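(* Let $\mathfrak n=\mathfrak p^2\mathfrak m$, where $\mathfrak p\lhd A$ is prime and $\mathfrak m\lhd A$ is a proper nonzero ideal (not necessarily coprime to $\mathfrak p$). Then $p$ divides $\#\mathbb T(\mathfrak n)/\mathfrak E(\mathfrak n)$, and hence also $\#\mathbb T(\mathfrak n)^0/\mathfrak E(\mathfrak n)^0$.
   Context: $q$ is a power of the prime $p$, $A=\mathbb F_q[T]$; ideals are identified with monic generators, $|\mathfrak n|=\#A/\mathfrak n$. $\Gamma_0(\mathfrak n)=\{\begin{pmatrix}a&b\\c&d\end{pmatrix}\in\mathrm{GL}_2(A):c\in\mathfrak n\}$. $\mathcal H_0(\mathfrak n,\mathbb Z)$ is the group of $\Gamma_0(\mathfrak n)$-invariant $\mathbb Z$-valued harmonic cochains on the Bruhat–Tits tree of $\mathrm{PGL}_2(\mathbb F_q((1/T)))$ with finite support modulo $\Gamma_0(\mathfrak n)$. Hecke operators: $f|T_\mathfrak m=\sum f|\begin{pmatrix}a&b\\0&d\end{pmatrix}$ over $a,b,d\in A$, $a,d$ monic, $(ad)=\mathfrak m$, $(a)+\mathfrak n=A$, $\deg b<\deg d$, where $(f|\gamma)(e)=f(\gamma e)$. $\mathbb T(\mathfrak n)$ is the $\mathbb Z$-algebra generated by all $T_\mathfrak m$ acting on $\mathcal H_0(\mathfrak n,\mathbb Z)$; $\mathbb T(\mathfrak n)^0$ is the subalgebra generated by $T_\mathfrak m$ with $\mathfrak m$ coprime to $\mathfrak n$. $\mathfrak E(\mathfrak n)$ (resp. $\mathfrak E(\mathfrak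 n)^0$) is the ideal of $\mathbb T(\mathfrak n)$ (resp. $\mathbb T(\mathfrak n)^0$) generated by $T_\mathfrak q-|\mathfrak q|-1$ for primes $\mathfrak q\nmid\mathfrak n$. *)

theory Defs
  imports
    "HOL-Analysis.Analysis"
    "HOL-Computational_Algebra.Computational_Algebra"
    "HOL-Algebra.Generated_Rings"
begin

text \<open>
  The finite field \<open>\<bbbF>\<^sub>q\<close> is a type \<open>'a::{field,finite}\<close>, \<open>A = \<bbbF>\<^sub>q[T]\<close> is \<open>'a poly\<close>, and the
  completion \<open>\<bbbF>\<^sub>q((1/T))\<close> is \<open>'a fls\<close>, whose variable \<open>fls_X\<close> is the uniformizer \<open>1/T\<close>; thus \<open>T\<close>
  is embedded as \<open>fls_X_inv\<close>. Nonzero ideals of \<open>A\<close> are represented by their monic generators.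
\<close>

definition poly_to_fls :: "'a::field poly \<Rightarrow> 'a fls" where
  "poly_to_fls f = poly (map_poly fls_const f) fls_X_inv"

definition monic :: "'a::{field,finite} poly \<Rightarrow> bool" where
  "monic f \<longleftrightarrow> lead_coeff f = 1"

definition ideal_norm :: "'a::{field,finite} poly \<Rightarrow> nat" where
  "ideal_norm n = card (UNIV // {(x, y). n dvd x - y})"


subsection \<open>The Bruhat--Tits tree\<close>

text \<open>
  Vertices are homothety classes of lattices in the plane of column vectors. The valuation ring is
  \<open>fls_subdegree x \<ge> 0\<close>, which includes \<open>0\<close> because \<open>fls_subdegree 0 = 0\<close>. Oriented edges are
  ordered pairs of adjacent vertices, (origin, terminus), so reversing an edge swaps the pair.
\<close>

type_synonym 'a lattice = "('a fls ^ 2) set"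
type_synonym 'a vertex = "'a lattice set"
type_synonym 'a edge = "'a vertex \<times> 'a vertex"

definition is_lattice :: "'a::{field,finite} lattice \<Rightarrow> bool" where
  "is_lattice L \<longleftrightarrow> (\<exists>g :: 'a fls ^ 2 ^ 2. invertible g \<and>
     L = {g *v x | x. \<forall>i. fls_subdegree (x $ i) \<ge> 0})"

definition homothety_class :: "'a::{field,finite} lattice \<Rightarrow> 'a vertex" where
  "homothety_class L = {(\<lambda>x. c *s x) ` L | c. c \<noteq> 0}"

definition vertices :: "'a::{field,finite} vertex set" where
  "vertices = {homothety_class L | L. is_lattice L}"

definition adjacent :: "'a::{field,finite} vertex \<Rightarrow> 'a vertex \<Rightarrow> bool" where
  "adjacent v w \<longleftrightarrow> (\<exists>L\<in>v. \<exists>M\<in>w. (\<lambda>x. fls_X *s x) ` L \<subset> M \<and> M \<subset> L)"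

definition edges :: "'a::{field,finite} edge set" where
  "edges = {(v, w). v \<in> vertices \<and> w \<in> vertices \<and> adjacent v w}"

definition vertex_act :: "'a::{field,finite} poly ^ 2 ^ 2 \<Rightarrow> 'a vertex \<Rightarrow> 'a vertex" where
  "vertex_act \<gamma> v = (\<lambda>L. (\<lambda>x. map_matrix poly_to_fls \<gamma> *v x) ` L) ` v"

definition edge_act :: "'a::{field,finite} poly ^ 2 ^ 2 \<Rightarrow> 'a edge \<Rightarrow> 'a edge" where
  "edge_act \<gamma> e = (vertex_act \<gamma> (fst e), vertex_act \<gamma> (snd e))"


subsection \<open>Harmonic cochains and Hecke operators\<close>

definition Gamma0 :: "'a::{field,finite} poly \<Rightarrow> ('a poly ^ 2 ^ 2) set" where
  "Gamma0 n = {\<gamma>. det \<gamma> dvd 1 \<and> n dvd \<gamma> $ 2 $ 1}"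

text \<open>
  Cochains are total functions on pairs of vertices, normalized to vanish on pairs that are not edges.
\<close>

definition harmonic :: "('a::{field,finite} edge \<Rightarrow> int) \<Rightarrow> bool" where
  "harmonic f \<longleftrightarrow>
     (\<forall>e. e \<notin> edges \<longrightarrow> f e = 0) \<and>
     (\<forall>v w. (v, w) \<in> edges \<longrightarrow> f (v, w) + f (w, v) = 0) \<and>
     (\<forall>v\<in>vertices. (\<Sum>w | (v, w) \<in> edges. f (v, w)) = 0)"

definition H0 :: "'a::{field,finite} poly \<Rightarrow> ('a edge \<Rightarrow> int) set" where
  "H0 n = {f. harmonic f \<and>
     (\<forall>\<gamma>\<in>Gamma0 n. \<forall>e\<in>edges. f (edge_act \<gamma> e) = f e) \<and>
     (\<exists>S. finite S \<and> S \<subseteq> edges \<and>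
        (\<forall>e\<in>edges. f e \<noteq> 0 \<longrightarrow> (\<exists>\<gamma>\<in>Gamma0 n. \<exists>s\<in>S. e = edge_act \<gamma> s)))}"

text \<open>
  In the index set below the disjunct \<open>b = 0\<close> accounts for the convention \<open>deg 0 = -\<infinity>\<close>: it is
  needed for \<open>d = 1\<close>, since \<open>degree 0 = 0\<close> here.
\<close>

definition hecke :: "'a::{field,finite} poly \<Rightarrow> 'a poly \<Rightarrow> ('a edge \<Rightarrow> int) \<Rightarrow> 'a edge \<Rightarrow> int" where
  "hecke n m = (\<lambda>f\<in>H0 n. \<lambda>e.
     \<Sum>(a, b, d) | monic a \<and> monic d \<and> a * d = m \<and> coprime a n \<and> (b = 0 \<or> degree b < degree d).
       f (edge_act (vector [vector [a, b], vector [0, d]]) e))"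

text \<open>
  The ring of endomorphisms of the abelian group \<open>H0 n\<close>. Endomorphisms are taken to be undefined
  outside \<open>H0 n\<close>, so that equality in the ring is equality on \<open>H0 n\<close>.
\<close>

definition End_H0 :: "'a::{field,finite} poly \<Rightarrow> (('a edge \<Rightarrow> int) \<Rightarrow> 'a edge \<Rightarrow> int) ring" where
  "End_H0 n =
     \<lparr>carrier = {F \<in> H0 n \<rightarrow>\<^sub>E H0 n. \<forall>f\<in>H0 n. \<forall>g\<in>H0 n. F (\<lambda>e. f e + g e) = (\<lambda>e. F f e + F g e)},
      mult = (\<lambda>F G. compose (H0 n) F G),
      one = (\<lambda>f\<in>H0 n. f),
      zero = (\<lambda>f\<in>H0 n. \<lambda>e. 0),
      add = (\<lambda>F G. \<lambda>f\<in>H0 n. \<lambda>e. F f e + G f e)\<rparr>"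

definition hecke_algebra where
  "hecke_algebra n = (End_H0 n)
     \<lparr>carrier := generate_ring (End_H0 n) {hecke n m | m. monic m}\<rparr>"

definition hecke_algebra0 where
  "hecke_algebra0 n = (End_H0 n)
     \<lparr>carrier := generate_ring (End_H0 n) {hecke n m | m. monic m \<and> coprime m n}\<rparr>"

definition eisenstein_gens where
  "eisenstein_gens n =
     {hecke n q \<ominus>\<^bsub>End_H0 n\<^esub> [ideal_norm q] \<cdot>\<^bsub>End_H0 n\<^esub> \<one>\<^bsub>End_H0 n\<^esub> \<ominus>\<^bsub>End_H0 n\<^esub> \<one>\<^bsub>End_H0 n\<^esub>
      | q. monic q \<and> prime_elem q \<and> \<not> q dvd n}"

definition eisenstein_ideal where
  "eisenstein_ideal n = Idl\<^bsub>hecke_algebra n\<^esub> (eisenstein_gens n)"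

definition eisenstein_ideal0 where
  "eisenstein_ideal0 n = Idl\<^bsub>hecke_algebra0 n\<^esub> (eisenstein_gens n)"

end

theory Submission
  imports Defs
begin

text \<open>
  For a prime \<open>q\<close> not dividing \<open>n\<close>, the operator \<open>T\<^sub>q - |q| - 1\<close> is injective on \<open>H0 n\<close>: an eigencochain
  with eigenvalue \<open>|q| + 1\<close> keeps its maximal absolute value along \<open>e, diag(q, 1) e, diag(q\<^sup>2, 1) e, \<dots>\<close>,
  which runs into a cusp, where the cochain vanishes. As \<open>H0 n\<close> is finitely generated, the Eisenstein ideal
  then contains a nonzero integer, so the quotient is finite. A prime \<open>p\<close> divides its order as soon as
  some \<open>f\<close> in \<open>H0 n\<close> is not divisible by \<open>p\<close> but satisfies \<open>T\<^sub>q f \<equiv> (|q| + 1) f\<close> modulo \<open>p\<close>.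

  Such an \<open>f\<close> is built from a prime \<open>y\<close> dividing \<open>m\<close>. An Eisenstein cochain of level \<open>y\<close>, whose values are
  modulo \<open>p\<close> differences of successive maxima of lattices, has the right eigenvalues, but it does not vanish
  at the cusps. A flow along the geodesics joining \<open>\<sigma> \<infinity>\<close> to \<open>\<sigma> 0\<close>, weighted by congruence conditions
  on \<open>\<sigma>\<close> modulo \<open>P\<close>, cancels its values there after multiplication by \<open>|P|\<close>, hence without any effect
  modulo \<open>p\<close>. The result is invariant under matrices with upper right entry divisible by \<open>P\<close> and lower
  left entry divisible by \<open>P y\<close>, and translation by \<open>diag(P, 1)\<close> turns this into level \<open>P\<^sup>2 y\<close>.
\<close>

text \<open>The obstacle is to kill the cusp values without touching the cochain modulo
  \<open>p\<close>. The unweighted flow along all geodesics from \<open>Gamma0 y\<close> would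
  cancel them, but with the coefficient \<open>Q ^ degree y - 1\<close>, a unit modulo
  \<open>p\<close>. The cusp values see the weights only through their sums over unipotent cosets.
  So the weight 1 may be traded for \<open>|P|\<close> times an integral weight that sums to 1, not
  to \<open>|P|\<close>, over the residues modulo \<open>P\<close>. Such a weight is not constant:
  it needs congruences modulo \<open>P\<close> at both ends of the geodesic, hence a factor
  \<open>P\<close> in each off-diagonal corner. This is why \<open>P ^ 2\<close> enters the level.
  The potential behind the Eisenstein cochain is modelled on the logarithm of the absolute value of
  the Drinfeld discriminant, whose weight \<open>Q ^ 2 - 1\<close> reappears in
  \<open>eis_pot_scale\<close>. The resulting cochain is controlled modulo \<open>p\<close> only
  under the operators at primes not dividing \<open>n\<close>; at the other primes it need not be an
  eigencochain. So divisibility is not read off from a homomorphism of the Hecke algebra to a field,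
  but from the action on all cochains with the same congruences.\<close>

no_notation fps_nth (infixl "$" 75)
notation fls_nth (infixl "$$" 75)
hide_const (open) up_ring.coeff up_ring.monom module.smult

section \<open>Matrices and valuations over the completion\<close>

section \<open>Two by two matrices\<close>

definition M2 :: "'r \<Rightarrow> 'r \<Rightarrow> 'r \<Rightarrow> 'r \<Rightarrow> 'r::zero^2^2" where
  "M2 a b c d = vector [vector [a, b], vector [c, d]]"

definition V2 :: "'r \<Rightarrow> 'r \<Rightarrow> 'r::zero^2" where
  "V2 a b = vector [a, b]"

lemma M2_nth [simp]:
  "M2 a b c d $ 1 $ 1 = a" "M2 a b c d $ 1 $ 2 = b" "M2 a b c d $ 2 $ 1 = c" "M2 a b c d $ 2 $ 2 = d"
  by (simp_all add: M2_def)

lemma V2_nth [simp]: "V2 a b $ 1 = a" "V2 a b $ 2 = b"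
  by (simp_all add: V2_def)

lemma vec2_eq_iff: "(x::'r^2) = y \<longleftrightarrow> x $ 1 = y $ 1 \<and> x $ 2 = y $ 2"
  by (simp add: vec_eq_iff forall_2)

lemma mat2_eq_iff:
  "(x::'r^2^2) = y \<longleftrightarrow> x$1$1 = y$1$1 \<and> x$1$2 = y$1$2 \<and> x$2$1 = y$2$1 \<and> x$2$2 = y$2$2"
  by (auto simp add: vec_eq_iff forall_2)

lemma M2_eta: "M2 (m$1$1) (m$1$2) (m$2$1) (m$2$2) = m"
  by (simp add: mat2_eq_iff)

lemma V2_eta: "V2 (x$1) (x$2) = x"
  by (simp add: vec2_eq_iff)

lemma M2_cases: obtains a b c d where "m = M2 a b c d"
  using M2_eta[of m] by metis

lemma M2_inject: "M2 a b c d = M2 a' b' c' d' \<longleftrightarrow> a = a' \<and> b = b' \<and> c = c' \<and> d = d'"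
  by (simp add: mat2_eq_iff)

lemma matmul2_nth:
  "((A::'r::semiring_1^2^2) ** B) $ i $ j = A$i$1 * B$1$j + A$i$2 * B$2$j"
  by (simp add: matrix_matrix_mult_def sum_2)

lemma matvec2_nth:
  "((A::'r::semiring_1^2^2) *v x) $ i = A$i$1 * x$1 + A$i$2 * x$2"
  by (simp add: matrix_vector_mult_def sum_2)

lemma M2_mult:
  "(M2 a b c d :: 'r::semiring_1^2^2) ** M2 a' b' c' d' =
   M2 (a*a' + b*c') (a*b' + b*d') (c*a' + d*c') (c*b' + d*d')"
  by (simp add: mat2_eq_iff matmul2_nth)

lemma M2_mulv:
  "(M2 a b c d :: 'r::semiring_1^2^2) *v x = V2 (a * x$1 + b * x$2) (c * x$1 + d * x$2)"
  by (simp add: vec2_eq_iff matvec2_nth)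

lemma mat_M2: "mat c = M2 c 0 0 c"
  by (simp add: mat2_eq_iff mat_def)

lemma det_M2 [simp]: "det (M2 a b c d :: 'r::comm_ring_1^2^2) = a * d - b * c"
  by (simp add: det_2)

lemma det_mat2 [simp]: "det (mat c :: 'r::comm_ring_1^2^2) = c * c"
  by (simp add: mat_M2)

lemma mat_mulv2: "(mat c :: 'r::semiring_1^2^2) *v x = c *s x"
  by (simp add: mat_M2 M2_mulv vec2_eq_iff)

lemma mat_mult2: "(mat c :: 'r::semiring_1^2^2) ** mat d = mat (c * d)"
  by (simp add: mat_M2 M2_mult)

lemma mat_comm2: "(mat c :: 'r::comm_ring_1^2^2) ** (A :: 'r^2^2) = A ** mat c"
  unfolding mat_M2 by (simp add: mat2_eq_iff matmul2_nth mult.commute)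

definition adj2 :: "'r::comm_ring_1^2^2 \<Rightarrow> 'r^2^2" where
  "adj2 m = M2 (m$2$2) (- (m$1$2)) (- (m$2$1)) (m$1$1)"

lemma adj2_left: "adj2 m ** m = mat (det m)"
  by (simp add: adj2_def mat_M2 mat2_eq_iff matmul2_nth det_2 algebra_simps)

lemma adj2_right: "m ** adj2 m = mat (det m)"
  by (simp add: adj2_def mat_M2 mat2_eq_iff matmul2_nth det_2 algebra_simps)

lemma det_adj2 [simp]: "det (adj2 m) = det m"
  by (simp add: adj2_def det_2 algebra_simps)

text \<open>Given by the adjugate, so that integrality of an inverse can be read off from the
  entries and the determinant.\<close>

definition inv2 :: "'r::field^2^2 \<Rightarrow> 'r^2^2" where
  "inv2 m = mat (1 / det m) ** adj2 m"

lemma inv2_left: "det m \<noteq> 0 \<Longrightarrow> inv2 m ** m = mat 1"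
  unfolding inv2_def by (simp add: matrix_mul_assoc[symmetric] adj2_left mat_mult2)

lemma inv2_right: "det m \<noteq> 0 \<Longrightarrow> m ** inv2 m = mat 1"
  using inv2_left matrix_left_right_inverse by blast

lemma inv2_unique: "det m \<noteq> 0 \<Longrightarrow> m ** n = mat 1 \<Longrightarrow> n = inv2 m"
  by (metis inv2_left matrix_mul_assoc matrix_mul_lid matrix_mul_rid)

lemma inv2_mult: "det m \<noteq> 0 \<Longrightarrow> det n \<noteq> 0 \<Longrightarrow> inv2 (m ** n) = inv2 n ** inv2 m"
  by (rule inv2_unique[symmetric])
     (simp_all add: det_mul matrix_mul_assoc inv2_right, metis inv2_right matrix_mul_assoc matrix_mul_rid)

lemma det_inv2: "det m \<noteq> 0 \<Longrightarrow> det (inv2 m) = 1 / det m"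
  by (simp add: inv2_def det_mul)

lemma inv2_mat: "c \<noteq> 0 \<Longrightarrow> inv2 (mat c) = mat (1 / c)"
  by (rule inv2_unique[symmetric]) (simp_all add: mat_mult2)

lemma inv2_inv2: "det m \<noteq> 0 \<Longrightarrow> inv2 (inv2 m) = m"
  by (rule inv2_unique[symmetric]) (simp_all add: det_inv2 inv2_left)

lemma inv2_M2:
  "a * d - b * c \<noteq> 0 \<Longrightarrow> inv2 (M2 a b c d) =
    M2 (d / (a*d - b*c)) (- b / (a*d - b*c)) (- c / (a*d - b*c)) (a / (a*d - b*c))"
  by (simp add: inv2_def adj2_def mat_M2 M2_mult)

lemma inv2_mulv [simp]: "det m \<noteq> 0 \<Longrightarrow> inv2 m *v (m *v x) = x" "det m \<noteq> 0 \<Longrightarrow> m *v (inv2 m *v x) = x"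
  by (simp_all add: matrix_vector_mul_assoc inv2_left inv2_right)

lemma inv2_mulm [simp]: "det m \<noteq> 0 \<Longrightarrow> inv2 m ** (m ** x) = x" "det m \<noteq> 0 \<Longrightarrow> m ** (inv2 m ** x) = x"
  by (simp_all add: matrix_mul_assoc inv2_left inv2_right)

lemma mulv_eq_0 [simp]: "det (m::'r::field^2^2) \<noteq> 0 \<Longrightarrow> m *v x = 0 \<longleftrightarrow> x = 0"
  by (metis inv2_mulv(1) matrix_vector_mult_0_right)

section \<open>Polynomials inside Laurent series\<close>

lemma pf_0 [simp]: "poly_to_fls 0 = 0"
  by (simp add: poly_to_fls_def)

lemma pf_pCons: "poly_to_fls (pCons c f) = fls_const c + fls_X_inv * poly_to_fls f"
  by (simp add: poly_to_fls_def map_poly_pCons)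

lemma pf_nth: "poly_to_fls f $$ k = (if k \<le> 0 then coeff f (nat (- k)) else 0)"
proof (induction f arbitrary: k)
  case 0
  then show ?case by simp
next
  case (pCons c f)
  have *: "(fls_X_inv * poly_to_fls f) $$ k = poly_to_fls f $$ (k + 1)"
    by (simp add: fls_X_inv_times_conv_shift)
  show ?case
    unfolding pf_pCons fls_plus_nth *
    by (auto simp: pCons.IH coeff_pCons nat_eq_iff split: nat.split)
qed

lemma pf_add: "poly_to_fls (f + g) = poly_to_fls f + poly_to_fls g"
  by (rule fls_eqI) (simp add: pf_nth)

lemma pf_diff: "poly_to_fls (f - g) = poly_to_fls f - poly_to_fls g"
  by (rule fls_eqI) (simp add: pf_nth)

lemma pf_smult: "poly_to_fls (smult c g) = fls_const c * poly_to_fls g"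
  by (rule fls_eqI) (simp add: pf_nth)

lemma pf_mult: "poly_to_fls (f * g) = poly_to_fls f * poly_to_fls g"
  by (induction f) (simp_all add: pf_pCons pf_add pf_smult algebra_simps)

lemma pf_1 [simp]: "poly_to_fls 1 = 1"
  by (simp add: one_pCons pf_pCons)

lemma pf_const: "poly_to_fls [:c:] = fls_const c"
  by (simp add: pf_pCons)

lemma pf_eq_iff [simp]: "poly_to_fls f = poly_to_fls g \<longleftrightarrow> f = g"
proof
  assume "poly_to_fls f = poly_to_fls g"
  then have "poly_to_fls f $$ (- int n) = poly_to_fls g $$ (- int n)" for n by simp
  then show "f = g" by (simp add: pf_nth poly_eq_iff)
qed simp

lemma pf_eq_0 [simp]: "poly_to_fls f = 0 \<longleftrightarrow> f = 0"
  using pf_eq_iff[of f 0] by (simp del: pf_eq_iff)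

lemma pf_subdegree: "fls_subdegree (poly_to_fls f) = - int (degree f)"
proof (cases "f = 0")
  case False
  then show ?thesis
    by (intro fls_subdegree_eqI) (auto simp: pf_nth intro: coeff_eq_0)
qed simp

abbreviation em :: "'a::{field,finite} poly^2^2 \<Rightarrow> 'a fls^2^2" where
  "em \<equiv> map_matrix poly_to_fls"

definition ev :: "'a::{field,finite} poly^2 \<Rightarrow> 'a fls^2" where
  "ev x = (\<chi> i. poly_to_fls (x $ i))"

lemma ev_nth [simp]: "ev x $ i = poly_to_fls (x $ i)"
  by (simp add: ev_def)

lemma ev_V2: "ev (V2 a b) = V2 (poly_to_fls a) (poly_to_fls b)"
  by (simp add: vec2_eq_iff)

lemma em_M2: "em (M2 a b c d) = M2 (poly_to_fls a) (poly_to_fls b) (poly_to_fls c) (poly_to_fls d)"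
  by (simp add: mat2_eq_iff)

lemma em_mult: "em (A ** B) = em A ** em B"
  by (simp add: mat2_eq_iff matmul2_nth pf_add pf_mult)

lemma em_mulv: "ev (A *v x) = em A *v ev x"
  by (simp add: vec2_eq_iff matvec2_nth pf_add pf_mult)

lemma em_mat: "em (mat c) = mat (poly_to_fls c)"
  by (simp add: mat_M2 em_M2)

lemma det_em [simp]: "det (em A) = poly_to_fls (det A)"
  by (simp add: det_2 pf_diff pf_mult)

lemma ev_eq_0 [simp]: "ev x = 0 \<longleftrightarrow> x = 0"
  by (simp add: vec2_eq_iff)

lemma ev_add: "ev (x + y) = ev x + ev y"
  by (simp add: vec2_eq_iff pf_add)

lemma ev_smult: "ev (c *s x) = poly_to_fls c *s ev x"
  by (simp add: vec2_eq_iff pf_mult)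

section \<open>Orders of vanishing\<close>

text \<open>The valuation as a predicate: \<open>0\<close> has order at least \<open>j\<close> for
  every \<open>j\<close>, although \<open>fls_subdegree 0 = 0\<close>. Sums and products then need
  no case distinction.\<close>

definition oge :: "int \<Rightarrow> 'a::field fls \<Rightarrow> bool" where
  "oge j x \<longleftrightarrow> (\<forall>n<j. x $$ n = 0)"

lemma oge_iff: "oge j x \<longleftrightarrow> x = 0 \<or> j \<le> fls_subdegree x"
  unfolding oge_def
  by (meson fls_eq0_below_subdegree fls_subdegree_geI fls_zero_nth leD leI nth_fls_subdegree_zero_iff order_less_le_trans)

lemma oge_0_iff: "oge 0 x \<longleftrightarrow> 0 \<le> fls_subdegree x"
  by (auto simp: oge_iff)

lemma oge_zero [simp]: "oge j 0"
  by (simp add: oge_def)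

lemma oge_add: "oge j x \<Longrightarrow> oge j y \<Longrightarrow> oge j (x + y)"
  by (simp add: oge_def)

lemma oge_diff: "oge j x \<Longrightarrow> oge j y \<Longrightarrow> oge j (x - y)"
  by (simp add: oge_def)

lemma oge_minus [simp]: "oge j (- x) \<longleftrightarrow> oge j x"
  by (simp add: oge_def)

lemma oge_mult: "oge i x \<Longrightarrow> oge j y \<Longrightarrow> oge (i + j) (x * y)"
  by (cases "x = 0 \<or> y = 0") (auto simp: oge_iff)

lemma oge_mult0: "oge 0 x \<Longrightarrow> oge j y \<Longrightarrow> oge j (x * y)"
  using oge_mult[of 0 x j y] by simp

lemma oge_pf: "oge j (poly_to_fls f) \<longleftrightarrow> f = 0 \<or> j \<le> - int (degree f)"
  by (simp add: oge_iff pf_subdegree)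

lemma oge_1 [simp]: "oge 0 1"
  by (simp add: oge_iff)

lemma oge_const [simp]: "oge 0 (fls_const c)"
  by (simp add: oge_def)

lemma oge_mult_left: "c \<noteq> 0 \<Longrightarrow> oge j (c * x) \<longleftrightarrow> oge (j - fls_subdegree c) x"
  by (cases "x = 0") (auto simp: oge_iff)

lemma oge_Suc: "oge (j + 1) x \<longleftrightarrow> oge j x \<and> x $$ j = 0"
  unfolding oge_def by (metis add.commute zle_add1_eq_le add1_zle_eq less_le order_less_le_trans zless_add1_eq)

definition oge2 :: "int \<Rightarrow> 'a::field fls^2 \<Rightarrow> bool" where
  "oge2 j u \<longleftrightarrow> oge j (u$1) \<and> oge j (u$2)"

text \<open>The sup norm in logarithmic form. Zero coordinates are skipped, since the convention
  \<open>fls_subdegree 0 = 0\<close> would spoil the minimum; the value at the zero vector has no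
  meaning.\<close>

definition ord2 :: "'a::field fls^2 \<Rightarrow> int" where
  "ord2 u = (if u$1 = 0 then fls_subdegree (u$2) else if u$2 = 0 then fls_subdegree (u$1)
             else min (fls_subdegree (u$1)) (fls_subdegree (u$2)))"

lemma oge2_ord2: "u \<noteq> 0 \<Longrightarrow> oge2 j u \<longleftrightarrow> j \<le> ord2 u"
  by (auto simp: oge2_def ord2_def oge_iff vec2_eq_iff)

lemma oge2_zero [simp]: "oge2 j 0"
  by (simp add: oge2_def)

lemma ord2_eqI: "u \<noteq> 0 \<Longrightarrow> oge2 j u \<Longrightarrow> \<not> oge2 (j + 1) u \<Longrightarrow> ord2 u = j"
  by (simp add: oge2_ord2)

lemma ord2_eqI': "u \<noteq> 0 \<Longrightarrow> v \<noteq> 0 \<Longrightarrow> (\<And>j. oge2 j u \<longleftrightarrow> oge2 (j - c) v) \<Longrightarrow> ord2 u = ord2 v + c"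
proof -
  assume a: "u \<noteq> 0" "v \<noteq> 0" and "\<And>j. oge2 j u \<longleftrightarrow> oge2 (j - c) v"
  then have "\<And>j. j \<le> ord2 u \<longleftrightarrow> j - c \<le> ord2 v" by (simp add: oge2_ord2)
  from this[of "ord2 u"] this[of "ord2 v + c"] show ?thesis by simp
qed

lemma ord2_scale: "c \<noteq> 0 \<Longrightarrow> u \<noteq> 0 \<Longrightarrow> ord2 (c *s u) = ord2 u + fls_subdegree c"
  by (rule ord2_eqI') (auto simp: oge2_def oge_mult_left vec2_eq_iff)

section \<open>The group of integral matrices\<close>

definition intM :: "'a::field fls^2^2 \<Rightarrow> bool" where
  "intM k \<longleftrightarrow> (\<forall>i j. oge 0 (k $ i $ j))"

text \<open>The general linear group over the valuation ring, which is the stabilizer of the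
  standard lattice.\<close>

definition GLO :: "('a::field fls^2^2) set" where
  "GLO = {k. intM k \<and> det k \<noteq> 0 \<and> fls_subdegree (det k) = 0}"

lemma intM_M2 [simp]: "intM (M2 a b c d) \<longleftrightarrow> oge 0 a \<and> oge 0 b \<and> oge 0 c \<and> oge 0 d"
  by (auto simp: intM_def forall_2)

lemma intM_mult: "intM a \<Longrightarrow> intM b \<Longrightarrow> intM (a ** b)"
  unfolding intM_def matmul2_nth by (simp add: oge_add oge_mult0)

lemma intM_det: "intM a \<Longrightarrow> oge 0 (det a)"
  unfolding intM_def det_2 by (simp add: oge_diff oge_mult0)

lemma intM_inv2: "intM k \<Longrightarrow> det k \<noteq> 0 \<Longrightarrow> fls_subdegree (det k) = 0 \<Longrightarrow> intM (inv2 k)"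
  unfolding inv2_def adj2_def
  by (intro intM_mult) (simp_all add: mat_M2, simp_all add: intM_def oge_iff divide_inverse)

lemma GLO_inv2: "a \<in> GLO \<Longrightarrow> inv2 a \<in> GLO"
  by (simp add: GLO_def intM_inv2 det_inv2 divide_inverse)

lemma GLO_det: "a \<in> GLO \<Longrightarrow> det a \<noteq> 0"
  by (simp add: GLO_def)

lemma GLO_det0: "a \<in> GLO \<Longrightarrow> fls_subdegree (det a) = 0"
  by (simp add: GLO_def)

lemma GLO_1 [simp]: "mat 1 \<in> GLO"
  by (simp add: GLO_def mat_M2)

lemma GLO_iff_inv2: "det k \<noteq> 0 \<Longrightarrow> k \<in> GLO \<longleftrightarrow> intM k \<and> intM (inv2 k)"
proof
  assume d: "det k \<noteq> 0" and i: "intM k \<and> intM (inv2 k)"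
  have "oge 0 (det k)" "oge 0 (det (inv2 k))" using i intM_det by blast+
  then show "k \<in> GLO" using d i by (auto simp: GLO_def det_inv2 oge_iff divide_inverse)
qed (use GLO_inv2 in \<open>auto simp: GLO_def\<close>)

declare GLO_det [simp]

lemma intM_mulv: "intM k \<Longrightarrow> oge2 j u \<Longrightarrow> oge2 j (k *v u)"
  by (simp add: oge2_def matvec2_nth intM_def oge_add oge_mult0)

lemma GLO_oge2: "k \<in> GLO \<Longrightarrow> oge2 j (k *v u) \<longleftrightarrow> oge2 j u"
  by (metis GLO_det GLO_iff_inv2 intM_mulv inv2_mulv(1))

lemma GLO_ord2: "k \<in> GLO \<Longrightarrow> u \<noteq> 0 \<Longrightarrow> ord2 (k *v u) = ord2 u"
  using ord2_eqI'[of "k *v u" u 0] by (simp add: GLO_oge2)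

section \<open>The tree: lattice classes and their neighbours\<close>

section \<open>Lattices and vertices\<close>

definition lat :: "'a::{field,finite} fls^2^2 \<Rightarrow> 'a lattice" where
  "lat g = {g *v x | x. oge2 0 x}"

definition vtx :: "'a::{field,finite} fls^2^2 \<Rightarrow> 'a vertex" where
  "vtx g = homothety_class (lat g)"

definition vact :: "'a::{field,finite} fls^2^2 \<Rightarrow> 'a vertex \<Rightarrow> 'a vertex" where
  "vact m v = (\<lambda>L. (\<lambda>x. m *v x) ` L) ` v"

lemma lat_image: "lat g = (\<lambda>x. g *v x) ` {x. oge2 0 x}"
  by (auto simp: lat_def)

lemma lat_mult: "(\<lambda>x. m *v x) ` lat g = lat (m ** g)"
  by (auto simp: lat_image image_image matrix_vector_mul_assoc)

lemma lat_scale: "(\<lambda>x. c *s x) ` lat g = lat (mat c ** g)"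
  using lat_mult[of "mat c" g] by (simp add: mat_mulv2)

lemma mem_lat: "det g \<noteq> 0 \<Longrightarrow> x \<in> lat g \<longleftrightarrow> oge2 0 (inv2 g *v x)"
  unfolding lat_def by (auto, metis inv2_mulv(2))

lemma is_lattice_iff: "is_lattice L \<longleftrightarrow> (\<exists>g. det g \<noteq> 0 \<and> L = lat g)"
  unfolding is_lattice_def lat_def oge2_def by (simp add: invertible_det_nz oge_0_iff forall_2)

lemma vtx_mem: "L \<in> vtx g \<longleftrightarrow> (\<exists>c. c \<noteq> 0 \<and> L = lat (mat c ** g))"
  by (auto simp: vtx_def homothety_class_def lat_scale)

lemma vertices_eq: "vertices = {vtx g | g. det g \<noteq> 0}"
  unfolding vertices_def vtx_def is_lattice_iff by blast

lemma vtx_in_vertices [simp]: "det g \<noteq> 0 \<Longrightarrow> vtx g \<in> vertices"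
  by (auto simp: vertices_eq)

lemma vertices_cases: assumes "v \<in> vertices" obtains g where "det g \<noteq> 0" "v = vtx g"
  using assms by (auto simp: vertices_eq)

lemma lat_subset: "det g \<noteq> 0 \<Longrightarrow> lat h \<subseteq> lat g \<longleftrightarrow> intM (inv2 g ** h)"
proof
  assume d: "det g \<noteq> 0" and s: "lat h \<subseteq> lat g"
  have "oge2 0 (inv2 g *v (h *v x))" if "oge2 0 x" for x
    using that s mem_lat[OF d] by (auto simp: lat_def)
  from this[of "V2 1 0"] this[of "V2 0 1"] show "intM (inv2 g ** h)"
    by (simp add: oge2_def matrix_vector_mul_assoc matvec2_nth intM_def forall_2)
next
  assume d: "det g \<noteq> 0" and s: "intM (inv2 g ** h)"
  show "lat h \<subseteq> lat g"
    using mem_lat[OF d] intM_mulv[OF s] by (auto simp: lat_def matrix_vector_mul_assoc)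
qed

lemma lat_eq_iff: "det g \<noteq> 0 \<Longrightarrow> det h \<noteq> 0 \<Longrightarrow> lat h = lat g \<longleftrightarrow> (\<exists>k\<in>GLO. h = g ** k)"
proof
  assume d: "det g \<noteq> 0" "det h \<noteq> 0" and "lat h = lat g"
  then have "intM (inv2 g ** h)" "intM (inv2 h ** g)" using lat_subset by blast+
  moreover have "inv2 (inv2 g ** h) = inv2 h ** g" using d by (simp add: inv2_mult det_inv2 inv2_inv2)
  ultimately have "inv2 g ** h \<in> GLO" using d by (simp add: GLO_iff_inv2 det_mul det_inv2)
  then show "\<exists>k\<in>GLO. h = g ** k" using d by (intro bexI[of _ "inv2 g ** h"]) auto
next
  assume d: "det g \<noteq> 0" "det h \<noteq> 0" and "\<exists>k\<in>GLO. h = g ** k"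
  then obtain k where k: "k \<in> GLO" "h = g ** k" by blast
  have "inv2 g ** h = k" "inv2 h ** g = inv2 k" using d k by (simp_all add: inv2_mult matrix_mul_assoc[symmetric] inv2_left)
  then show "lat h = lat g" using lat_subset d k GLO_iff_inv2[of k] by (metis GLO_det subset_antisym)
qed

lemma homoth_scale:
  assumes "c \<noteq> 0" shows "homothety_class ((\<lambda>x. c *s x) ` L) = homothety_class L"
proof -
  have *: "(\<lambda>x. d *s x) ` (\<lambda>x. c *s x) ` L = (\<lambda>x. (d * c) *s x) ` L" for c d :: "'a fls" and L :: "'a lattice"
    by (simp add: image_image vector_smult_assoc)
  show ?thesis
  proof (safe)
    fix M assume "M \<in> homothety_class ((*s) c ` L)"
    then show "M \<in> homothety_class L" unfolding homothety_class_def using assms by (auto simp: *)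
  next
    fix M assume "M \<in> homothety_class L"
    then obtain d where "d \<noteq> 0" "M = (\<lambda>x. d *s x) ` L" unfolding homothety_class_def by blast
    then show "M \<in> homothety_class ((*s) c ` L)" unfolding homothety_class_def using assms
      by (auto simp: * intro!: exI[of _ "d / c"])
  qed
qed

lemma vtx_scale: "c \<noteq> 0 \<Longrightarrow> vtx (mat c ** g) = vtx g"
  unfolding vtx_def lat_scale[symmetric] by (rule homoth_scale)

lemma vtx_eq_iff:
  assumes "det g \<noteq> 0" "det h \<noteq> 0"
  shows "vtx h = vtx g \<longleftrightarrow> (\<exists>c. c \<noteq> 0 \<and> (\<exists>k\<in>GLO. h = mat c ** g ** k))"
proof
  assume "vtx h = vtx g"
  moreover have "lat h \<in> vtx h" by (subst vtx_mem) (auto intro!: exI[of _ 1])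
  ultimately obtain c where "c \<noteq> 0" "lat h = lat (mat c ** g)" by (auto simp: vtx_mem)
  then show "\<exists>c. c \<noteq> 0 \<and> (\<exists>k\<in>GLO. h = mat c ** g ** k)"
    using assms lat_eq_iff[of "mat c ** g" h] by (auto simp: det_mul)
next
  assume "\<exists>c. c \<noteq> 0 \<and> (\<exists>k\<in>GLO. h = mat c ** g ** k)"
  then obtain c k where c: "c \<noteq> 0" "k \<in> GLO" "h = mat c ** g ** k" by blast
  then have "lat h = lat (mat c ** g)" using assms by (subst lat_eq_iff) (auto simp: det_mul)
  then show "vtx h = vtx g" using vtx_scale[OF c(1)] by (simp add: vtx_def)
qed

lemma vtx_mult_GLO: "det g \<noteq> 0 \<Longrightarrow> k \<in> GLO \<Longrightarrow> vtx (g ** k) = vtx g"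
  by (subst vtx_eq_iff) (auto simp: det_mul intro!: exI[of _ 1] bexI[of _ k])

lemma vtx_image: "vtx g = (\<lambda>c. lat (mat c ** g)) ` {c. c \<noteq> 0}"
  by (auto simp: vtx_mem)

lemma vact_vtx: "vact m (vtx g) = vtx (m ** g)"
proof -
  have "m ** (mat c ** g) = mat c ** (m ** g)" for c
    by (metis mat_comm2 matrix_mul_assoc)
  then show ?thesis by (simp add: vact_def vtx_image image_image lat_mult)
qed

lemma vact_vact: "vact m (vact n v) = vact (m ** n) v"
  by (simp add: vact_def image_image matrix_vector_mul_assoc)

lemma vact_1 [simp]: "vact (mat 1) v = v"
  by (simp add: vact_def)

lemma vertex_act_eq: "vertex_act \<gamma> = vact (em \<gamma>)"
  by (simp add: fun_eq_iff vertex_act_def vact_def)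

lemma vact_inv [simp]: "det m \<noteq> 0 \<Longrightarrow> vact m (vact (inv2 m) v) = v" "det m \<noteq> 0 \<Longrightarrow> vact (inv2 m) (vact m v) = v"
  by (simp_all add: vact_vact inv2_left inv2_right)

section \<open>Neighbours in the tree\<close>

text \<open>The neighbours of \<open>vtx g\<close> are the vertices \<open>vtx (g ** nb i)\<close>, with \<open>i\<close> in the projective line over the residue field.\<close>

definition nb :: "'a::{field,finite} option \<Rightarrow> 'a fls^2^2" where
  "nb i = (case i of Some b \<Rightarrow> M2 fls_X (fls_const b) 0 1 | None \<Rightarrow> M2 1 0 0 fls_X)"

text \<open>The coefficient vector of order \<open>j\<close> of \<open>u\<close> lies on the line of
  the residue plane named by \<open>i\<close>: the line through \<open>(b, 1)\<close> for
  \<open>Some b\<close>, through \<open>(1, 0)\<close> for \<open>None\<close>. By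
  \<open>oge2_nb\<close> this is what membership in the neighbouring lattice demands in addition to
  \<open>oge2 j u\<close>.\<close>

definition hit :: "'a::{field,finite} option \<Rightarrow> int \<Rightarrow> 'a fls^2 \<Rightarrow> bool" where
  "hit i j u \<longleftrightarrow> (case i of Some b \<Rightarrow> (u$1) $$ j = b * (u$2) $$ j | None \<Rightarrow> (u$2) $$ j = 0)"

text \<open>The point of the projective line given by the leading coefficient vector. Towards this
  neighbour, and no other, the order of \<open>u\<close> does not drop.\<close>

definition ldir :: "'a::{field,finite} fls^2 \<Rightarrow> 'a option" where
  "ldir u = (if (u$2) $$ ord2 u = 0 then None else Some ((u$1) $$ ord2 u / (u$2) $$ ord2 u))"

text \<open>Minus the logarithm of the norm with unit ball \<open>lat g\<close>: for nonzero
  \<open>x\<close>, the largest \<open>j\<close> such that \<open>x\<close> lies in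
  \<open>fls_X ^ j\<close> times \<open>lat g\<close>.\<close>

definition nu :: "'a::{field,finite} fls^2^2 \<Rightarrow> 'a fls^2 \<Rightarrow> int" where
  "nu g x = ord2 (inv2 g *v x)"

lemma det_inv2_nz [simp]: "det m \<noteq> 0 \<Longrightarrow> det (inv2 m) \<noteq> 0"
  by (simp add: det_inv2)

lemma mat_left_comm2: "(A::'r::comm_ring_1^2^2) ** (mat c ** B) = mat c ** (A ** B)"
  by (simp add: matrix_mul_assoc mat_comm2[of c A])

lemma mul_left_cancel2: "det (g::'r::field^2^2) \<noteq> 0 \<Longrightarrow> g ** A = g ** B \<longleftrightarrow> A = B"
  by (metis inv2_mulm(1))

lemma mult_one_div: "(x::'r::field) \<noteq> 0 \<Longrightarrow> x * (1 / x) = 1"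
  by simp

lemma oge_divide: "y \<noteq> 0 \<Longrightarrow> oge 0 (x / y) \<longleftrightarrow> oge (fls_subdegree y) x"
  by (cases "x = 0") (simp_all add: oge_iff divide_inverse)

lemma inv2_upper: "x \<noteq> 0 \<Longrightarrow> inv2 (M2 x b 0 1) *v u = V2 (1 / x * (u$1 - b * u$2)) (u$2)"
  by (simp add: inv2_M2 M2_mulv vec2_eq_iff field_simps)

lemma inv2_lower: "x \<noteq> 0 \<Longrightarrow> inv2 (M2 1 0 0 x) *v u = V2 (u$1) (1 / x * u$2)"
  by (simp add: inv2_M2 M2_mulv vec2_eq_iff field_simps)

lemma det_nb [simp]: "det (nb i) = fls_X"
  by (simp add: nb_def split: option.split)

lemma oge_X0 [simp]: "oge 0 fls_X"
  by (simp add: oge_iff)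

lemma intM_nb [simp]: "intM (nb i)"
  by (simp add: nb_def split: option.split)

lemma oge2_nb: "oge2 j (inv2 (nb i) *v u) \<longleftrightarrow> oge2 j u \<and> hit i j u"
proof (cases i)
  case None
  have "oge j (1 / fls_X * u$2) \<longleftrightarrow> oge (j + 1) (u$2)"
    by (subst oge_mult_left) (auto simp: divide_inverse)
  then show ?thesis unfolding None
    by (auto simp: nb_def inv2_lower oge2_def hit_def oge_Suc simp del: times_divide_eq_left)
next
  case (Some b)
  have "oge j (u$1) \<and> oge j (u$2) \<longleftrightarrow> oge j (u$1 - fls_const b * u$2) \<and> oge j (u$2)"
    using oge_add[of j "u$1 - fls_const b * u$2" "fls_const b * u$2"]
      oge_diff[of j "u$1" "fls_const b * u$2"] oge_mult0[of "fls_const b" j "u$2"] by auto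
  moreover have "oge j (1 / fls_X * (u$1 - fls_const b * u$2)) \<longleftrightarrow> oge (j + 1) (u$1 - fls_const b * u$2)"
    by (subst oge_mult_left) (auto simp: divide_inverse)
  moreover have "(inv2 (nb i) *v u) $ 1 = 1 / fls_X * (u$1 - fls_const b * u$2)" "(inv2 (nb i) *v u) $ 2 = u$2"
    unfolding Some by (simp_all only: nb_def option.case inv2_upper[OF fls_X_nonzero] V2_nth)
  ultimately show ?thesis unfolding Some
    by (auto simp: oge2_def hit_def oge_Suc)
qed

lemma hit_low: "oge2 (j + 1) u \<Longrightarrow> hit i j u"
  by (auto simp: hit_def oge2_def oge_Suc split: option.split)

lemma hit_ord2: "u \<noteq> 0 \<Longrightarrow> hit i (ord2 u) u \<longleftrightarrow> i = ldir u"
proof -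
  assume u: "u \<noteq> 0"
  have "\<not> ((u$1) $$ ord2 u = 0 \<and> (u$2) $$ ord2 u = 0)"
    using oge2_ord2[OF u, of "ord2 u"] oge2_ord2[OF u, of "ord2 u + 1"] by (auto simp: oge2_def oge_Suc)
  then show ?thesis by (auto simp: hit_def ldir_def split: option.split)
qed

lemma ord2_nb: "u \<noteq> 0 \<Longrightarrow> ord2 (inv2 (nb i) *v u) = ord2 u - (if i = ldir u then 0 else 1)"
proof -
  assume u: "u \<noteq> 0"
  then have nz: "inv2 (nb i) *v u \<noteq> 0" by simp
  have *: "oge2 (ord2 u) u" "\<not> oge2 (ord2 u + 1) u" "oge2 (ord2 u - 1) u" using u by (simp_all add: oge2_ord2)
  show ?thesis
    by (cases "i = ldir u"; rule ord2_eqI)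
       (use u nz * hit_ord2[OF u, of i] hit_low[of "ord2 u - 1" u i] in \<open>auto simp: oge2_nb\<close>)
qed

lemma nu_nb: "det g \<noteq> 0 \<Longrightarrow> x \<noteq> 0 \<Longrightarrow> nu (g ** nb i) x = nu g x - (if i = ldir (inv2 g *v x) then 0 else 1)"
  unfolding nu_def by (simp add: inv2_mult matrix_vector_mul_assoc[symmetric] ord2_nb det_inv2)

lemma nu_scale:
  assumes "det g \<noteq> 0" "x \<noteq> 0" "c \<noteq> 0" "k \<in> GLO"
  shows "nu (mat c ** g ** k) x = nu g x - fls_subdegree c"
proof -
  have "inv2 (mat c ** g ** k) *v x = inv2 k *v (inv2 g *v ((1 / c) *s x))"
    using assms by (simp add: inv2_mult det_mul inv2_mat matrix_vector_mul_assoc[symmetric] mat_mulv2)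
  moreover have "inv2 g *v ((1 / c) *s x) = (1 / c) *s (inv2 g *v x)"
    by (metis mat_comm2 mat_mulv2 matrix_vector_mul_assoc)
  moreover define y where "y = inv2 g *v x"
  moreover have y: "y \<noteq> 0" using assms by (simp add: y_def)
  then have "(1 / c) *s y \<noteq> 0" using assms by (auto simp: vec2_eq_iff)
  ultimately show ?thesis using assms y
    by (simp add: nu_def GLO_ord2 GLO_inv2 ord2_scale divide_inverse)
qed

lemma nu_mult: "det g \<noteq> 0 \<Longrightarrow> det m \<noteq> 0 \<Longrightarrow> nu (m ** g) x = nu g (inv2 m *v x)"
  by (simp add: nu_def inv2_mult matrix_vector_mul_assoc)

lemma nu_mult': "det g \<noteq> 0 \<Longrightarrow> det m \<noteq> 0 \<Longrightarrow> nu (m ** g) (m *v x) = nu g x"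
  by (simp add: nu_mult)

lemma nth0_mult: "oge 0 x \<Longrightarrow> oge 0 y \<Longrightarrow> (x * y) $$ 0 = x $$ 0 * y $$ 0"
proof -
  assume x: "oge 0 x" and y: "oge 0 y"
  have x': "oge 1 (x - fls_const (x $$ 0))"
    using oge_Suc[of 0 "x - fls_const (x $$ 0)"] oge_diff[OF x oge_const] by simp
  have "x * y = fls_const (x $$ 0) * y + (x - fls_const (x $$ 0)) * y" by (simp add: algebra_simps)
  moreover have "oge 1 ((x - fls_const (x $$ 0)) * y)" using oge_mult[OF x' y] by simp
  then have "((x - fls_const (x $$ 0)) * y) $$ 0 = 0" by (simp add: oge_def)
  ultimately show ?thesis by (metis fls_plus_nth fls_mult_const_nth(1) add.right_neutral)
qed

lemma intM_cols: "intM m \<longleftrightarrow> oge2 0 (m *v V2 1 0) \<and> oge2 0 (m *v V2 0 1)"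
  by (auto simp: intM_def oge2_def matvec2_nth forall_2)

lemma intM_nb_iff: "intM (inv2 (nb i) ** k) \<longleftrightarrow> intM k \<and> hit i 0 (k *v V2 1 0) \<and> hit i 0 (k *v V2 0 1)"
  by (auto simp: intM_cols matrix_vector_mul_assoc[symmetric] oge2_nb)

text \<open>The reduction of \<open>k\<close> modulo the uniformizer is singular, so both columns
  reduce into one line; this line names the neighbour.\<close>

lemma nb_factor:
  assumes "intM k" "det k \<noteq> 0" "fls_subdegree (det k) = 1"
  shows "\<exists>i. inv2 (nb i) ** k \<in> GLO"
proof -
  have "(det k) $$ 0 = 0" using assms by simp
  then have d: "k$1$1$$0 * k$2$2$$0 = k$1$2$$0 * k$2$1$$0"
    using assms(1) by (simp add: det_2 nth0_mult intM_def)
  have "\<exists>i. hit i 0 (k *v V2 1 0) \<and> hit i 0 (k *v V2 0 1)"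
  proof (cases "k$2$1$$0 = 0 \<and> k$2$2$$0 = 0")
    case True
    then show ?thesis by (intro exI[of _ None]) (simp add: hit_def matvec2_nth)
  next
    case False
    show ?thesis
    proof (cases "k$2$1$$0 = 0")
      case True
      then show ?thesis using d False
        by (intro exI[of _ "Some (k$1$2$$0 / k$2$2$$0)"]) (simp add: hit_def matvec2_nth)
    next
      case F: False
      then show ?thesis using d
        by (intro exI[of _ "Some (k$1$1$$0 / k$2$1$$0)"]) (simp add: hit_def matvec2_nth divide_simps)
    qed
  qed
  then obtain i where "intM (inv2 (nb i) ** k)" using assms(1) by (auto simp: intM_nb_iff)
  then have "inv2 (nb i) ** k \<in> GLO" using assms by (simp del: GLO_det add: GLO_def det_mul det_inv2 divide_inverse)
  then show ?thesis ..
qed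

lemma lat_GLO: "det g \<noteq> 0 \<Longrightarrow> k \<in> GLO \<Longrightarrow> lat (g ** k) = lat g"
  by (subst lat_eq_iff) (auto simp: det_mul)

text \<open>The order of the determinant of \<open>inv2 g ** h\<close> measures the index. The
  inclusions bound it by 0 and 2, strictness excludes both ends, and order 1 is settled by
  \<open>nb_factor\<close>.\<close>

lemma lat_between_iff:
  assumes g: "det g \<noteq> 0" and h: "det h \<noteq> 0"
  shows "lat (mat fls_X ** g) \<subset> lat h \<and> lat h \<subset> lat g \<longleftrightarrow> (\<exists>i. \<exists>k\<in>GLO. h = g ** nb i ** k)"
proof
  assume a: "lat (mat fls_X ** g) \<subset> lat h \<and> lat h \<subset> lat g"
  define k where "k = inv2 g ** h"
  have dk: "det k \<noteq> 0" and hk: "h = g ** k" using g h by (auto simp: k_def det_mul det_inv2)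
  have ik: "intM k" using a lat_subset[OF g, of h] by (auto simp: k_def)
  have "inv2 k = inv2 h ** g" using g h by (simp add: k_def inv2_mult inv2_inv2)
  then have "inv2 h ** (mat fls_X ** g) = mat fls_X ** inv2 k"
    by (simp add: mat_left_comm2)
  then have i2: "intM (mat fls_X ** inv2 k)" using a lat_subset[OF h, of "mat fls_X ** g"] by auto
  have s0: "fls_subdegree (det k) \<ge> 0" using intM_det[OF ik] dk by (simp add: oge_iff)
  have "det (mat fls_X ** inv2 k) = fls_X * fls_X * inverse (det k)"
    using dk by (simp add: det_mul det_inv2 divide_inverse)
  then have sd: "fls_subdegree (det (mat fls_X ** inv2 k)) = 2 - fls_subdegree (det k)"
    and dd: "det (mat fls_X ** inv2 k) \<noteq> 0" using dk by simp_all
  have s2: "fls_subdegree (det k) \<le> 2" using intM_det[OF i2] dd sd by (simp add: oge_iff)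
  have n0: "fls_subdegree (det k) \<noteq> 0"
  proof
    assume "fls_subdegree (det k) = 0"
    then have "k \<in> GLO" using ik dk by (simp del: GLO_det add: GLO_def)
    then show False using a lat_GLO[OF g] hk by auto
  qed
  have n2: "fls_subdegree (det k) \<noteq> 2"
  proof
    assume "fls_subdegree (det k) = 2"
    then have *: "mat fls_X ** inv2 k \<in> GLO" using i2 dd sd by (simp del: GLO_det add: GLO_def)
    have "h ** (mat fls_X ** inv2 k) = mat fls_X ** g"
      using dk by (simp add: hk mat_left_comm2 matrix_mul_assoc[symmetric] inv2_right)
    then show False using a lat_GLO[OF h *] by auto
  qed
  have "fls_subdegree (det k) = 1" using s0 s2 n0 n2 by linarith
  then obtain i where i: "inv2 (nb i) ** k \<in> GLO" using nb_factor ik dk by blast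
  have "h = g ** nb i ** (inv2 (nb i) ** k)" by (simp add: hk matrix_mul_assoc[symmetric])
  then show "\<exists>i. \<exists>k\<in>GLO. h = g ** nb i ** k" using i by blast
next
  assume "\<exists>i. \<exists>k\<in>GLO. h = g ** nb i ** k"
  then obtain i k where k: "k \<in> GLO" "h = g ** nb i ** k" by blast
  have L: "lat h = lat (g ** nb i)" using k g by (simp add: lat_GLO det_mul)
  have 1: "lat (g ** nb i) \<subseteq> lat g" using g by (simp add: lat_subset)
  have "inv2 (g ** nb i) ** (mat fls_X ** g) = mat fls_X ** inv2 (nb i)"
    using g by (simp add: inv2_mult mat_left_comm2 matrix_mul_assoc[symmetric] inv2_left)
  moreover have "intM (mat fls_X ** inv2 (nb i))"
  proof -
    have "fls_X * (1 / fls_X) = (1 :: 'a fls)" by (rule mult_one_div) simp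
    then have "mat fls_X ** inv2 (nb i) = adj2 (nb i)"
      unfolding inv2_def by (simp only: det_nb matrix_mul_assoc mat_mult2 matrix_mul_lid)
    then show ?thesis by (simp add: nb_def adj2_def split: option.split)
  qed
  ultimately have 2: "lat (mat fls_X ** g) \<subseteq> lat (g ** nb i)" using g by (simp add: lat_subset det_mul)
  have 3: "lat (g ** nb i) \<noteq> lat g"
  proof
    assume "lat (g ** nb i) = lat g"
    then obtain k where "k \<in> GLO" "g ** nb i = g ** k" using g lat_eq_iff[of g "g ** nb i"] by (auto simp: det_mul)
    then have "nb i \<in> GLO" using g by (metis inv2_mulm(1))
    then show False by (simp del: GLO_det add: GLO_def)
  qed
  have 4: "lat (g ** nb i) \<noteq> lat (mat fls_X ** g)"
  proof
    assume "lat (g ** nb i) = lat (mat fls_X ** g)"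
    then obtain k where "k \<in> GLO" "g ** nb i = mat fls_X ** g ** k"
      using g lat_eq_iff[of "mat fls_X ** g" "g ** nb i"] by (auto simp: det_mul)
    then have "g ** nb i = g ** (mat fls_X ** k)" by (simp add: mat_left_comm2 matrix_mul_assoc[symmetric])
    then have "nb i = mat fls_X ** k" using g by (simp add: mul_left_cancel2)
    then have "fls_subdegree (det (nb i)) = fls_subdegree (fls_X * fls_X * det k)" by (simp only: det_mul det_mat2)
    then show False using \<open>k \<in> GLO\<close> by (simp add: GLO_det0)
  qed
  show "lat (mat fls_X ** g) \<subset> lat h \<and> lat h \<subset> lat g" using L 1 2 3 4 by auto
qed

lemma adjacent_iff:
  assumes g: "det g \<noteq> 0" and w: "w \<in> vertices"
  shows "adjacent (vtx g) w \<longleftrightarrow> (\<exists>i. w = vtx (g ** nb i))"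
proof
  obtain h where h: "det h \<noteq> 0" "w = vtx h" using w by (elim vertices_cases)
  assume "adjacent (vtx g) w"
  then obtain c d where c: "c \<noteq> 0" "d \<noteq> 0"
      and s: "lat (mat fls_X ** (mat c ** g)) \<subset> lat (mat d ** h)" "lat (mat d ** h) \<subset> lat (mat c ** g)"
  proof -
    obtain L M where "L \<in> vtx g" "M \<in> vtx h" and s: "(\<lambda>x. fls_X *s x) ` L \<subset> M" "M \<subset> L"
      using \<open>adjacent (vtx g) w\<close> h(2) by (auto simp: adjacent_def)
    then obtain c d where c: "c \<noteq> 0" "d \<noteq> 0" "L = lat (mat c ** g)" "M = lat (mat d ** h)" by (auto simp: vtx_mem)
    show thesis using that[OF c(1,2)] s unfolding c(3,4) lat_scale .
  qed
  then obtain i k where k: "k \<in> GLO" "mat d ** h = mat c ** g ** nb i ** k"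
    using lat_between_iff[of "mat c ** g" "mat d ** h"] g h by (auto simp: det_mul)
  have "vtx h = vtx (mat d ** h)" using c by (simp add: vtx_scale)
  also have "\<dots> = vtx (mat c ** (g ** nb i))" unfolding k using k(1) g c
    by (simp add: vtx_mult_GLO det_mul matrix_mul_assoc)
  also have "\<dots> = vtx (g ** nb i)" using c by (simp add: vtx_scale)
  finally show "\<exists>i. w = vtx (g ** nb i)" using h by blast
next
  assume "\<exists>i. w = vtx (g ** nb i)"
  then obtain i where i: "w = vtx (g ** nb i)" by blast
  have "lat (mat fls_X ** g) \<subset> lat (g ** nb i) \<and> lat (g ** nb i) \<subset> lat g"
    using g by (subst lat_between_iff) (auto simp: det_mul intro!: exI[of _ i] bexI[of _ "mat 1"])
  moreover have "lat g \<in> vtx g" "lat (g ** nb i) \<in> w" unfolding i by (auto simp: vtx_mem intro!: exI[of _ 1])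
  ultimately show "adjacent (vtx g) w" unfolding adjacent_def lat_scale[symmetric] by blast
qed

lemma edges_iff: "det g \<noteq> 0 \<Longrightarrow> (vtx g, w) \<in> edges \<longleftrightarrow> (\<exists>i. w = vtx (g ** nb i))"
proof -
  assume g: "det g \<noteq> 0"
  have "vtx (g ** nb i) \<in> vertices" for i using g by (simp add: det_mul)
  then show ?thesis using g adjacent_iff[OF g, of w] by (auto simp: edges_def)
qed

lemma edges_cases:
  assumes "e \<in> edges"
  obtains g i where "det g \<noteq> 0" "e = (vtx g, vtx (g ** nb i))"
proof -
  obtain v w where e: "e = (v, w)" by fastforce
  then have "v \<in> vertices" using assms by (auto simp: edges_def)
  then obtain g where g: "det g \<noteq> 0" "v = vtx g" by (elim vertices_cases)
  then show ?thesis using that assms e edges_iff[of g w] by auto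
qed

text \<open>Comparing determinants shows that the homothety factor is a unit, so the two lattices
  are equal and not merely homothetic; then the columns of \<open>nb i\<close> must reduce into the
  line \<open>j\<close>.\<close>

lemma nb_inj:
  assumes g: "det g \<noteq> 0" and eq: "vtx (g ** nb i) = vtx (g ** nb j)"
  shows "i = j"
proof -
  obtain c k where c: "c \<noteq> 0" "k \<in> GLO" and "g ** nb i = mat c ** (g ** nb j) ** k"
    using eq g vtx_eq_iff[of "g ** nb j" "g ** nb i"] by (auto simp: det_mul)
  then have "g ** nb i = g ** (mat c ** (nb j ** k))" by (simp add: mat_left_comm2 matrix_mul_assoc[symmetric])
  then have n: "nb i = mat c ** (nb j ** k)" using g by (simp add: mul_left_cancel2)
  then have "fls_subdegree (det (nb i)) = fls_subdegree (c * c * (fls_X * det k))" by (simp add: det_mul)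
  then have c0: "fls_subdegree c = 0" using c by (simp add: GLO_det0)
  have "inv2 (nb j) ** nb i = mat c ** k" unfolding n
    by (simp add: mat_left_comm2)
  moreover have "intM (mat c ** k)" using c c0
    by (intro intM_mult) (auto simp del: GLO_det simp add: mat_M2 oge_iff GLO_def)
  ultimately have "hit j 0 (nb i *v V2 1 0) \<and> hit j 0 (nb i *v V2 0 1)" by (metis intM_nb_iff)
  then show ?thesis by (auto simp: nb_def hit_def M2_mulv split: option.splits)
qed

lemma sum_nb:
  assumes g: "det g \<noteq> 0"
  shows "(\<Sum>w | (vtx g, w) \<in> edges. F w) = (\<Sum>i\<in>UNIV. F (vtx (g ** nb i)))"
proof -
  have "{w. (vtx g, w) \<in> edges} = (\<lambda>i. vtx (g ** nb i)) ` UNIV" using g by (auto simp: edges_iff)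
  moreover have "inj (\<lambda>i. vtx (g ** nb i))" using nb_inj[OF g] by (auto simp: inj_def)
  ultimately show ?thesis by (simp add: sum.reindex o_def)
qed

text \<open>If \<open>M\<close> lies strictly between \<open>fls_X L\<close> and \<open>L\<close>,
  then \<open>fls_X L\<close> lies strictly between \<open>fls_X M\<close> and \<open>M\<close>, and
  it is homothetic to \<open>L\<close>.\<close>

lemma edges_sym: assumes "(v, w) \<in> edges" shows "(w, v) \<in> edges"
proof -
  have vw: "v \<in> vertices" "w \<in> vertices" using assms by (auto simp: edges_def)
  obtain g where g: "det g \<noteq> 0" "v = vtx g" using vw by (elim vertices_cases)
  obtain L M where LM: "L \<in> v" "M \<in> w" "(\<lambda>x. fls_X *s x) ` L \<subset> M" "M \<subset> L"
    using assms by (auto simp: edges_def adjacent_def)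
  obtain c where c: "c \<noteq> 0" "L = lat (mat c ** g)" using LM(1) g by (auto simp: vtx_mem)
  have "(\<lambda>x. fls_X *s x) ` L \<in> v" unfolding c g(2) lat_scale using c(1)
    by (auto simp: vtx_mem matrix_mul_assoc mat_mult2 intro!: exI[of _ "fls_X * c"])
  moreover have "(\<lambda>x. fls_X *s x) ` M \<subset> (\<lambda>x. fls_X *s x) ` L"
  proof -
    have "inj (\<lambda>x::'a fls^2. fls_X *s x)" by (auto simp: inj_def vec2_eq_iff)
    then show ?thesis using LM(4) by (simp add: image_strict_mono inj_on_subset)
  qed
  ultimately have "adjacent w v" unfolding adjacent_def using LM(2,3)
    by (intro bexI[of _ M] bexI[of _ "(\<lambda>x. fls_X *s x) ` L"] conjI)
  then show ?thesis using vw by (simp add: edges_def)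
qed

lemma vact_edges: "det m \<noteq> 0 \<Longrightarrow> (v, w) \<in> edges \<Longrightarrow> (vact m v, vact m w) \<in> edges"
  by (elim edges_cases) (auto simp: vact_vtx edges_iff det_mul matrix_mul_assoc)

lemma vact_edges_iff: "det m \<noteq> 0 \<Longrightarrow> (vact m v, vact m w) \<in> edges \<longleftrightarrow> (v, w) \<in> edges"
  using vact_edges[of m v w] vact_edges[of "inv2 m" "vact m v" "vact m w"] by (auto simp: det_inv2)

lemma edge_act_vtx: "edge_act \<gamma> (vtx g, vtx h) = (vtx (em \<gamma> ** g), vtx (em \<gamma> ** h))"
  by (simp add: edge_act_def vertex_act_eq vact_vtx)

lemma edge_act_mult: "edge_act \<gamma> (edge_act \<delta> e) = edge_act (\<gamma> ** \<delta>) e"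
  by (simp add: edge_act_def vertex_act_eq vact_vact em_mult)

lemma edge_act_edges [simp]: "det \<gamma> \<noteq> 0 \<Longrightarrow> edge_act \<gamma> e \<in> edges \<longleftrightarrow> e \<in> edges"
  using vact_edges_iff[of "em \<gamma>" "fst e" "snd e"] by (simp add: edge_act_def vertex_act_eq)

section \<open>Functions on vertices\<close>

definition vinv :: "('a::{field,finite} fls^2^2 \<Rightarrow> 'b) \<Rightarrow> bool" where
  "vinv \<phi> \<longleftrightarrow> (\<forall>g c k. det g \<noteq> 0 \<longrightarrow> c \<noteq> 0 \<longrightarrow> k \<in> GLO \<longrightarrow> \<phi> (mat c ** g ** k) = \<phi> g)"

definition vfun :: "('a::{field,finite} fls^2^2 \<Rightarrow> 'b) \<Rightarrow> 'a vertex \<Rightarrow> 'b" where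
  "vfun \<phi> v = \<phi> (SOME g. det g \<noteq> 0 \<and> vtx g = v)"

lemma vinv_eq: "vinv \<phi> \<Longrightarrow> det g \<noteq> 0 \<Longrightarrow> det h \<noteq> 0 \<Longrightarrow> vtx h = vtx g \<Longrightarrow> \<phi> h = \<phi> g"
  using vtx_eq_iff[of g h] unfolding vinv_def by auto

lemma vfun_vtx: "vinv \<phi> \<Longrightarrow> det g \<noteq> 0 \<Longrightarrow> vfun \<phi> (vtx g) = \<phi> g"
  unfolding vfun_def by (rule someI2[of _ g]) (auto intro: vinv_eq)

section \<open>The quotient of the tree by \<open>GL2A\<close> is a ray\<close>

section \<open>Reduction theory\<close>

definition GL2A :: "('a::{field,finite} poly^2^2) set" where
  "GL2A = {\<gamma>. det \<gamma> dvd 1}"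

definition Lam :: "nat \<Rightarrow> 'a::{field,finite} fls^2^2" where
  "Lam k = M2 (poly_to_fls (monom 1 k)) 0 0 1"

lemma det_Lam [simp]: "det (Lam k) \<noteq> 0"
  by (simp add: Lam_def)

lemma subdegree_monom: "fls_subdegree (poly_to_fls (monom (1::'a::{field,finite}) k)) = - int k"
  by (simp add: pf_subdegree degree_monom_eq)

lemma GL2A_mult: "a \<in> GL2A \<Longrightarrow> b \<in> GL2A \<Longrightarrow> a ** b \<in> GL2A"
  unfolding GL2A_def by (auto simp: det_mul)

lemma GL2A_det [simp]: "a \<in> GL2A \<Longrightarrow> det a \<noteq> 0"
  unfolding GL2A_def by auto

lemma GL2A_1 [simp]: "mat 1 \<in> GL2A"
  by (simp add: GL2A_def)

lemma GL2A_inverse: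
  assumes "\<gamma> \<in> GL2A"
  obtains \<delta> where "\<delta> \<in> GL2A" "\<gamma> ** \<delta> = mat 1" "\<delta> ** \<gamma> = mat 1"
proof -
  obtain u where u: "1 = det \<gamma> * u" using assms by (auto simp: GL2A_def)
  have "mat u ** adj2 \<gamma> ** \<gamma> = mat 1"
    using u by (simp add: matrix_mul_assoc[symmetric] adj2_left mat_mult2 mult.commute)
  moreover have "\<gamma> ** (mat u ** adj2 \<gamma>) = mat 1"
    using u by (simp add: mat_left_comm2 adj2_right mat_mult2 mult.commute)
  moreover have "det (mat u ** adj2 \<gamma>) * det \<gamma> = 1" using u by (simp add: det_mul algebra_simps)
  then have "mat u ** adj2 \<gamma> \<in> GL2A" unfolding GL2A_def by (metis (mono_tags) dvd_triv_left mem_Collect_eq)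
  ultimately show ?thesis using that by blast
qed

definition redu :: "'a::{field,finite} vertex \<Rightarrow> bool" where
  "redu v \<longleftrightarrow> (\<exists>\<gamma>\<in>GL2A. \<exists>k. v = vtx (em \<gamma> ** Lam k))"

lemma redu_em: "\<gamma> \<in> GL2A \<Longrightarrow> redu (vtx g) \<Longrightarrow> redu (vtx (em \<gamma> ** g))"
  unfolding redu_def by (metis GL2A_mult em_mult matrix_mul_assoc vact_vtx)

lemma poly_part:
  fixes u :: "'a::{field,finite} fls"
  shows "\<exists>f. oge 1 (u - poly_to_fls f)"
proof -
  define N where "N = nat (1 - fls_subdegree u)"
  define f where "f = Poly (map (\<lambda>n. u $$ (- int n)) [0..<N])"
  have "(u - poly_to_fls f) $$ n = 0" if "n < 1" for n
  proof -
    have "coeff f (nat (- n)) = u $$ n"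
    proof (cases "nat (-n) < N")
      case True
      then show ?thesis using that by (simp add: f_def coeff_Poly_eq nth_default_def)
    next
      case False
      then have "n < fls_subdegree u" using that unfolding N_def by linarith
      then show ?thesis using False by (simp add: f_def coeff_Poly_eq nth_default_def)
    qed
    then show ?thesis using that by (simp add: pf_nth)
  qed
  then show ?thesis unfolding oge_def by blast
qed

abbreviation Sw :: "'r::comm_ring_1^2^2" where "Sw \<equiv> M2 0 1 1 0"

lemma Sw_GL2A: "Sw \<in> GL2A"
  by (simp add: GL2A_def)

lemma Sw_GLO: "Sw \<in> GLO"
  by (simp del: GLO_det add: GLO_def)

lemma redu_diag: "x \<noteq> 0 \<Longrightarrow> redu (vtx (M2 x 0 0 1))"
proof -
  assume x: "x \<noteq> (0::'a fls)"
  define v where "v = fls_subdegree x"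
  show ?thesis
  proof (cases "v \<le> 0")
    case True
    define t where "t = poly_to_fls (monom (1::'a) (nat (-v)))"
    have t: "t \<noteq> 0" "fls_subdegree t = v" using True by (simp_all add: t_def subdegree_monom)
    have "Lam (nat (-v)) = M2 t 0 0 1" unfolding Lam_def t_def ..
    then have "M2 x 0 0 1 = Lam (nat (-v)) ** M2 (x / t) 0 0 1"
      using t(1) by (simp add: M2_mult)
    moreover have "M2 (x / t) 0 0 1 \<in> GLO" using t x by (simp del: GLO_det add: GLO_def oge_iff divide_inverse v_def)
    ultimately have "vtx (M2 x 0 0 1) = vtx (Lam (nat (-v)))" by (simp add: vtx_mult_GLO)
    then show ?thesis unfolding redu_def by (intro bexI[of _ "mat 1"] exI[of _ "nat (-v)"]) (simp_all add: em_mat)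
  next
    case False
    define t where "t = poly_to_fls (monom (1::'a) (nat v))"
    have t: "t \<noteq> 0" "fls_subdegree t = - v" using False by (simp_all add: t_def subdegree_monom)
    have "Lam (nat v) = M2 t 0 0 1" unfolding Lam_def t_def ..
    then have "M2 x 0 0 1 = mat x ** (em Sw ** Lam (nat v)) ** M2 0 (1 / (x * t)) 1 0"
      using t(1) x by (simp add: M2_mult em_M2 mat_M2)
    moreover have "M2 0 (1 / (x * t)) 1 0 \<in> GLO" using t x by (simp del: GLO_det add: GLO_def oge_iff divide_inverse v_def)
    ultimately have "vtx (M2 x 0 0 1) = vtx (em Sw ** Lam (nat v))"
      using x t(1) by (subst vtx_eq_iff) (auto simp: det_mul em_M2)
    then show ?thesis unfolding redu_def using Sw_GL2A by blast
  qed
qed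

text \<open>The continued fraction algorithm: remove the polynomial part of \<open>u\<close>, and
  unless the rest \<open>u'\<close> is absorbed by the lattice, swap the coordinates. The order of
  \<open>x\<close> then falls by twice the order of \<open>u'\<close>, which is at least 1.\<close>

lemma redu_upper:
  fixes x u :: "'a::{field,finite} fls"
  shows "x \<noteq> 0 \<Longrightarrow> redu (vtx (M2 x u 0 1))"
proof (induction "nat (fls_subdegree x)" arbitrary: x u rule: less_induct)
  case less
  obtain f where f: "oge 1 (u - poly_to_fls f)" using poly_part by blast
  define u' where "u' = u - poly_to_fls f"
  have eq: "M2 x u 0 1 = em (M2 1 f 0 1) ** M2 x u' 0 1"
    by (simp add: em_M2 M2_mult u'_def)
  have gl: "M2 1 f 0 1 \<in> GL2A" by (simp add: GL2A_def)
  have "redu (vtx (M2 x u' 0 1))"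
  proof (cases "oge (fls_subdegree x) u'")
    case True
    have "M2 x u' 0 1 = M2 x 0 0 1 ** M2 1 (u' / x) 0 1" using less.prems by (simp add: M2_mult)
    moreover have "M2 1 (u' / x) 0 1 \<in> GLO"
      using True less.prems by (simp del: GLO_det add: GLO_def oge_divide)
    ultimately show ?thesis using redu_diag[OF less.prems] less.prems by (simp add: vtx_mult_GLO)
  next
    case False
    define e where "e = fls_subdegree u'"
    have u0: "u' \<noteq> 0" and e: "e \<ge> 1" "e < fls_subdegree x"
      using False f by (auto simp: oge_iff u'_def[symmetric] e_def)
    define y where "y = x / (u' * u')"
    have y: "y \<noteq> 0" "fls_subdegree y = fls_subdegree x - 2 * e"
      using u0 less.prems by (simp_all add: y_def divide_inverse e_def)
    have "nat (fls_subdegree y) < nat (fls_subdegree x)" using e y by linarith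
    then have r: "redu (vtx (M2 y (1 / u') 0 1))" using less.hyps y by blast
    have "Sw ** M2 x u' 0 1 = mat u' ** M2 y (1 / u') 0 1 ** M2 (-1) 0 (x / u') 1"
      using u0 by (simp add: M2_mult mat_M2 y_def)
    moreover have "M2 (-1) 0 (x / u') 1 \<in> GLO"
      using u0 less.prems e by (simp del: GLO_det add: GLO_def oge_iff divide_inverse e_def)
    ultimately have "vtx (Sw ** M2 x u' 0 1) = vtx (M2 y (1 / u') 0 1)"
      using u0 y less.prems by (subst vtx_eq_iff) (auto simp: det_mul)
    then have "redu (vtx (em Sw ** (Sw ** M2 x u' 0 1)))" using r redu_em[OF Sw_GL2A] by metis
    then show ?thesis by (simp add: em_M2 M2_mult)
  qed
  then show ?case using redu_em[OF gl] eq by metis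
qed

text \<open>Column operations from \<open>GLO\<close> make \<open>g\<close> upper triangular as soon
  as the second row has its entry of smaller order on the right; \<open>Sw\<close> puts it
  there.\<close>

lemma redu_all:
  assumes g: "det g \<noteq> 0" shows "redu (vtx g)"
proof -
  have *: "redu (vtx g)" if g: "det g \<noteq> 0" and d: "g$2$2 \<noteq> 0" "oge (fls_subdegree (g$2$2)) (g$2$1)" for g :: "'a fls^2^2"
  proof -
    obtain a b c e where m: "g = M2 a b c e" by (rule M2_cases)
    have d': "e \<noteq> 0" "oge (fls_subdegree e) c" "a * e - b * c \<noteq> 0" using that by (simp_all add: m)
    define x where "x = (a * e - b * c) / (e * e)"
    have "g = mat e ** M2 x (b / e) 0 1 ** M2 1 0 (c / e) 1"
      unfolding m x_def using d' by (simp add: M2_mult mat_M2 M2_inject field_simps)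
    moreover have "M2 1 0 (c / e) 1 \<in> GLO" using d' by (simp del: GLO_det add: GLO_def oge_divide)
    moreover have x: "x \<noteq> 0" using d' by (simp add: x_def)
    ultimately have "vtx g = vtx (M2 x (b / e) 0 1)" using g d' by (subst vtx_eq_iff) auto
    then show ?thesis using redu_upper[OF x] by simp
  qed
  show ?thesis
  proof (cases "g$2$2 \<noteq> 0 \<and> oge (fls_subdegree (g$2$2)) (g$2$1)")
    case True
    then show ?thesis using * g by blast
  next
    case False
    then have "g$2$1 \<noteq> 0" "oge (fls_subdegree (g$2$1)) (g$2$2)" using g by (auto simp: det_2 oge_iff)
    then have "redu (vtx (g ** Sw))" using * [of "g ** Sw"] g by (simp add: det_mul matmul2_nth)
    then show ?thesis using vtx_mult_GLO[OF g Sw_GLO] by simp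
  qed
qed

lemma reduction:
  assumes "det g \<noteq> 0"
  obtains \<gamma> k c \<kappa> where "\<gamma> \<in> GL2A" "c \<noteq> 0" "\<kappa> \<in> GLO" "g = mat c ** (em \<gamma> ** Lam k) ** \<kappa>"
    "vtx g = vtx (em \<gamma> ** Lam k)"
proof -
  obtain \<gamma> k where g: "\<gamma> \<in> GL2A" "vtx g = vtx (em \<gamma> ** Lam k)"
    using redu_all[OF assms] by (auto simp: redu_def)
  then show ?thesis using that assms vtx_eq_iff[of "em \<gamma> ** Lam k" g] by (auto simp: det_mul)
qed

section \<open>Heights\<close>

text \<open>The first successive minimum of the polynomial vectors for the norm of
  \<open>lat g\<close>, in logarithmic form. The \<open>Sup\<close> is attained by
  \<open>amax_exists\<close>.\<close>

definition amax :: "'a::{field,finite} fls^2^2 \<Rightarrow> int" where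
  "amax g = Sup {nu g (ev x) | x. x \<noteq> 0}"

text \<open>
  Unlike \<open>amax\<close>, the height depends only on the homothety class of the lattice. It is the distance of the image of
  \<open>vtx g\<close> from the origin of the ray \<open>vtx (Lam k)\<close>, which is a fundamental domain for \<open>GL2A\<close>.
\<close>

definition ht :: "'a::{field,finite} fls^2^2 \<Rightarrow> int" where
  "ht g = 2 * amax g + fls_subdegree (det g)"

lemma inv2_Lam: "inv2 (Lam k) *v u = V2 (u$1 / poly_to_fls (monom 1 k)) (u$2)"
  by (simp add: Lam_def inv2_M2 M2_mulv)

lemma nu_Lam: "nu (Lam k) (ev x) = (if x$2 = 0 then (if x$1 = 0 then 0 else int k - int (degree (x$1)))
    else if x$1 = 0 then - int (degree (x$2)) else min (int k - int (degree (x$1))) (- int (degree (x$2))))"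
proof -
  have "fls_subdegree (poly_to_fls (x$1) / poly_to_fls (monom 1 k)) = int k - int (degree (x$1))" if "x$1 \<noteq> 0"
    using that by (simp add: divide_inverse pf_subdegree degree_monom_eq)
  then show ?thesis unfolding nu_def inv2_Lam by (simp add: ord2_def pf_subdegree)
qed

lemma nu_Lam_le: "x \<noteq> 0 \<Longrightarrow> nu (Lam k) (ev x) \<le> int k"
  by (auto simp: nu_Lam vec2_eq_iff)

lemma det_em_GL2A [simp]: "\<gamma> \<in> GL2A \<Longrightarrow> det (em \<gamma>) \<noteq> 0"
  by simp

lemma GL2A_mulv_eq_0 [simp]: "\<gamma> \<in> GL2A \<Longrightarrow> \<gamma> *v x = 0 \<longleftrightarrow> x = 0"
  by (metis ev_eq_0 em_mulv det_em_GL2A mulv_eq_0)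

lemma nu_em: "det (em \<gamma>) \<noteq> 0 \<Longrightarrow> det g \<noteq> 0 \<Longrightarrow> nu (em \<gamma> ** g) (ev (\<gamma> *v x)) = nu g (ev x)"
  by (metis em_mulv nu_mult')

lemma amax_eqI: "x \<noteq> 0 \<Longrightarrow> nu g (ev x) = j \<Longrightarrow> (\<And>y. y \<noteq> 0 \<Longrightarrow> nu g (ev y) \<le> j) \<Longrightarrow> amax g = j"
  unfolding amax_def by (intro cSup_eq_maximum) auto

lemma GL2A_surj: "\<gamma> \<in> GL2A \<Longrightarrow> \<exists>y. x = \<gamma> *v y"
  by (metis GL2A_inverse matrix_vector_mul_assoc matrix_vector_mul_lid)

lemma amax_exists:
  assumes "det g \<noteq> 0"
  shows "\<exists>j. (\<exists>x. x \<noteq> 0 \<and> nu g (ev x) = j) \<and> (\<forall>y. y \<noteq> 0 \<longrightarrow> nu g (ev y) \<le> j)"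
proof -
  obtain \<gamma> k c \<kappa> where r: "\<gamma> \<in> GL2A" "c \<noteq> 0" "\<kappa> \<in> GLO" "g = mat c ** (em \<gamma> ** Lam k) ** \<kappa>"
    using reduction[OF assms] by metis
  have nu: "nu g (ev (\<gamma> *v y)) = nu (Lam k) (ev y) - fls_subdegree c" if "y \<noteq> 0" for y
  proof -
    have "ev (\<gamma> *v y) \<noteq> 0" using that r by simp
    then show ?thesis unfolding r(4) using r(1,2,3) by (subst nu_scale) (auto simp: det_mul nu_em)
  qed
  have "V2 1 0 \<noteq> (0::'a poly^2)" by (simp add: vec2_eq_iff)
  moreover have "nu (Lam k) (ev (V2 1 0)) = int k" by (simp add: nu_Lam)
  ultimately have 1: "\<gamma> *v V2 1 0 \<noteq> 0 \<and> nu g (ev (\<gamma> *v V2 1 0)) = int k - fls_subdegree c"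
    using r(1) nu by simp
  have 2: "nu g (ev y) \<le> int k - fls_subdegree c" if y: "y \<noteq> 0" for y
  proof -
    obtain z where z: "y = \<gamma> *v z" using GL2A_surj[OF r(1)] by blast
    then have "z \<noteq> 0" using y r(1) by auto
    then show ?thesis using nu[of z] nu_Lam_le[of z k] z by simp
  qed
  show ?thesis using 1 2 by blast
qed

lemma amax_attained: "det g \<noteq> 0 \<Longrightarrow> \<exists>x. x \<noteq> 0 \<and> nu g (ev x) = amax g"
  and amax_ge: "det g \<noteq> 0 \<Longrightarrow> y \<noteq> 0 \<Longrightarrow> nu g (ev y) \<le> amax g"
  using amax_exists[of g] amax_eqI[of _ g] by (metis (mono_tags))+

lemma amax_scale:
  assumes "det g \<noteq> 0" "c \<noteq> 0" "k \<in> GLO"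
  shows "amax (mat c ** g ** k) = amax g - fls_subdegree c"
proof -
  obtain x where x: "x \<noteq> 0" "nu g (ev x) = amax g" using amax_attained assms by blast
  show ?thesis using assms x amax_ge[OF assms(1)]
    by (intro amax_eqI[OF x(1)]) (auto simp: nu_scale)
qed

lemma amax_em:
  assumes "det g \<noteq> 0" "\<gamma> \<in> GL2A"
  shows "amax (em \<gamma> ** g) = amax g"
proof -
  obtain x where x: "x \<noteq> 0" "nu g (ev x) = amax g" using amax_attained assms by blast
  show ?thesis
  proof (rule amax_eqI[of "\<gamma> *v x"])
    fix y :: "'a poly^2" assume "y \<noteq> 0"
    moreover obtain z where "y = \<gamma> *v z" using GL2A_surj assms by blast
    ultimately show "nu (em \<gamma> ** g) (ev y) \<le> amax g" using assms amax_ge[OF assms(1), of z]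
      by (auto simp: nu_em)
  qed (use x assms in \<open>auto simp: nu_em\<close>)
qed

lemma amax_Lam: "amax (Lam k) = int k"
  by (rule amax_eqI[of "V2 1 0"]) (auto simp: nu_Lam nu_Lam_le vec2_eq_iff[of "V2 1 0"])

lemma subdegree_det_GL2A [simp]: "\<gamma> \<in> GL2A \<Longrightarrow> fls_subdegree (poly_to_fls (det \<gamma>)) = 0"
  by (auto simp: pf_subdegree GL2A_def is_unit_poly_iff)

lemma ht_vinv: "vinv ht"
  unfolding vinv_def ht_def by (auto simp: amax_scale det_mul GLO_det0)

lemma ht_em: "det g \<noteq> 0 \<Longrightarrow> \<gamma> \<in> GL2A \<Longrightarrow> ht (em \<gamma> ** g) = ht g"
  by (simp add: ht_def amax_em det_mul)

lemma ht_Lam: "ht (Lam k) = int k"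
  by (simp add: ht_def amax_Lam, simp add: Lam_def subdegree_monom)

lemma reduction_ht:
  assumes "det g \<noteq> 0"
  obtains \<gamma> where "\<gamma> \<in> GL2A" "vtx g = vtx (em \<gamma> ** Lam (nat (ht g)))" "ht g \<ge> 0"
proof -
  obtain \<gamma> k where r: "\<gamma> \<in> GL2A" "vtx g = vtx (em \<gamma> ** Lam k)" using reduction[OF assms] by metis
  then have "ht g = int k" using vinv_eq[OF ht_vinv assms, of "em \<gamma> ** Lam k"]
    by (simp add: det_mul ht_em ht_Lam)
  then show ?thesis using that r by simp
qed

lemma ht_nonneg: "det g \<noteq> 0 \<Longrightarrow> ht g \<ge> 0"
  using reduction_ht by metis

lemma ldir_const:
  assumes "c \<noteq> 0" "u \<noteq> 0" shows "ldir (fls_const c *s u) = ldir u"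
proof -
  have "ord2 (fls_const c *s u) = ord2 u" using assms by (simp add: ord2_scale)
  then show ?thesis using assms by (simp add: ldir_def)
qed

lemma mulv_scale2: "(A::'r::comm_ring_1^2^2) *v (c *s x) = c *s (A *v x)"
  by (simp add: vec2_eq_iff matvec2_nth algebra_simps)

text \<open>For \<open>Lam k\<close> the order of \<open>V2 a b\<close> is the smaller of
  \<open>k - degree a\<close> and \<open>- degree b\<close>, zero entries being skipped. For
  \<open>k > 0\<close> the maximum \<open>k\<close> is reached only at constant multiples of
  \<open>V2 1 0\<close>, for \<open>k = 0\<close> at all nonzero constant vectors.\<close>

lemma amax_maximizers:
  assumes "det g \<noteq> 0"
  obtains s t where "s \<noteq> 0"
    "ht g > 0 \<Longrightarrow> (\<forall>y. y \<noteq> 0 \<longrightarrow> nu g (ev y) = amax g \<longrightarrow> (\<exists>c. c \<noteq> 0 \<and> y = [:c:] *s s))"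
    "nu g (ev s) = amax g"
    "ht g = 0 \<Longrightarrow> (\<forall>c d. c \<noteq> 0 \<or> d \<noteq> 0 \<longrightarrow> [:c:] *s s + [:d:] *s t \<noteq> 0 \<and> nu g (ev ([:c:] *s s + [:d:] *s t)) = amax g)"
proof -
  obtain \<gamma> k c \<kappa> where r: "\<gamma> \<in> GL2A" "c \<noteq> 0" "\<kappa> \<in> GLO" "g = mat c ** (em \<gamma> ** Lam k) ** \<kappa>"
      "vtx g = vtx (em \<gamma> ** Lam k)"
    using reduction[OF assms] by metis
  have k: "ht g = int k" using vinv_eq[OF ht_vinv assms, of "em \<gamma> ** Lam k"] r
    by (simp add: det_mul ht_em ht_Lam)
  have am: "amax g = int k - fls_subdegree c" using r by (simp add: amax_scale det_mul amax_em amax_Lam)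
  have nu: "nu g (ev (\<gamma> *v y)) = nu (Lam k) (ev y) - fls_subdegree c" if "y \<noteq> 0" for y
  proof -
    have "ev (\<gamma> *v y) \<noteq> 0" using that r by simp
    then show ?thesis unfolding r(4) using r(1,2,3) by (subst nu_scale) (auto simp: det_mul nu_em)
  qed
  have e1: "V2 1 0 \<noteq> (0::'a poly^2)" by (simp add: vec2_eq_iff)
  show ?thesis
  proof (rule that[of "\<gamma> *v V2 1 0" "\<gamma> *v V2 0 1"])
    show "\<gamma> *v V2 1 0 \<noteq> 0" using e1 r(1) by simp
    show "nu g (ev (\<gamma> *v V2 1 0)) = amax g" using nu[OF e1] am by (simp add: nu_Lam)
    show "\<forall>y. y \<noteq> 0 \<longrightarrow> nu g (ev y) = amax g \<longrightarrow> (\<exists>c. c \<noteq> 0 \<and> y = [:c:] *s (\<gamma> *v V2 1 0))" if h: "ht g > 0"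
    proof (intro allI impI)
      fix y :: "'a poly^2" assume y: "y \<noteq> 0" "nu g (ev y) = amax g"
      obtain z where z: "y = \<gamma> *v z" using GL2A_surj r(1) by blast
      have z0: "z \<noteq> 0" using y z r(1) by auto
      have "nu (Lam k) (ev z) = int k" using nu[OF z0] y am z by simp
      then have z12: "z$2 = 0" "z$1 \<noteq> 0" "degree (z$1) = 0" using h k z0
        by (auto simp: nu_Lam vec2_eq_iff split: if_splits)
      then obtain c where c: "z$1 = [:c:]" by (elim degree_eq_zeroE)
      then have "c \<noteq> 0" "z = [:c:] *s V2 1 0" using z12 by (auto simp: vec2_eq_iff)
      then show "\<exists>c. c \<noteq> 0 \<and> y = [:c:] *s (\<gamma> *v V2 1 0)" unfolding z by (auto simp: mulv_scale2)
    qed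
    show "\<forall>c d. c \<noteq> 0 \<or> d \<noteq> 0 \<longrightarrow> [:c:] *s (\<gamma> *v V2 1 0) + [:d:] *s (\<gamma> *v V2 0 1) \<noteq> 0 \<and>
      nu g (ev ([:c:] *s (\<gamma> *v V2 1 0) + [:d:] *s (\<gamma> *v V2 0 1))) = amax g" if h: "ht g = 0"
    proof (intro allI impI)
      fix c d :: 'a assume cd: "c \<noteq> 0 \<or> d \<noteq> 0"
      have eq: "[:c:] *s (\<gamma> *v V2 1 0) + [:d:] *s (\<gamma> *v V2 0 1) = \<gamma> *v V2 [:c:] [:d:]"
        by (simp add: vec2_eq_iff matvec2_nth algebra_simps)
      have nz: "V2 [:c:] [:d:] \<noteq> 0" using cd by (auto simp: vec2_eq_iff)
      show "[:c:] *s (\<gamma> *v V2 1 0) + [:d:] *s (\<gamma> *v V2 0 1) \<noteq> 0 \<and>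
          nu g (ev ([:c:] *s (\<gamma> *v V2 1 0) + [:d:] *s (\<gamma> *v V2 0 1))) = amax g"
        unfolding eq using nz nu[OF nz] am h k cd r(1) by (auto simp: nu_Lam)
    qed
  qed
qed

text \<open>By \<open>nu_nb\<close> a vector keeps its order towards the neighbour in its own
  direction and loses one towards all others, so the maximum survives exactly if some maximizer
  points to \<open>i\<close>.\<close>

lemma amax_nb_general:
  assumes g: "det g \<noteq> 0"
  shows "amax (g ** nb i) = amax g - (if \<exists>x. x \<noteq> 0 \<and> nu g (ev x) = amax g \<and> ldir (inv2 g *v ev x) = i then 0 else 1)"
proof (cases "\<exists>x. x \<noteq> 0 \<and> nu g (ev x) = amax g \<and> ldir (inv2 g *v ev x) = i")
  case True
  then obtain x where x: "x \<noteq> 0" "nu g (ev x) = amax g" "ldir (inv2 g *v ev x) = i" by blast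
  have "amax (g ** nb i) = amax g"
    by (rule amax_eqI[OF x(1)]) (use x g amax_ge[OF g] in \<open>auto simp: nu_nb intro: order_trans[OF diff_left_mono[of 0]]\<close>)
  then show ?thesis using True by simp
next
  case False
  obtain x where x: "x \<noteq> 0" "nu g (ev x) = amax g" using amax_attained[OF g] by blast
  have "amax (g ** nb i) = amax g - 1"
  proof (rule amax_eqI[OF x(1)])
    show "nu (g ** nb i) (ev x) = amax g - 1" using x g False by (auto simp: nu_nb)
    fix y :: "'a poly^2" assume y: "y \<noteq> 0"
    show "nu (g ** nb i) (ev y) \<le> amax g - 1"
      using amax_ge[OF g y] False y g by (cases "nu g (ev y) = amax g") (auto simp: nu_nb)
  qed
  then show ?thesis using False by simp
qed

text \<open>All maximizers are constant multiples of one vector and share its direction. Together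
  with \<open>ht_nb\<close>: one neighbour is higher by one and all others are lower by one.\<close>

lemma amax_nb_pos:
  assumes g: "det g \<noteq> 0" and h: "ht g > 0"
  shows "\<exists>j. \<forall>i. amax (g ** nb i) = amax g - (if i = j then 0 else 1)"
proof -
  obtain s where s: "s \<noteq> 0" "\<forall>y. y \<noteq> 0 \<longrightarrow> nu g (ev y) = amax g \<longrightarrow> (\<exists>c. c \<noteq> 0 \<and> y = [:c:] *s s)"
    "nu g (ev s) = amax g" using amax_maximizers[OF g] h by metis
  define j where "j = ldir (inv2 g *v ev s)"
  have "ldir (inv2 g *v ev y) = j" if y: "y \<noteq> 0" "nu g (ev y) = amax g" for y
  proof -
    obtain c where c: "c \<noteq> 0" "y = [:c:] *s s" using s(2) y by blast
    have "inv2 g *v ev y = fls_const c *s (inv2 g *v ev s)"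
      unfolding c(2) ev_smult pf_const mulv_scale2 ..
    then show ?thesis using c s g unfolding j_def by (simp add: ldir_const)
  qed
  then have "(\<exists>x. x \<noteq> 0 \<and> nu g (ev x) = amax g \<and> ldir (inv2 g *v ev x) = i) \<longleftrightarrow> i = j" for i
    using s by blast
  then show ?thesis by (intro exI[of _ j]) (simp add: amax_nb_general[OF g])
qed

text \<open>The maximizers together with 0 contain a plane over the finite field, and the linear
  form that cuts out the direction \<open>i\<close> has a nontrivial zero on it. So every direction
  is taken by a maximizer.\<close>

lemma amax_nb_zero:
  assumes g: "det g \<noteq> 0" and h: "ht g = 0"
  shows "amax (g ** nb i) = amax g"
proof -
  obtain s t where st: "\<And>c d. c \<noteq> 0 \<or> d \<noteq> 0 \<Longrightarrow> [:c:] *s s + [:d:] *s t \<noteq> 0 \<and> nu g (ev ([:c:] *s s + [:d:] *s t)) = amax g"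
    using amax_maximizers[OF g] h by metis
  define u where "u = inv2 g *v ev s"
  define v where "v = inv2 g *v ev t"
  have uv: "inv2 g *v ev ([:c:] *s s + [:d:] *s t) = fls_const c *s u + fls_const d *s v" for c d
    unfolding u_def v_def by (simp add: ev_add ev_smult pf_const matrix_vector_right_distrib mulv_scale2)
  define l where "l w = (case i of Some b \<Rightarrow> (w$1) $$ amax g - b * (w$2) $$ amax g | None \<Rightarrow> (w$2) $$ amax g)" for w :: "'a fls^2"
  have hl: "hit i (amax g) w \<longleftrightarrow> l w = 0" for w by (auto simp: hit_def l_def split: option.split)
  have lin: "l (fls_const c *s u + fls_const d *s v) = c * l u + d * l v" for c d
    by (simp add: l_def algebra_simps split: option.split)
  obtain c d where cd: "c \<noteq> 0 \<or> d \<noteq> 0" "c * l u + d * l v = 0"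
  proof (cases "l u = 0")
    case True then show ?thesis using that[of 1 0] by simp
  next
    case False then show ?thesis using that[of "- l v" "l u"] by simp
  qed
  define x where "x = [:c:] *s s + [:d:] *s t"
  have x: "x \<noteq> 0" "nu g (ev x) = amax g" using st[OF cd(1)] by (auto simp: x_def)
  have "hit i (amax g) (inv2 g *v ev x)" using hl lin cd uv by (simp add: x_def)
  then have "i = ldir (inv2 g *v ev x)" using hit_ord2[of "inv2 g *v ev x" i] x g by (simp add: nu_def)
  then show ?thesis using x by (auto simp: amax_nb_general[OF g])
qed

lemma ht_nb: "det g \<noteq> 0 \<Longrightarrow> ht (g ** nb i) = ht g + 2 * (amax (g ** nb i) - amax g) + 1"
  by (simp add: ht_def det_mul)

lemma finite_degree_le: "finite {f :: 'a::{field,finite} poly. degree f \<le> n}"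
proof -
  have "{f :: 'a poly. degree f \<le> n} \<subseteq> Poly ` {xs. set xs \<subseteq> UNIV \<and> length xs = Suc n}"
  proof
    fix f :: "'a poly" assume "f \<in> {f. degree f \<le> n}"
    then have "f = Poly (map (coeff f) [0..<Suc n])"
      by (intro poly_eqI) (auto simp: coeff_Poly_eq nth_default_def coeff_eq_0 simp del: upt_Suc)
    then show "f \<in> Poly ` {xs. set xs \<subseteq> UNIV \<and> length xs = Suc n}"
      by (metis (mono_tags, lifting) imageI length_map length_upt mem_Collect_eq minus_nat.diff_0 subset_UNIV)
  qed
  then show ?thesis using finite_lists_length_eq[of "UNIV::'a set" "Suc n"] by (meson finite_imageI finite_subset finite)
qed

lemma finite_nu_ge:
  fixes g :: "'a::{field,finite} fls^2^2"
  assumes "det g \<noteq> 0"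
  shows "finite {x. x = 0 \<or> j \<le> nu g (ev x)}"
proof -
  obtain \<gamma> k c \<kappa> where r: "\<gamma> \<in> GL2A" "c \<noteq> 0" "\<kappa> \<in> GLO" "g = mat c ** (em \<gamma> ** Lam k) ** \<kappa>"
    using reduction[OF assms] by metis
  have nu: "nu g (ev (\<gamma> *v y)) = nu (Lam k) (ev y) - fls_subdegree c" if "y \<noteq> 0" for y
  proof -
    have "ev (\<gamma> *v y) \<noteq> 0" using that r by simp
    then show ?thesis unfolding r(4) using r(1,2,3) by (subst nu_scale) (auto simp: det_mul nu_em)
  qed
  define N where "N = nat (int k + \<bar>j + fls_subdegree c\<bar>)"
  let ?D = "{f :: 'a poly. degree f \<le> N}"
  have "{x. x = 0 \<or> j \<le> nu g (ev x)} \<subseteq> (\<lambda>(a, b). \<gamma> *v V2 a b) ` (?D \<times> ?D)"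
  proof
    fix x :: "'a poly^2" assume x: "x \<in> {x. x = 0 \<or> j \<le> nu g (ev x)}"
    obtain y where y: "x = \<gamma> *v y" using GL2A_surj r(1) by blast
    have "degree (y$1) \<le> N \<and> degree (y$2) \<le> N"
    proof (cases "y = 0")
      case False
      then have "j + fls_subdegree c \<le> nu (Lam k) (ev y)" using x y nu[OF False] r(1) by auto
      then show ?thesis using False by (auto simp: nu_Lam N_def split: if_splits)
    qed (simp add: vec2_eq_iff)
    then show "x \<in> (\<lambda>(a, b). \<gamma> *v V2 a b) ` (?D \<times> ?D)"
      unfolding y by (intro image_eqI[of _ _ "(y$1, y$2)"]) (auto simp: V2_eta)
  qed
  then show ?thesis by (rule finite_subset) (intro finite_imageI finite_cartesian_product finite_degree_le)
qed

section \<open>Behaviour of cochains at the cusps, and finiteness of \<open>H0\<close>\<close>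

section \<open>Cochains of finite support\<close>

lemma monom_X: "fls_X * poly_to_fls (monom 1 (Suc k)) = poly_to_fls (monom 1 k)"
proof -
  have "(monom 1 (Suc k) :: 'a poly) = monom 1 1 * monom 1 k" by (simp add: mult_monom)
  moreover have "poly_to_fls (monom 1 1) = (fls_X_inv :: 'a fls)"
    by (simp add: monom_altdef pf_pCons)
  moreover have "fls_X * fls_X_inv = (1::'a fls)" by (simp add: fls_X_times_conv_shift)
  ultimately show ?thesis by (simp add: pf_mult mult.assoc[symmetric])
qed

lemma Lam_nb_None: "vtx (h ** Lam k ** nb None) = vtx (h ** Lam (Suc k))"
proof -
  have "h ** Lam k ** nb None = mat fls_X ** (h ** Lam (Suc k))"
    unfolding matrix_mul_assoc[symmetric] mat_left_comm2[symmetric]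
    by (simp add: Lam_def nb_def M2_mult mat_M2 monom_X)
  then show ?thesis by (simp add: vtx_scale)
qed

lemma Lam_nb_Some: "h ** Lam (Suc k) ** nb (Some b) = h ** em (M2 1 (monom b (Suc k)) 0 1) ** Lam k"
proof -
  have "poly_to_fls (monom b (Suc k)) = fls_const b * poly_to_fls (monom 1 (Suc k))"
    by (intro fls_eqI) (simp add: pf_nth)
  then show ?thesis unfolding matrix_mul_assoc[symmetric]
    by (simp add: Lam_def nb_def M2_mult em_M2 monom_X mult.commute)
qed

lemma unip_Lam: "degree r \<le> k \<Longrightarrow> det h \<noteq> 0 \<Longrightarrow> vtx (h ** em (M2 1 r 0 1) ** Lam k) = vtx (h ** Lam k)"
proof -
  assume r: "degree r \<le> k" and h: "det h \<noteq> 0"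
  define t where "t = poly_to_fls (monom (1::'a) k)"
  have t: "t \<noteq> 0" "fls_subdegree t = - int k" by (simp_all add: t_def subdegree_monom)
  have "em (M2 1 r 0 1) ** Lam k = Lam k ** M2 1 (poly_to_fls r / t) 0 1"
    using t(1) by (simp add: Lam_def em_M2 M2_mult t_def[symmetric])
  moreover have "M2 1 (poly_to_fls r / t) 0 1 \<in> GLO" using r t
    by (simp del: GLO_det add: GLO_def oge_divide oge_pf)
  ultimately show ?thesis using h vtx_mult_GLO[of "h ** Lam k" "M2 1 (poly_to_fls r / t) 0 1"]
    by (simp add: det_mul matrix_mul_assoc[symmetric])
qed

lemma Gamma0_GL2A: "\<gamma> \<in> Gamma0 n \<Longrightarrow> \<gamma> \<in> GL2A"
  by (simp add: Gamma0_def GL2A_def)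

definition invariant :: "('a::{field,finite} poly^2^2) set \<Rightarrow> ('a edge \<Rightarrow> int) \<Rightarrow> bool" where
  "invariant \<Gamma> f \<longleftrightarrow> (\<forall>\<gamma>\<in>\<Gamma>. \<forall>e\<in>edges. f (edge_act \<gamma> e) = f e)"

lemma harmonic_nb:
  "harmonic f \<Longrightarrow> det g \<noteq> 0 \<Longrightarrow> (\<Sum>i\<in>UNIV. f (vtx g, vtx (g ** nb i))) = 0"
  using sum_nb[of g "\<lambda>w. f (vtx g, w)"] unfolding harmonic_def by auto

lemma harmonic_flip: "harmonic f \<Longrightarrow> (v, w) \<in> edges \<Longrightarrow> f (w, v) = - f (v, w)"
  unfolding harmonic_def by (metis add.commute eq_neg_iff_add_eq_0)

lemma UNIV_option_sum: "(\<Sum>i\<in>(UNIV::'a::finite option set). F i) = F None + (\<Sum>b\<in>UNIV. F (Some b))"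
  by (simp add: UNIV_option_conv sum.reindex)

text \<open>The conjugate by \<open>\<gamma>\<close> of the unipotent matrix has lower left entry
  \<open>\<gamma>$2$1 ^ 2 * \<beta>\<close> up to a unit. Hence the stabilizer of any cusp contains
  all translations by multiples of \<open>n\<close>.\<close>

lemma conj_unip_Gamma0:
  assumes \<gamma>: "\<gamma> \<in> GL2A" and n: "n dvd \<beta>"
  shows "\<exists>\<delta>\<in>Gamma0 n. \<delta> ** \<gamma> = \<gamma> ** M2 1 \<beta> 0 1"
proof -
  obtain u where u: "det \<gamma> * u = 1" using \<gamma> by (auto simp: GL2A_def)
  define \<delta> where "\<delta> = \<gamma> ** M2 1 \<beta> 0 1 ** (mat u ** adj2 \<gamma>)"
  have "\<delta> ** \<gamma> = \<gamma> ** M2 1 \<beta> 0 1 ** (mat u ** mat (det \<gamma>))"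
    unfolding \<delta>_def by (simp add: matrix_mul_assoc[symmetric] adj2_left)
  then have 1: "\<delta> ** \<gamma> = \<gamma> ** M2 1 \<beta> 0 1" using u by (simp add: mat_mult2 mult.commute)
  have "det \<delta> * det \<gamma> = det \<gamma>" using arg_cong[OF 1, of det] by (simp add: det_mul)
  then have "det \<delta> = 1" using \<gamma> by simp
  moreover have "\<delta> $ 2 $ 1 = - (u * \<gamma>$2$1 * \<gamma>$2$1) * \<beta>"
    by (simp add: \<delta>_def matmul2_nth adj2_def mat_M2 algebra_simps)
  then have "n dvd \<delta> $ 2 $ 1" using n by (metis dvd_mult)
  ultimately show ?thesis using 1 by (intro bexI[of _ \<delta>]) (simp_all add: Gamma0_def)
qed

lemma invariant_vtx:
  assumes "invariant \<Gamma> f" "\<gamma> \<in> \<Gamma>" "(vtx g, vtx h) \<in> edges"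
  shows "f (vtx (em \<gamma> ** g), vtx (em \<gamma> ** h)) = f (vtx g, vtx h)"
  using assms unfolding invariant_def by (metis edge_act_vtx)

text \<open>Far enough in the cusp the translations of \<open>conj_unip_Gamma0\<close> fix the
  vertex and permute its lower neighbours transitively. So these edges carry equal values, and
  harmonicity makes the edge going up carry their sum.\<close>

lemma cusp_flow:
  fixes f :: "'a::{field,finite} edge \<Rightarrow> int"
  assumes har: "harmonic f" and inv: "invariant (Gamma0 n) f" and n: "n \<noteq> 0"
    and \<gamma>: "\<gamma> \<in> GL2A" and k: "degree n \<le> Suc k"
  shows "f (vtx (em \<gamma> ** Lam (Suc k)), vtx (em \<gamma> ** Lam (Suc (Suc k)))) =
    int CARD('a) * f (vtx (em \<gamma> ** Lam k), vtx (em \<gamma> ** Lam (Suc k)))"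
proof -
  let ?g = "em \<gamma> ** Lam (Suc k)"
  have g: "det ?g \<noteq> 0" using \<gamma> by (simp add: det_mul)
  have b0: "vtx (?g ** nb (Some 0)) = vtx (em \<gamma> ** Lam k)"
    by (simp add: Lam_nb_Some em_M2) (simp add: mat_M2[symmetric])
  have "f (vtx ?g, vtx (?g ** nb (Some b))) = f (vtx ?g, vtx (?g ** nb (Some 0)))" for b
  proof -
    \<comment> \<open>\<open>\<beta>\<close> is a multiple of \<open>n\<close> of degree at most
      \<open>Suc k\<close> with coefficient \<open>b\<close> at \<open>Suc k\<close>. The difference
      \<open>r\<close> to the monomial has degree at most \<open>k\<close> and so fixes the lower
      vertex.\<close>
    define m where "m = monom (b / lead_coeff n) (Suc k - degree n)"
    define \<beta> where "\<beta> = n * m"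
    define r where "r = \<beta> - monom b (Suc k)"
    have cb: "coeff \<beta> j = (if Suc k - degree n \<le> j then b / lead_coeff n * coeff n (j - (Suc k - degree n)) else 0)" for j
      by (simp add: \<beta>_def m_def mult.commute[of n] coeff_monom_mult)
    have dr: "degree r \<le> k"
    proof (rule degree_le, intro allI impI)
      fix i assume i: "k < i"
      show "coeff r i = 0"
      proof (cases "i = Suc k")
        case True
        then show ?thesis using n k by (simp add: r_def cb)
      next
        case False
        then have "degree n < i - (Suc k - degree n)" using i k by linarith
        then show ?thesis using False i by (simp add: r_def cb coeff_eq_0)
      qed
    qed
    have db: "degree \<beta> \<le> Suc k"
      using dr degree_add_le[of r "Suc k" "monom b (Suc k)"] degree_monom_le[of b "Suc k"]
      by (simp add: r_def)
    obtain \<delta> where \<delta>: "\<delta> \<in> Gamma0 n" "\<delta> ** \<gamma> = \<gamma> ** M2 1 \<beta> 0 1"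
      using conj_unip_Gamma0[OF \<gamma>, of n \<beta>] by (auto simp: \<beta>_def)
    have e: "em \<delta> ** em \<gamma> = em \<gamma> ** em (M2 1 \<beta> 0 1)" by (metis \<delta>(2) em_mult)
    have 1: "vtx (em \<delta> ** ?g) = vtx ?g"
      using e db \<gamma> by (simp add: matrix_mul_assoc unip_Lam)
    have "M2 1 \<beta> 0 1 = M2 1 (monom b (Suc k)) 0 1 ** M2 1 r 0 1" by (simp add: M2_mult r_def)
    then have "em \<delta> ** (em \<gamma> ** Lam k) = em \<gamma> ** em (M2 1 (monom b (Suc k)) 0 1) ** em (M2 1 r 0 1) ** Lam k"
      using e by (simp add: em_mult matrix_mul_assoc)
    moreover have "det (em \<gamma> ** em (M2 1 (monom b (Suc k)) 0 1)) \<noteq> 0" using \<gamma> by (simp add: det_mul)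
    ultimately have 2: "vtx (em \<delta> ** (em \<gamma> ** Lam k)) = vtx (?g ** nb (Some b))"
      using dr by (simp add: unip_Lam Lam_nb_Some)
    have "(vtx ?g, vtx (em \<gamma> ** Lam k)) \<in> edges" using g b0 edges_iff[OF g] by metis
    from invariant_vtx[OF inv \<delta>(1) this] show ?thesis using 1 2 b0 by simp
  qed
  moreover have "(vtx ?g, vtx (em \<gamma> ** Lam k)) \<in> edges" using g b0 edges_iff[OF g] by metis
  then have "f (vtx ?g, vtx (em \<gamma> ** Lam k)) = - f (vtx (em \<gamma> ** Lam k), vtx ?g)"
    using harmonic_flip[OF har edges_sym] by fastforce
  ultimately show ?thesis
    using harmonic_nb[OF har g] b0 by (simp add: UNIV_option_sum Lam_nb_None)
qed

lemma up_edge: "\<gamma> \<in> GL2A \<Longrightarrow> (vtx (em \<gamma> ** Lam k), vtx (em \<gamma> ** Lam (Suc k))) \<in> edges"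
  by (subst edges_iff) (auto simp: det_mul Lam_nb_None intro!: exI[of _ None])

text \<open>By \<open>cusp_flow\<close> a nonzero value propagates along the whole ray. The heights
  of its edges are unbounded, so they lie in infinitely many orbits, against finite support.\<close>

lemma H0_cusp_zero:
  fixes f :: "'a::{field,finite} edge \<Rightarrow> int"
  assumes f: "f \<in> H0 n" and n: "n \<noteq> 0" and \<gamma>: "\<gamma> \<in> GL2A" and k: "degree n \<le> Suc k"
  shows "f (vtx (em \<gamma> ** Lam k), vtx (em \<gamma> ** Lam (Suc k))) = 0"
proof (rule ccontr)
  let ?e = "\<lambda>j. (vtx (em \<gamma> ** Lam j), vtx (em \<gamma> ** Lam (Suc j)))"
  assume nz: "f (?e k) \<noteq> 0"
  have har: "harmonic f" and inv: "invariant (Gamma0 n) f" using f by (auto simp: H0_def invariant_def)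
  obtain S where S: "finite S" "S \<subseteq> edges"
      "\<And>e. e \<in> edges \<Longrightarrow> f e \<noteq> 0 \<Longrightarrow> \<exists>\<gamma>\<in>Gamma0 n. \<exists>s\<in>S. e = edge_act \<gamma> s"
    using f by (auto simp: H0_def)
  have nz': "f (?e (k + j)) \<noteq> 0" for j
  proof (induction j)
    case (Suc j)
    then show ?case using cusp_flow[OF har inv n \<gamma>, of "k + j"] k by simp
  qed (use nz in simp)
  define H where "H e = vfun ht (fst e)" for e :: "'a edge"
  have "int (k + j) \<in> H ` S" for j
  proof -
    obtain \<delta> s where \<delta>: "\<delta> \<in> Gamma0 n" "s \<in> S" "?e (k + j) = edge_act \<delta> s"
      using S(3)[OF up_edge[OF \<gamma>] nz'] by blast
    have "s \<in> edges" using S(2) \<delta>(2) by blast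
    then obtain g i where g: "det g \<noteq> 0" "s = (vtx g, vtx (g ** nb i))" by (rule edges_cases)
    have *: "\<delta> \<in> GL2A" using \<delta> Gamma0_GL2A by blast
    have "H (?e (k + j)) = H s" using g * unfolding \<delta>(3) H_def
      by (simp add: edge_act_vtx vfun_vtx[OF ht_vinv] det_mul ht_em)
    moreover have "H (?e (k + j)) = int (k + j)" unfolding H_def using \<gamma>
      by (simp add: vfun_vtx[OF ht_vinv] det_mul ht_em ht_Lam)
    ultimately show ?thesis using \<delta>(2) by (metis imageI)
  qed
  then have "range (\<lambda>j. int (k + j)) \<subseteq> H ` S" by blast
  moreover have "infinite (range (\<lambda>j. int (k + j)))" by (rule range_inj_infinite) (auto simp: inj_def)
  ultimately show False using S(1) finite_subset by blast
qed

text \<open>An edge whose origin is higher than \<open>B\<close> is, up to orientation, a translate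
  of an edge of the ray with lower end at height at least \<open>B\<close>.\<close>

lemma up_edges_vanish:
  fixes f :: "'a::{field,finite} edge \<Rightarrow> int"
  assumes har: "harmonic f"
    and van: "\<And>\<gamma> k. \<gamma> \<in> GL2A \<Longrightarrow> B \<le> k \<Longrightarrow> f (vtx (em \<gamma> ** Lam k), vtx (em \<gamma> ** Lam (Suc k))) = 0"
    and g: "det g \<noteq> 0" "int B < ht g"
  shows "f (vtx g, vtx (g ** nb i)) = 0"
proof -
  obtain \<gamma> where \<gamma>: "\<gamma> \<in> GL2A" "vtx g = vtx (em \<gamma> ** Lam (nat (ht g)))" using reduction_ht[OF g(1)] by metis
  obtain k where k: "nat (ht g) = Suc k" "B \<le> k" using g(2) by (cases "nat (ht g)") auto
  have d: "det (em \<gamma> ** Lam (Suc k)) \<noteq> 0" using \<gamma> by (simp add: det_mul)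
  have "(vtx g, vtx (g ** nb i)) \<in> edges" using edges_iff[OF g(1)] by blast
  then obtain j where j: "vtx (g ** nb i) = vtx (em \<gamma> ** Lam (Suc k) ** nb j)"
    using edges_iff[OF d] \<gamma>(2) k by auto
  show ?thesis
  proof (cases j)
    case None
    then show ?thesis using j van[OF \<gamma>(1), of "Suc k"] k \<gamma>(2) by (simp add: Lam_nb_None)
  next
    case (Some b)
    define \<gamma>' where "\<gamma>' = \<gamma> ** M2 1 (monom b (Suc k)) 0 1"
    have \<gamma>': "\<gamma>' \<in> GL2A" unfolding \<gamma>'_def using \<gamma> by (intro GL2A_mult) (auto simp: GL2A_def)
    have w: "vtx (g ** nb i) = vtx (em \<gamma>' ** Lam k)" using j Some by (simp add: Lam_nb_Some \<gamma>'_def em_mult)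
    have v: "vtx g = vtx (em \<gamma>' ** Lam (Suc k))"
      using \<gamma> k degree_monom_le[of b "Suc k"] by (simp add: \<gamma>'_def em_mult unip_Lam)
    show ?thesis unfolding v w using van[OF \<gamma>' k(2)] harmonic_flip[OF har up_edge[OF \<gamma>']] by simp
  qed
qed

lemma H0_vanish:
  assumes "f \<in> H0 n" "n \<noteq> 0" "det g \<noteq> 0" "int (degree n) < ht g"
  shows "f (vtx g, vtx (g ** nb i)) = 0"
  using assms by (intro up_edges_vanish[of f "degree n"] H0_cusp_zero) (auto simp: H0_def)

text \<open>The coset of a matrix is determined by its bottom row modulo \<open>n\<close>.\<close>

lemma Gamma0_cosets:
  fixes n :: "'a::{field,finite} poly"
  assumes n: "n \<noteq> 0"
  obtains R where "finite R" "R \<subseteq> GL2A" "\<And>\<gamma>. \<gamma> \<in> GL2A \<Longrightarrow> \<exists>\<rho>\<in>R. \<exists>\<delta>\<in>Gamma0 n. \<gamma> = \<delta> ** \<rho>"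
proof -
  define f where "f \<gamma> = (\<gamma>$2$1 mod n, \<gamma>$2$2 mod n)" for \<gamma> :: "'a poly^2^2"
  let ?D = "{h :: 'a poly. degree h \<le> degree n}"
  have "h mod n \<in> ?D" for h using degree_mod_less[OF n, of h] by auto
  then have "f ` GL2A \<subseteq> ?D \<times> ?D" by (auto simp: f_def)
  then have "finite (f ` GL2A)" by (rule finite_subset) (intro finite_cartesian_product finite_degree_le)
  then obtain R where R: "R \<subseteq> GL2A" "finite R" "f ` GL2A = f ` R" by (metis finite_subset_image order_refl)
  show ?thesis
  proof (rule that[OF R(2,1)])
    fix \<gamma> :: "'a poly^2^2" assume \<gamma>: "\<gamma> \<in> GL2A"
    then obtain \<rho> where \<rho>: "\<rho> \<in> R" "f \<gamma> = f \<rho>" using R(3) by (metis imageE imageI)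
    have \<rho>': "\<rho> \<in> GL2A" using \<rho> R by blast
    then obtain u where u: "det \<rho> * u = 1" by (auto simp: GL2A_def)
    define \<delta> where "\<delta> = \<gamma> ** (mat u ** adj2 \<rho>)"
    have 1: "\<delta> ** \<rho> = \<gamma>" using u unfolding \<delta>_def
      by (simp add: matrix_mul_assoc[symmetric] adj2_left mat_mult2 mult.commute)
    have "det \<delta> * det \<rho> = det \<gamma>" using arg_cong[OF 1, of det] by (simp add: det_mul)
    then have "det \<delta> dvd 1" using \<gamma> unfolding GL2A_def by (metis dvd_triv_left dvd_trans mem_Collect_eq)
    moreover have "\<delta> $ 2 $ 1 = u * (\<gamma>$2$1 * \<rho>$2$2 - \<gamma>$2$2 * \<rho>$2$1)"
      by (simp add: \<delta>_def matmul2_nth adj2_def mat_M2 algebra_simps)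
    moreover have "n dvd \<gamma>$2$1 * \<rho>$2$2 - \<gamma>$2$2 * \<rho>$2$1"
    proof -
      have "n dvd \<gamma>$2$1 - \<rho>$2$1" "n dvd \<gamma>$2$2 - \<rho>$2$2" using \<rho>(2) by (simp_all add: f_def mod_eq_dvd_iff)
      then have "n dvd (\<gamma>$2$1 - \<rho>$2$1) * \<rho>$2$2 - (\<gamma>$2$2 - \<rho>$2$2) * \<rho>$2$1" by simp
      then show ?thesis by (simp add: algebra_simps)
    qed
    ultimately have "\<delta> \<in> Gamma0 n" by (simp add: Gamma0_def)
    then show "\<exists>\<rho>\<in>R. \<exists>\<delta>\<in>Gamma0 n. \<gamma> = \<delta> ** \<rho>" using 1 \<rho> by metis
  qed
qed

lemma finite_edges_mod:
  fixes n :: "'a::{field,finite} poly"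
  assumes n: "n \<noteq> 0"
  obtains S where "finite S" "S \<subseteq> edges"
    "\<And>g i. det g \<noteq> 0 \<Longrightarrow> ht g \<le> int B \<Longrightarrow> \<exists>\<gamma>\<in>Gamma0 n. \<exists>s\<in>S. (vtx g, vtx (g ** nb i)) = edge_act \<gamma> s"
proof -
  obtain R where R: "finite R" "R \<subseteq> GL2A" "\<And>\<gamma>. \<gamma> \<in> GL2A \<Longrightarrow> \<exists>\<rho>\<in>R. \<exists>\<delta>\<in>Gamma0 n. \<gamma> = \<delta> ** \<rho>"
    using Gamma0_cosets[OF n] by blast
  define F where "F = (\<lambda>(\<rho>, k, i). (vtx (em \<rho> ** Lam k), vtx (em \<rho> ** Lam k ** nb i)) :: 'a edge)"
  define S where "S = F ` (R \<times> {..B} \<times> UNIV)"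
  have "(vtx (em \<rho> ** Lam k), vtx (em \<rho> ** Lam k ** nb i)) \<in> edges" if "\<rho> \<in> R" for \<rho> k i
  proof -
    have "\<rho> \<in> GL2A" using that R(2) by blast
    then have "det (em \<rho> ** Lam k) \<noteq> 0" by (simp add: det_mul)
    then show ?thesis using edges_iff by blast
  qed
  then have "F ` (R \<times> {..B} \<times> UNIV) \<subseteq> edges" by (auto simp: F_def)
  moreover have "finite (F ` (R \<times> {..B} \<times> UNIV))" using R(1) by auto
  moreover have "\<exists>\<gamma>\<in>Gamma0 n. \<exists>s\<in>S. (vtx g, vtx (g ** nb i)) = edge_act \<gamma> s"
    if g: "det g \<noteq> 0" "ht g \<le> int B" for g i
  proof -
    obtain \<gamma> where \<gamma>: "\<gamma> \<in> GL2A" "vtx g = vtx (em \<gamma> ** Lam (nat (ht g)))" using reduction_ht[OF g(1)] by metis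
    obtain \<rho> \<delta> where rd: "\<rho> \<in> R" "\<delta> \<in> Gamma0 n" "\<gamma> = \<delta> ** \<rho>" using R(3) \<gamma> by blast
    have d: "det (em \<gamma> ** Lam (nat (ht g))) \<noteq> 0" using \<gamma> by (simp add: det_mul)
    have "(vtx g, vtx (g ** nb i)) \<in> edges" using edges_iff[OF g(1)] by blast
    then obtain j where j: "vtx (g ** nb i) = vtx (em \<gamma> ** Lam (nat (ht g)) ** nb j)"
      using edges_iff[OF d] \<gamma>(2) by auto
    have "(vtx g, vtx (g ** nb i)) = edge_act \<delta> (F (\<rho>, nat (ht g), j))"
      by (simp add: F_def edge_act_vtx j \<gamma>(2) rd(3) em_mult matrix_mul_assoc)
    moreover have "F (\<rho>, nat (ht g), j) \<in> S" unfolding S_def using rd g by auto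
    ultimately show ?thesis using rd(2) by blast
  qed
  ultimately show ?thesis using that unfolding S_def by blast
qed

text \<open>Converse of \<open>H0_vanish\<close>: edges of bounded height form finitely many orbits,
  so vanishing above some height gives finite support.\<close>

lemma H0_I:
  assumes n: "n \<noteq> 0" and "harmonic f" "invariant (Gamma0 n) f"
    and van: "\<And>g i. det g \<noteq> 0 \<Longrightarrow> int B < ht g \<Longrightarrow> f (vtx g, vtx (g ** nb i)) = 0"
  shows "f \<in> H0 n"
proof -
  obtain S where S: "finite S" "S \<subseteq> edges"
    "\<And>g i. det g \<noteq> 0 \<Longrightarrow> ht g \<le> int B \<Longrightarrow> \<exists>\<gamma>\<in>Gamma0 n. \<exists>s\<in>S. (vtx g, vtx (g ** nb i)) = edge_act \<gamma> s"
    using finite_edges_mod[OF n] by metis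
  have "\<exists>\<gamma>\<in>Gamma0 n. \<exists>s\<in>S. e = edge_act \<gamma> s" if e: "e \<in> edges" "f e \<noteq> 0" for e
    using e(1)
  proof (rule edges_cases)
    fix g i assume g: "det g \<noteq> 0" "e = (vtx g, vtx (g ** nb i))"
    then have "\<not> int B < ht g" using van e(2) by auto
    then show ?thesis using S(3)[of g i] g by simp
  qed
  then show ?thesis using assms S(1,2) unfolding H0_def invariant_def by blast
qed

text \<open>Evaluation at \<open>S\<close> embeds \<open>H0 n\<close> into a free abelian group of
  finite rank; finite generation of \<open>H0 n\<close> and of the Hecke algebra rests on
  this.\<close>

lemma H0_determined:
  assumes n: "n \<noteq> 0"
  obtains S where "finite S" "\<And>f. f \<in> H0 n \<Longrightarrow> (\<And>s. s \<in> S \<Longrightarrow> f s = 0) \<Longrightarrow> f = (\<lambda>e. 0)"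
proof -
  obtain S where S: "finite S" "S \<subseteq> edges"
    "\<And>g i. det g \<noteq> 0 \<Longrightarrow> ht g \<le> int (degree n) \<Longrightarrow> \<exists>\<gamma>\<in>Gamma0 n. \<exists>s\<in>S. (vtx g, vtx (g ** nb i)) = edge_act \<gamma> s"
    using finite_edges_mod[OF n] by metis
  have "f = (\<lambda>e. 0)" if f: "f \<in> H0 n" "\<And>s. s \<in> S \<Longrightarrow> f s = 0" for f
  proof
    fix e
    show "f e = 0"
    proof (cases "e \<in> edges")
      case True
      then obtain g i where g: "det g \<noteq> 0" "e = (vtx g, vtx (g ** nb i))" by (rule edges_cases)
      show ?thesis
      proof (cases "int (degree n) < ht g")
        case True
        then show ?thesis using H0_vanish[OF f(1) n g(1)] g by simp
      next
        case False
        then obtain \<gamma> s where \<gamma>: "\<gamma> \<in> Gamma0 n" "s \<in> S" "e = edge_act \<gamma> s" using S(3) g by fastforce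
        then have "s \<in> edges" using S(2) by blast
        then have "f e = f s" using f(1) \<gamma> by (simp add: H0_def)
        then show ?thesis using f(2) \<gamma> by simp
      qed
    qed (use f(1) in \<open>cases e; auto simp: H0_def harmonic_def\<close>)
  qed
  then show ?thesis using that S(1) by blast
qed

section \<open>Polynomial arithmetic and Hecke operators\<close>

section \<open>Arithmetic of polynomials\<close>

lemma bezout_poly:
  fixes x z :: "'a::field poly"
  shows "\<exists>u v d. d = u * x + v * z \<and> d dvd x \<and> d dvd z"
proof (induction "euclidean_size z" arbitrary: x z rule: less_induct)
  case less
  show ?case
  proof (cases "z = 0")
    case True
    then show ?thesis by (intro exI[of _ 1] exI[of _ 0] exI[of _ x]) simp
  next
    case False
    then have "euclidean_size (x mod z) < euclidean_size z" by (rule mod_size_less)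
    then obtain u v d where d: "d = u * z + v * (x mod z)" "d dvd z" "d dvd x mod z"
      using less.hyps by blast
    have "d = v * x + (u - v * (x div z)) * z" unfolding d(1) minus_div_mult_eq_mod[symmetric]
      by (simp add: algebra_simps)
    moreover have "d dvd x" using d(2,3) by (metis dvd_mod_imp_dvd)
    ultimately show ?thesis using d(2) by blast
  qed
qed

text \<open>Over an arbitrary field there is no class instance giving Bezout coefficients for \<open>coprime\<close>.\<close>

definition cop :: "'a::field poly \<Rightarrow> 'a poly \<Rightarrow> bool" where
  "cop a b \<longleftrightarrow> (\<exists>u v. u * a + v * b = 1)"

lemma cop_unitI:
  assumes "u * a + v * b = d" "d dvd 1" shows "cop a b"
proof -
  obtain e where "1 = d * e" using assms(2) by (rule dvdE)
  then have "(e * u) * a + (e * v) * b = 1" using assms(1) by (metis distrib_left mult.assoc mult.commute)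
  then show ?thesis unfolding cop_def by blast
qed

lemma cop_iff: "cop a b \<longleftrightarrow> coprime a b"
proof
  assume "cop a b"
  then obtain u v where uv: "u * a + v * b = 1" by (auto simp: cop_def)
  show "coprime a b"
  proof (rule coprimeI)
    fix c assume "c dvd a" "c dvd b"
    then have "c dvd u * a + v * b" by simp
    then show "is_unit c" using uv by simp
  qed
next
  assume c: "coprime a b"
  obtain u v d where d: "d = u * a + v * b" "d dvd a" "d dvd b" using bezout_poly by blast
  then have "d dvd 1" using c coprime_common_divisor by blast
  then show "cop a b" by (rule cop_unitI[OF d(1)[symmetric]])
qed

lemma cop_sym: "cop a b \<Longrightarrow> cop b a"
  unfolding cop_def by (metis add.commute)

lemma cop_mult: "cop a n \<Longrightarrow> cop b n \<Longrightarrow> cop (a * b) n"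
proof -
  assume "cop a n" "cop b n"
  then obtain u v u' v' where 1: "u * a + v * n = 1" and 2: "u' * b + v' * n = 1" by (auto simp: cop_def)
  have "(u * u') * (a * b) + (v + u * a * v') * n = u * a * (u' * b + v' * n) + v * n" by (simp add: algebra_simps)
  then show ?thesis using 1 2 unfolding cop_def by (metis mult.right_neutral)
qed

lemma cop_dvd: "cop a n \<Longrightarrow> b dvd a \<Longrightarrow> cop b n"
  unfolding cop_iff by (metis coprime_divisors dvd_refl)

lemma cop_dvd_mult: "cop a n \<Longrightarrow> n dvd a * b \<Longrightarrow> n dvd b"
proof -
  assume "cop a n" and n: "n dvd a * b"
  then obtain u v where 1: "u * a + v * n = 1" by (auto simp: cop_def)
  have "u * (a * b) + v * b * n = (u * a + v * n) * b" by (simp add: algebra_simps)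
  then have "b = u * (a * b) + v * b * n" using 1 by simp
  then show ?thesis using n by (metis dvd_add dvd_mult dvd_triv_right)
qed

lemma cop_add: "cop a n \<Longrightarrow> cop (a + b * n) n"
proof -
  assume "cop a n"
  then obtain u v where "u * a + v * n = 1" by (auto simp: cop_def)
  then have "u * (a + b * n) + (v - u * b) * n = 1" by (simp add: algebra_simps)
  then show ?thesis unfolding cop_def by blast
qed

lemma cop_unit: "a dvd 1 \<Longrightarrow> cop a n"
  by (rule cop_unitI[of 1 a 0 n a]) simp_all

lemma prime_cop:
  assumes "prime_elem (q :: 'a::field poly)" "\<not> q dvd a"
  shows "cop q a"
proof -
  obtain u v d where d: "d = u * q + v * a" "d dvd q" "d dvd a" using bezout_poly by blast
  from d(2) obtain e where e: "q = d * e" by (elim dvdE)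
  have "\<not> q dvd d" using d(3) assms(2) dvd_trans by blast
  then have "q dvd e" using assms(1) e prime_elem_dvd_mult_iff[of q d e] by simp
  then obtain e' where "e = q * e'" by (elim dvdE)
  then have "q * 1 = q * (d * e')" using e by simp
  then have "d * e' = 1" using assms(1) by (metis mult_left_cancel prime_elem_not_zeroI)
  then have "e' * u * q + e' * v * a = 1" using d(1) by (simp add: algebra_simps)
  then show ?thesis unfolding cop_def by blast
qed

lemma deg0_unit: "degree c = 0 \<Longrightarrow> c \<noteq> 0 \<Longrightarrow> is_unit (c :: 'a::field poly)"
  by (auto elim!: degree_eq_zeroE simp: is_unit_const_poly_iff dvd_field_iff)

lemma prime_degree_pos: "prime_elem (q :: 'a::field poly) \<Longrightarrow> degree q > 0"
  by (metis deg0_unit gr_zeroI prime_elem_def)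

text \<open>Without divisors of intermediate degree, a common divisor
  \<open>d = u * q + v * y\<close> is either associated with \<open>n\<close>, whence
  \<open>q\<close> divides \<open>y\<close>, or a unit, whence \<open>q\<close> divides the other
  factor.\<close>

lemma prime_factor_exists:
  fixes n :: "'a::{field,finite} poly"
  shows "degree n > 0 \<Longrightarrow> \<exists>q. monic q \<and> prime_elem q \<and> q dvd n"
proof (induction "degree n" arbitrary: n rule: less_induct)
  case less
  show ?case
  proof (cases "\<exists>d. d dvd n \<and> 0 < degree d \<and> degree d < degree n")
    case True
    then show ?thesis using less.hyps dvd_trans by metis
  next
    case False
    have n0: "n \<noteq> 0" using less.prems by auto
    define q where "q = smult (1 / lead_coeff n) n"
    have q: "monic q" "q dvd n" "n dvd q" "degree q = degree n" "q \<noteq> 0"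
      using n0 by (auto simp: q_def monic_def smult_dvd_iff dvd_smult_iff)
    have "prime_elem q"
    proof (rule prime_elemI)
      show "q \<noteq> 0" by fact
      show "\<not> is_unit q" using less.prems q by (auto simp: is_unit_poly_iff)
      fix x y assume xy: "q dvd x * y"
      show "q dvd x \<or> q dvd y"
      proof (rule disjCI)
        assume ny: "\<not> q dvd y"
        obtain u v d where d: "d = u * q + v * y" "d dvd q" "d dvd y" using bezout_poly by blast
        have d0: "d \<noteq> 0" using d(2) q(5) by auto
        have dn: "d dvd n" using d(2) q(2) dvd_trans by blast
        have "degree d \<noteq> degree n"
        proof
          assume e: "degree d = degree n"
          from dn obtain c where c: "n = d * c" by (elim dvdE)
          then have "degree c = 0" using e n0 by (auto simp: degree_mult_eq)
          moreover have "c \<noteq> 0" using c n0 by auto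
          ultimately have "is_unit c" by (rule deg0_unit)
          then have "n dvd d" unfolding c by (simp add: mult_unit_dvd_iff)
          then show False using ny d(3) q(2) dvd_trans by blast
        qed
        then have "degree d = 0" using False dn dvd_imp_degree_le[OF dn n0] by fastforce
        then have "is_unit d" using d0 by (rule deg0_unit)
        then have "cop q y" by (rule cop_unitI[OF d(1)[symmetric]])
        then show "q dvd x" using xy cop_dvd_mult[of y q x] cop_sym by (auto simp: mult.commute)
      qed
    qed
    then show ?thesis using q by blast
  qed
qed

lemma monic_nz [simp]: "monic f \<Longrightarrow> f \<noteq> 0"
  by (auto simp: monic_def)

lemma monic_mult: "monic a \<Longrightarrow> monic b \<Longrightarrow> monic (a * b)"
  by (simp add: monic_def lead_coeff_mult)

lemma monic_1 [simp]: "monic 1"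
  by (simp add: monic_def)

lemma monic_unit: "monic a \<Longrightarrow> a dvd 1 \<Longrightarrow> a = 1"
proof -
  assume a: "monic a" "a dvd 1"
  then obtain c where c: "a = [:c:]" using is_unit_poly_iff by blast
  then have "c = 1" using a(1) by (simp add: monic_def)
  then show "a = 1" by (simp add: c one_pCons)
qed

lemma monic_cancel: "monic (a * b) \<Longrightarrow> monic a \<Longrightarrow> monic b"
  by (simp add: monic_def lead_coeff_mult)

section \<open>Residues\<close>

definition Res :: "'a::{field,finite} poly \<Rightarrow> 'a poly set" where
  "Res d = {b. b = 0 \<or> degree b < degree d}"

lemma finite_Res [simp]: "finite (Res d)"
  by (rule finite_subset[OF _ finite_degree_le[of "degree d"]]) (auto simp: Res_def)

lemma mod_Res [simp]: "d \<noteq> 0 \<Longrightarrow> b mod d \<in> Res d"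
  using degree_mod_less[of d b] by (auto simp: Res_def)

lemma Res_mod: "b \<in> Res d \<Longrightarrow> b mod d = b"
  by (auto simp: Res_def mod_poly_less)

lemma Res_eqI: "b \<in> Res d \<Longrightarrow> c \<in> Res d \<Longrightarrow> d dvd b - c \<Longrightarrow> b = c"
  by (metis Res_mod mod_eq_dvd_iff)

lemma Res_1: "Res 1 = {0}"
  by (auto simp: Res_def)

lemma card_Res: "card (Res d) = CARD('a) ^ degree (d :: 'a::{field,finite} poly)"
proof -
  let ?L = "{xs :: 'a list. set xs \<subseteq> UNIV \<and> length xs = degree d}"
  have "bij_betw Poly ?L (Res d)"
  proof (rule bij_betw_byWitness[where f' = "\<lambda>f. map (coeff f) [0..<degree d]"])
    show "\<forall>xs\<in>?L. map (coeff (Poly xs)) [0..<degree d] = xs"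
      by (auto intro!: nth_equalityI simp: coeff_Poly_eq nth_default_def)
    show "\<forall>f\<in>Res d. Poly (map (coeff f) [0..<degree d]) = f"
      by (auto intro!: poly_eqI simp: coeff_Poly_eq nth_default_def Res_def coeff_eq_0)
    show "Poly ` ?L \<subseteq> Res d"
    proof
      fix f assume "f \<in> Poly ` ?L"
      then obtain xs where xs: "f = Poly xs" "length xs = degree d" by auto
      have "degree f < degree d" if "f \<noteq> 0"
      proof -
        have "coeff f (degree f) \<noteq> 0" using that by simp
        then show ?thesis using xs by (auto simp: coeff_Poly_eq nth_default_def split: if_splits)
      qed
      then show "f \<in> Res d" by (auto simp: Res_def)
    qed
    show "(\<lambda>f. map (coeff f) [0..<degree d]) ` Res d \<subseteq> ?L" by auto
  qed
  then have "card ?L = card (Res d)" by (rule bij_betw_same_card)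
  then show ?thesis using card_lists_length_eq[OF finite, of "UNIV :: 'a set" "degree d"] by simp
qed

text \<open>An injective map of the finite set of residue classes to itself is a
  permutation.\<close>

lemma sum_Res_perm:
  assumes d: "d \<noteq> 0" and per: "\<And>b x. h (b + x * d) = h b"
    and inj: "\<And>b c. b \<in> Res d \<Longrightarrow> c \<in> Res d \<Longrightarrow> d dvd p b - p c \<Longrightarrow> b = c"
  shows "(\<Sum>b\<in>Res d. h (p b)) = (\<Sum>b\<in>Res d. h b)"
proof -
  have hm: "h (b mod d) = h b" for b using per[of "b mod d" "b div d"] by simp
  have i: "inj_on (\<lambda>b. p b mod d) (Res d)" using inj by (auto simp: inj_on_def mod_eq_dvd_iff)
  have im: "(\<lambda>b. p b mod d) ` Res d = Res d" using d i by (intro endo_inj_surj) auto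
  have "(\<Sum>b\<in>Res d. h b) = (\<Sum>b\<in>Res d. h (p b mod d))"
    using sum.reindex[OF i, of h] unfolding im by (simp add: o_def)
  then show ?thesis by (simp add: hm)
qed

lemma Res_mult_comb:
  assumes "b \<in> Res d" "b' \<in> Res q" "q \<noteq> 0" "d \<noteq> 0"
  shows "b + b' * d \<in> Res (q * d)"
proof (cases "b' = 0")
  case True
  then show ?thesis using assms by (auto simp: Res_def degree_mult_eq)
next
  case False
  then have "degree (b' * d) < degree (q * d)" using assms by (auto simp: Res_def degree_mult_eq)
  moreover have "degree b < degree (q * d) \<or> b = 0" using assms by (auto simp: Res_def degree_mult_eq)
  ultimately show ?thesis unfolding Res_def using degree_add_less by auto
qed

lemma div_Res:
  assumes c: "c \<in> Res (q * d)" and q: "q \<noteq> 0" and d: "d \<noteq> 0"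
  shows "c div d \<in> Res q"
proof (cases "c div d = 0")
  case False
  then have "degree c \<ge> degree d" using div_poly_less by (metis not_less)
  have "degree (c div d * d) \<le> max (degree c) (degree (c mod d))"
    using degree_diff_le_max[of c "c mod d"] by (simp add: minus_mod_eq_div_mult)
  moreover have "degree (c mod d) \<le> degree c" using degree_mod_less[of d c] d \<open>degree c \<ge> degree d\<close> by auto
  ultimately have "degree (c div d) + degree d \<le> degree c" using False d by (simp add: degree_mult_eq)
  moreover have "c \<noteq> 0" using False by auto
  ultimately show ?thesis using c q d by (auto simp: Res_def degree_mult_eq)
qed (simp add: Res_def)

lemma sum_Res_mult:
  assumes q: "q \<noteq> 0" and d: "d \<noteq> 0"
  shows "(\<Sum>b\<in>Res d. \<Sum>b'\<in>Res q. h (b + b' * d)) = (\<Sum>c\<in>Res (q * d). h c)"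
proof -
  have "bij_betw (\<lambda>(b, b'). b + b' * d) (Res d \<times> Res q) (Res (q * d))"
  proof (rule bij_betw_byWitness[where f' = "\<lambda>c. (c mod d, c div d)"])
    have *: "(b + b' * d) mod d = b" "(b + b' * d) div d = b'" if "b \<in> Res d" for b b'
      using that d by (simp_all add: Res_mod mod_mult_self1) (auto simp: Res_def div_poly_less)
    show "\<forall>a\<in>Res d \<times> Res q. ((case a of (b, b') \<Rightarrow> b + b' * d) mod d, (case a of (b, b') \<Rightarrow> b + b' * d) div d) = a"
      using * by auto
    show "\<forall>a'\<in>Res (q * d). (case (a' mod d, a' div d) of (b, b') \<Rightarrow> b + b' * d) = a'" by simp
    show "(\<lambda>(b, b'). b + b' * d) ` (Res d \<times> Res q) \<subseteq> Res (q * d)"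
      using Res_mult_comb[OF _ _ q d] by auto
    show "(\<lambda>c. (c mod d, c div d)) ` Res (q * d) \<subseteq> Res d \<times> Res q"
      using div_Res[OF _ q d] d by auto
  qed
  then have "(\<Sum>c\<in>Res (q * d). h c) = (\<Sum>x\<in>Res d \<times> Res q. h (case x of (b, b') \<Rightarrow> b + b' * d))"
    by (rule sum.reindex_bij_betw[symmetric])
  then show ?thesis by (simp add: sum.cartesian_product case_prod_unfold)
qed

lemma sum_Res_periodic:
  fixes h :: "'a::{field,finite} poly \<Rightarrow> int"
  assumes q: "q \<noteq> 0" and d: "d \<noteq> 0" and per: "\<And>b x. h (b + x * d) = h b"
  shows "(\<Sum>c\<in>Res (q * d). h c) = int (card (Res q)) * (\<Sum>b\<in>Res d. h b)"
  unfolding sum_Res_mult[OF q d, symmetric] by (simp add: per sum_distrib_left)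

section \<open>Hecke operators\<close>

definition hecke_mats :: "'a::{field,finite} poly \<Rightarrow> 'a poly \<Rightarrow> ('a poly^2^2) set" where
  "hecke_mats n m = {M2 a b 0 d | a b d. monic a \<and> monic d \<and> a * d = m \<and> coprime a n \<and> b \<in> Res d}"

text \<open>The Hecke sum for arbitrary functions on edges, whereas \<open>hecke\<close> is
  \<open>undefined\<close> off \<open>H0 n\<close>; so sums can be iterated without checking
  membership.\<close>

definition hecke_op :: "'a::{field,finite} poly \<Rightarrow> 'a poly \<Rightarrow> ('a edge \<Rightarrow> int) \<Rightarrow> 'a edge \<Rightarrow> int" where
  "hecke_op n m f = (\<lambda>e. \<Sum>M\<in>hecke_mats n m. f (edge_act M e))"

lemma hecke_eq_hecke_op: "f \<in> H0 n \<Longrightarrow> hecke n m f = hecke_op n m f"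
proof -
  assume f: "f \<in> H0 n"
  let ?I = "{(a, b, d). monic a \<and> monic d \<and> a * d = m \<and> coprime a n \<and> (b = 0 \<or> degree b < degree d)}"
  have im: "hecke_mats n m = (\<lambda>(a, b, d). M2 a b 0 d) ` ?I" unfolding hecke_mats_def Res_def by (auto simp: image_iff M2_inject)
  have inj: "inj_on (\<lambda>(a, b, d). M2 a b 0 d) ?I" by (auto simp: inj_on_def M2_inject)
  have "(\<Sum>M\<in>hecke_mats n m. f (edge_act M e)) = (\<Sum>(a, b, d)\<in>?I. f (edge_act (M2 a b 0 d) e))" for e
    unfolding im sum.reindex[OF inj] by (intro sum.cong) auto
  then show ?thesis unfolding hecke_def hecke_op_def M2_def[symmetric] restrict_def using f by simp
qed

lemma hecke_mats_det: "M \<in> hecke_mats n m \<Longrightarrow> det M = m"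
  by (auto simp: hecke_mats_def)

lemma finite_hecke_mats [simp]: "monic m \<Longrightarrow> finite (hecke_mats n m)"
proof -
  assume m: "monic m"
  let ?D = "{f :: 'a poly. degree f \<le> degree m}"
  have "hecke_mats n m \<subseteq> (\<lambda>(a, b, d). M2 a b 0 d) ` (?D \<times> ?D \<times> ?D)"
  proof
    fix M assume "M \<in> hecke_mats n m"
    then obtain a b d where M: "M = M2 a b 0 d" "monic a" "monic d" "a * d = m" "b \<in> Res d" by (auto simp: hecke_mats_def)
    have "degree m = degree a + degree d" using degree_mult_eq[of a d] M by simp
    then show "M \<in> (\<lambda>(a, b, d). M2 a b 0 d) ` (?D \<times> ?D \<times> ?D)"
      using M by (intro image_eqI[of _ _ "(a, b, d)"]) (auto simp: Res_def)
  qed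
  then show ?thesis by (rule finite_subset) (intro finite_imageI finite_cartesian_product finite_degree_le)
qed

lemma Gamma0_mult: "a \<in> Gamma0 n \<Longrightarrow> b \<in> Gamma0 n \<Longrightarrow> a ** b \<in> Gamma0 n"
  unfolding Gamma0_def by (auto simp: det_mul matmul2_nth)

lemma Gamma0_unip: "M2 1 x 0 1 \<in> Gamma0 n"
  by (simp add: Gamma0_def)

lemma Gamma0_inverse:
  assumes "\<gamma> \<in> Gamma0 n"
  obtains \<delta> where "\<delta> \<in> Gamma0 n" "\<gamma> ** \<delta> = mat 1" "\<delta> ** \<gamma> = mat 1"
proof -
  obtain u where u: "det \<gamma> * u = 1" using assms by (auto simp: Gamma0_def)
  define \<delta> where "\<delta> = mat u ** adj2 \<gamma>"
  have 1: "\<delta> ** \<gamma> = mat 1"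
    using u by (simp add: \<delta>_def matrix_mul_assoc[symmetric] adj2_left mat_mult2 mult.commute)
  have 2: "\<gamma> ** \<delta> = mat 1"
    using u by (simp add: \<delta>_def mat_left_comm2 adj2_right mat_mult2 mult.commute)
  have "det \<delta> * det \<gamma> = 1" using arg_cong[OF 1, of det] by (simp add: det_mul)
  then have "det \<delta> dvd 1" by (metis dvd_triv_left)
  then have "\<delta> \<in> Gamma0 n" using assms by (simp add: Gamma0_def \<delta>_def matmul2_nth mat_M2 adj2_def)
  then show ?thesis using that 1 2 by blast
qed

text \<open>Hermite normal form of \<open>M ** \<gamma>\<close>. The monic gcd \<open>a'\<close> of
  its first column divides \<open>x\<close> and is therefore prime to \<open>n\<close>; so
  \<open>n\<close>, which divides \<open>z\<close>, divides the cofactor \<open>z'\<close>. The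
  Bezout coefficients complete the cofactors to a matrix of determinant 1 in
  \<open>Gamma0 n\<close>.\<close>

lemma hecke_mats_Gamma0:
  assumes M: "M \<in> hecke_mats n m" and \<gamma>: "\<gamma> \<in> Gamma0 n" and m: "monic m"
  shows "\<exists>\<gamma>'\<in>Gamma0 n. \<exists>M'\<in>hecke_mats n m. M ** \<gamma> = \<gamma>' ** M'"
proof -
  obtain a b d where M': "M = M2 a b 0 d" "monic a" "monic d" "a * d = m" "coprime a n" "b \<in> Res d"
    using M by (auto simp: hecke_mats_def)
  obtain \<alpha> \<beta> g \<delta> where \<gamma>': "\<gamma> = M2 \<alpha> \<beta> (n * g) \<delta>"
    using \<gamma> M2_eta[of \<gamma>] by (metis (mono_tags, lifting) Gamma0_def dvdE mem_Collect_eq)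
  define u where "u = \<alpha> * \<delta> - \<beta> * (n * g)"
  have u1: "u dvd 1" using \<gamma> by (simp add: Gamma0_def \<gamma>' u_def)
  then obtain c0 where c0: "u = [:c0:]" "c0 dvd 1" unfolding is_unit_poly_iff by blast
  have c00: "c0 \<noteq> 0" using c0(2) by auto
  define x where "x = a * \<alpha> + b * (n * g)"
  define z where "z = d * (n * g)"
  define y where "y = a * \<beta> + b * \<delta>"
  define w where "w = d * \<delta>"
  have M\<gamma>: "M ** \<gamma> = M2 x y z w" by (simp add: M' \<gamma>' M2_mult x_def y_def z_def w_def)
  have det: "x * w - y * z = m * u" unfolding x_def y_def z_def w_def u_def M'(4)[symmetric] by (simp add: algebra_simps)
  have copx: "cop x n"
  proof -
    have "cop (\<alpha> * \<delta>) n" using cop_add[OF cop_unit[OF u1], of "\<beta> * g" n] by (simp add: u_def algebra_simps)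
    then have "cop \<alpha> n" by (rule cop_dvd) simp
    moreover have "cop a n" using M'(5) cop_iff by blast
    ultimately have "cop (a * \<alpha>) n" by (intro cop_mult)
    then show ?thesis using cop_add[of "a * \<alpha>" n "b * g"] by (simp add: x_def algebra_simps)
  qed
  obtain s0 t0 e where e: "e = s0 * x + t0 * z" "e dvd x" "e dvd z" using bezout_poly by blast
  have "x \<noteq> 0 \<or> z \<noteq> 0" using det m u1 by auto
  then have e0: "e \<noteq> 0" using e(2,3) by auto
  define k where "k = inverse (lead_coeff e)"
  have k0: "k \<noteq> 0" using e0 by (simp add: k_def)
  define a' where "a' = smult k e"
  have a': "monic a'" using e0 by (simp add: a'_def monic_def k_def)
  define s where "s = smult k s0"
  define t where "t = smult k t0"
  have a'st: "a' = s * x + t * z" by (simp add: a'_def s_def t_def e(1) smult_add_right)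
  obtain x' where x': "x = a' * x'" using e(2) k0 by (metis a'_def dvdE smult_dvd_iff)
  obtain z' where z': "z = a' * z'" using e(3) k0 by (metis a'_def dvdE smult_dvd_iff)
  have "a' * (s * x' + t * z') = a' * 1" using a'st x' z' by (simp add: algebra_simps)
  then have st: "s * x' + t * z' = 1" using a' by (metis monic_nz mult_left_cancel)
  have "n dvd a' * z'" using z' z_def by (metis dvd_mult dvd_triv_left)
  moreover have copa': "cop a' n" using copx x' cop_dvd by (metis dvd_triv_left)
  ultimately have nz': "n dvd z'" using cop_dvd_mult by blast
  define d'' where "d'' = x' * w - z' * y"
  define y' where "y' = s * y + t * w"
  have 1: "M2 x' (- t) z' s ** M2 a' y' 0 d'' = M2 x y z w"
  proof -
    have "x' * y' - t * d'' = (s * x' + t * z') * y" "z' * y' + s * d'' = (s * x' + t * z') * w"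
      unfolding y'_def d''_def by (simp_all add: algebra_simps)
    then show ?thesis using st by (simp add: M2_mult M2_inject x' z' mult.commute)
  qed
  have ad'': "a' * d'' = m * u" using det unfolding d''_def x' z' by (simp add: algebra_simps)
  define d' where "d' = smult (1 / c0) d''"
  have d'': "d'' = u * d'" using c0 c00 by (simp add: d'_def)
  have "u * (a' * d') = u * m" using ad'' d'' by (simp add: algebra_simps)
  moreover have "u \<noteq> 0" using c0 c00 by simp
  ultimately have ad': "a' * d' = m" using mult_left_cancel by blast
  have d'm: "monic d'" using ad' m a' monic_cancel by blast
  define b' where "b' = y' mod d'"
  define l where "l = y' div d'"
  have y'eq: "y' = b' + l * d'" by (simp add: b'_def l_def)
  \<comment> \<open>The unit \<open>u\<close> stems from the determinant of \<open>\<gamma>\<close>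
    and makes the lower entry monic; \<open>l\<close> reduces \<open>y'\<close> modulo
    \<open>d'\<close>.\<close>
  have 2: "M2 a' y' 0 d'' = M2 1 0 0 u ** M2 1 l 0 1 ** M2 a' b' 0 d'"
    by (simp add: M2_mult M2_inject y'eq d'')
  have "M2 x' (- t) z' s ** (M2 1 0 0 u ** M2 1 l 0 1) \<in> Gamma0 n"
    using st nz' u1 by (intro Gamma0_mult) (auto simp: Gamma0_def mult.commute)
  moreover have "M2 a' b' 0 d' \<in> hecke_mats n m"
    unfolding hecke_mats_def using a' d'm ad' copa' by (auto simp: cop_iff b'_def M2_inject)
  moreover have "M ** \<gamma> = M2 x' (- t) z' s ** (M2 1 0 0 u ** M2 1 l 0 1) ** M2 a' b' 0 d'"
    using 1 2 M\<gamma> by (simp add: matrix_mul_assoc)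
  ultimately show ?thesis by blast
qed

text \<open>\<open>\<gamma>\<close> is upper triangular along with both matrices; monic diagonals
  make its diagonal 1, and reduced residues leave no room for a translation.\<close>

lemma hecke_mats_unique:
  assumes "M \<in> hecke_mats n m" "M' \<in> hecke_mats n m" "\<gamma> \<in> GL2A" "M = \<gamma> ** M'"
  shows "M = M'"
proof -
  obtain a b d where M: "M = M2 a b 0 d" "monic a" "monic d" "a * d = m" "b \<in> Res d"
    using assms by (auto simp: hecke_mats_def)
  obtain a' b' d' where M': "M' = M2 a' b' 0 d'" "monic a'" "monic d'" "a' * d' = m" "b' \<in> Res d'"
    using assms by (auto simp: hecke_mats_def)
  obtain p x r s where \<gamma>: "\<gamma> = M2 p x r s" by (rule M2_cases)
  have eq: "a = p * a'" "b = p * b' + x * d'" "0 = r * a'" "d = r * b' + s * d'"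
    using assms(4) unfolding M(1) M'(1) \<gamma> M2_mult M2_inject by simp_all
  have r: "r = 0" using eq(3) M' by simp
  have "monic p" using monic_cancel[of a' p] M M' eq(1) by (simp add: mult.commute)
  moreover have "p dvd 1" using assms(3) r unfolding GL2A_def \<gamma> by (auto dest: dvd_mult_left)
  ultimately have p: "p = 1" by (rule monic_unit)
  have "monic s" using monic_cancel[of d' s] M M' eq(4) r by (simp add: mult.commute)
  moreover have "s dvd 1" using assms(3) r unfolding GL2A_def \<gamma> by (auto dest: dvd_mult_right)
  ultimately have s: "s = 1" by (rule monic_unit)
  have d: "d = d'" using eq(4) r s by simp
  have "b = b'" using M(5) M'(5) d eq(2) p by (intro Res_eqI[of b d b']) auto
  then show ?thesis using M M' eq p d by simp
qed

text \<open>\<open>M\<close> preserves polynomial vectors, so the image of a maximizer has the same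
  order for \<open>em M ** g\<close>. Only the order of the determinant falls, by
  \<open>degree (det M)\<close>.\<close>

lemma ht_mult_lower:
  assumes "det M \<noteq> 0" "det g \<noteq> 0"
  shows "ht g - int (degree (det M)) \<le> ht (em M ** g)"
proof -
  obtain x where x: "x \<noteq> 0" "nu g (ev x) = amax g" using amax_attained assms by blast
  have "ev (M *v x) \<noteq> 0" using x assms by (simp add: em_mulv del: ev_eq_0) (simp add: x)
  then have "M *v x \<noteq> 0" by simp
  moreover have "nu (em M ** g) (ev (M *v x)) = amax g" using x assms by (simp add: nu_em)
  ultimately have "amax g \<le> amax (em M ** g)" using amax_ge[of "em M ** g" "M *v x"] assms by (simp add: det_mul)
  then show ?thesis using assms by (simp add: ht_def det_mul pf_subdegree)
qed

text \<open>Right multiplication by \<open>\<gamma>\<close> permutes the representatives up to left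
  factors from \<open>Gamma0 n\<close>, which \<open>f\<close> does not see.\<close>

lemma hecke_op_H0:
  assumes f: "f \<in> H0 n" and m: "monic m" and n: "n \<noteq> 0"
  shows "hecke_op n m f \<in> H0 n"
proof (rule H0_I[OF n])
  have har: "harmonic f" and inv: "\<And>\<gamma> e. \<gamma> \<in> Gamma0 n \<Longrightarrow> e \<in> edges \<Longrightarrow> f (edge_act \<gamma> e) = f e"
    using f by (auto simp: H0_def)
  have dM: "det M \<noteq> 0" if "M \<in> hecke_mats n m" for M using hecke_mats_det[OF that] m by simp
  have off: "f e = 0" if "e \<notin> edges" for e using har that unfolding harmonic_def by blast
  show "harmonic (hecke_op n m f)"
    unfolding harmonic_def
  proof (intro conjI allI impI ballI)
    fix e :: "'a edge" assume "e \<notin> edges"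
    then have "f (edge_act M e) = 0" if "M \<in> hecke_mats n m" for M using off dM[OF that] by simp
    then show "hecke_op n m f e = 0" by (simp add: hecke_op_def)
  next
    fix v w :: "'a vertex" assume e: "(v, w) \<in> edges"
    have "f (edge_act M (v, w)) + f (edge_act M (w, v)) = 0" if "M \<in> hecke_mats n m" for M
    proof -
      have "edge_act M (v, w) \<in> edges" using dM[OF that] e by simp
      then show ?thesis using har by (auto simp: edge_act_def harmonic_def)
    qed
    then show "hecke_op n m f (v, w) + hecke_op n m f (w, v) = 0" by (simp add: hecke_op_def sum.distrib[symmetric])
  next
    fix v :: "'a vertex" assume "v \<in> vertices"
    then obtain g where g: "det g \<noteq> 0" "v = vtx g" by (elim vertices_cases)
    have "(\<Sum>i\<in>UNIV. f (edge_act M (vtx g, vtx (g ** nb i)))) = 0" if "M \<in> hecke_mats n m" for M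
      using harmonic_nb[OF har, of "em M ** g"] g dM[OF that] by (simp add: edge_act_vtx det_mul matrix_mul_assoc)
    then show "(\<Sum>w | (v, w) \<in> edges. hecke_op n m f (v, w)) = 0"
      unfolding g(2) sum_nb[OF g(1)] hecke_op_def by (subst sum.swap) simp
  qed
  show "invariant (Gamma0 n) (hecke_op n m f)"
    unfolding invariant_def
  proof (intro ballI)
    fix \<gamma> :: "'a poly^2^2" and e :: "'a edge" assume \<gamma>: "\<gamma> \<in> Gamma0 n" and e: "e \<in> edges"
    have "\<forall>M\<in>hecke_mats n m. \<exists>M'. M' \<in> hecke_mats n m \<and> (\<exists>\<gamma>'\<in>Gamma0 n. M ** \<gamma> = \<gamma>' ** M')" using hecke_mats_Gamma0[OF _ \<gamma> m] by blast
    then obtain \<sigma> where \<sigma>: "\<And>M. M \<in> hecke_mats n m \<Longrightarrow> \<sigma> M \<in> hecke_mats n m"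
      "\<And>M. M \<in> hecke_mats n m \<Longrightarrow> \<exists>\<gamma>'\<in>Gamma0 n. M ** \<gamma> = \<gamma>' ** \<sigma> M" by metis
    have "inj_on \<sigma> (hecke_mats n m)"
    proof (rule inj_onI)
      fix M M' assume M: "M \<in> hecke_mats n m" "M' \<in> hecke_mats n m" "\<sigma> M = \<sigma> M'"
      obtain \<gamma>1 where 1: "\<gamma>1 \<in> Gamma0 n" "M ** \<gamma> = \<gamma>1 ** \<sigma> M" using \<sigma>(2) M by blast
      obtain \<gamma>2 where 2: "\<gamma>2 \<in> Gamma0 n" "M' ** \<gamma> = \<gamma>2 ** \<sigma> M" using \<sigma>(2)[OF M(2)] M(3) by auto
      obtain \<delta> where \<delta>: "\<delta> \<in> Gamma0 n" "\<delta> ** \<gamma>2 = mat 1" using Gamma0_inverse 2 by blast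
      obtain \<epsilon> where \<epsilon>: "\<gamma> ** \<epsilon> = mat 1" using Gamma0_inverse \<gamma> by blast
      have "\<sigma> M = \<delta> ** (M' ** \<gamma>)" using 2 \<delta> by (simp add: matrix_mul_assoc)
      then have "M ** \<gamma> = \<gamma>1 ** \<delta> ** M' ** \<gamma>" using 1 by (simp add: matrix_mul_assoc)
      then have "M ** (\<gamma> ** \<epsilon>) = \<gamma>1 ** \<delta> ** M' ** (\<gamma> ** \<epsilon>)" by (simp add: matrix_mul_assoc)
      then have "M = \<gamma>1 ** \<delta> ** M'" by (simp add: \<epsilon>)
      then show "M = M'" using hecke_mats_unique[OF M(1,2)] 1 \<delta> by (metis GL2A_mult Gamma0_GL2A)
    qed
    then have inj: "inj_on \<sigma> (hecke_mats n m)" .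
    have im: "\<sigma> ` hecke_mats n m = hecke_mats n m" using \<sigma>(1) m inj by (intro endo_inj_surj) auto
    have "(\<Sum>M\<in>hecke_mats n m. f (edge_act M e)) = (\<Sum>M\<in>hecke_mats n m. f (edge_act (\<sigma> M) e))"
      using sum.reindex[OF inj, of "\<lambda>M. f (edge_act M e)"] unfolding im by (simp add: o_def)
    moreover have "f (edge_act M (edge_act \<gamma> e)) = f (edge_act (\<sigma> M) e)" if M: "M \<in> hecke_mats n m" for M
    proof -
      obtain \<gamma>1 where 1: "\<gamma>1 \<in> Gamma0 n" "M ** \<gamma> = \<gamma>1 ** \<sigma> M" using \<sigma>(2) M by blast
      have "edge_act M (edge_act \<gamma> e) = edge_act \<gamma>1 (edge_act (\<sigma> M) e)" by (simp add: edge_act_mult 1)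
      then show ?thesis using inv 1(1) e dM[OF \<sigma>(1)[OF M]] by simp
    qed
    ultimately show "hecke_op n m f (edge_act \<gamma> e) = hecke_op n m f e" by (simp add: hecke_op_def)
  qed
  show "hecke_op n m f (vtx g, vtx (g ** nb i)) = 0" if g: "det g \<noteq> 0" "int (degree n + degree m) < ht g" for g i
  proof -
    have "f (edge_act M (vtx g, vtx (g ** nb i))) = 0" if M: "M \<in> hecke_mats n m" for M
    proof -
      have "int (degree n) < ht (em M ** g)" using ht_mult_lower[OF dM[OF M] g(1)] hecke_mats_det[OF M] g by simp
      then show ?thesis using H0_vanish[OF f n, of "em M ** g" i] g(1) dM[OF M]
        by (simp add: edge_act_vtx det_mul matrix_mul_assoc)
    qed
    then show ?thesis by (simp add: hecke_op_def)
  qed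
qed

definition hecke_pairs :: "'a::{field,finite} poly \<Rightarrow> 'a poly \<Rightarrow> ('a poly \<times> 'a poly) set" where
  "hecke_pairs n m = {(a, d). monic a \<and> monic d \<and> a * d = m \<and> coprime a n}"

lemma finite_hecke_pairs: "monic m \<Longrightarrow> finite (hecke_pairs n m)"
proof -
  assume m: "monic m"
  let ?D = "{f :: 'a poly. degree f \<le> degree m}"
  have "hecke_pairs n m \<subseteq> ?D \<times> ?D"
  proof
    fix x assume "x \<in> hecke_pairs n m"
    then obtain a d where x: "x = (a, d)" "monic a" "monic d" "a * d = m" by (auto simp: hecke_pairs_def)
    have "degree m = degree a + degree d" using degree_mult_eq[of a d] x by simp
    then show "x \<in> ?D \<times> ?D" using x by simp
  qed
  then show ?thesis by (rule finite_subset) (intro finite_cartesian_product finite_degree_le)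
qed

lemma sum_hecke_mats:
  assumes m: "monic m"
  shows "(\<Sum>M\<in>hecke_mats n m. F M) = (\<Sum>(a, d)\<in>hecke_pairs n m. \<Sum>b\<in>Res d. F (M2 a b 0 d))"
proof -
  let ?I = "SIGMA x:hecke_pairs n m. Res (snd x)"
  let ?g = "\<lambda>(x, b). M2 (fst x) b 0 (snd x)"
  have im: "hecke_mats n m = ?g ` ?I" unfolding hecke_mats_def hecke_pairs_def by (auto simp: image_iff M2_inject)
  have inj: "inj_on ?g ?I" by (auto simp: inj_on_def M2_inject)
  have "(\<Sum>M\<in>hecke_mats n m. F M) = (\<Sum>(x, b)\<in>?I. F (M2 (fst x) b 0 (snd x)))"
    unfolding im sum.reindex[OF inj] by (intro sum.cong) auto
  also have "\<dots> = (\<Sum>x\<in>hecke_pairs n m. \<Sum>b\<in>Res (snd x). F (M2 (fst x) b 0 (snd x)))"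
    using finite_hecke_pairs[OF m] by (simp add: sum.Sigma)
  finally show ?thesis by (simp add: case_prod_unfold)
qed

lemma prime_not_unit: "prime_elem (q :: 'a::field poly) \<Longrightarrow> q \<noteq> 1"
  by auto

lemma hecke_pairs_prime:
  assumes q: "monic q" "prime_elem q" "\<not> q dvd n"
  shows "hecke_pairs n q = {(1, q), (q, 1)}"
proof -
  have "coprime q n" using prime_cop[OF q(2,3)] cop_iff by blast
  moreover have "(a, d) = (1, q) \<or> (a, d) = (q, 1)" if "monic a" "monic d" "a * d = q" for a d
  proof -
    have "a dvd 1 \<or> d dvd 1" using irreducibleD[OF prime_elem_imp_irreducible[OF q(2)]] that by metis
    then show ?thesis using monic_unit[OF that(1)] monic_unit[OF that(2)] that(3) by auto
  qed
  ultimately show ?thesis using q(1) by (auto simp: hecke_pairs_def)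
qed

lemma sum_hecke_mats_prime:
  assumes q: "monic q" "prime_elem q" "\<not> q dvd n"
  shows "(\<Sum>M\<in>hecke_mats n q. F M) = F (M2 q 0 0 1) + (\<Sum>b\<in>Res q. F (M2 1 b 0 q))"
proof -
  have "(1, q) \<noteq> (q, 1)" using prime_not_unit[OF q(2)] by auto
  then show ?thesis by (simp add: sum_hecke_mats[OF q(1)] hecke_pairs_prime[OF q] Res_1 add.commute)
qed

lemma edge_act_scale: "c \<noteq> 0 \<Longrightarrow> e \<in> edges \<Longrightarrow> edge_act (mat c ** M) e = edge_act M e"
proof -
  assume c: "c \<noteq> 0" and "e \<in> edges"
  then obtain g i where "e = (vtx g, vtx (g ** nb i))" by (elim edges_cases)
  then show ?thesis using c
    by (simp add: edge_act_vtx em_mult em_mat matrix_mul_assoc[symmetric] vtx_scale)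
qed

text \<open>The two compositions sum \<open>A a d + S a (q * d)\<close> and
  \<open>S (q * a) d + B a d\<close> over the pairs. Here \<open>A a d = S (q * a) d\<close> unless
  \<open>q\<close> divides \<open>d\<close>, and \<open>B a d = S a (q * d)\<close> unless
  \<open>q\<close> divides \<open>a\<close>. The map from \<open>(a, d)\<close> to
  \<open>(q * a, d div q)\<close> matches the exceptional pairs, and the discrepancy is
  \<open>N * S a (d div q) - S (q * a) d\<close> on both sides.\<close>

lemma hecke_op_commute_edge:
  fixes f :: "'a::{field,finite} edge \<Rightarrow> int"
  assumes f: "f \<in> H0 n" and m: "monic m" and q: "monic q" "prime_elem q" "\<not> q dvd n" and e: "e \<in> edges"
  shows "hecke_op n m (hecke_op n q f) e = hecke_op n q (hecke_op n m f) e"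
proof -
  define \<Phi> where "\<Phi> a b d = f (edge_act (M2 a b 0 d) e)" for a b d
  define S where "S a d = (\<Sum>b\<in>Res d. \<Phi> a b d)" for a d
  define N where "N = int (card (Res q))"
  have q0: "q \<noteq> 0" using q by simp
  have per: "\<Phi> a (b + x * d) d = \<Phi> a b d" if "a \<noteq> 0" "d \<noteq> 0" for a b d x
  proof -
    have "M2 a (b + x * d) 0 d = M2 1 x 0 1 ** M2 a b 0 d" by (simp add: M2_mult)
    moreover have "edge_act (M2 a b 0 d) e \<in> edges" using that e by simp
    ultimately show ?thesis using f Gamma0_unip[of x n] unfolding \<Phi>_def H0_def
      by (simp add: edge_act_mult[symmetric])
  qed
  have sc: "\<Phi> (c * a) (c * b) (c * d) = \<Phi> a b d" if "c \<noteq> 0" for a b c d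
  proof -
    have "M2 (c * a) (c * b) 0 (c * d) = mat c ** M2 a b 0 d" by (simp add: M2_mult mat_M2)
    then show ?thesis using edge_act_scale[OF that e] by (simp add: \<Phi>_def)
  qed
  define A where "A a d = (\<Sum>b\<in>Res d. \<Phi> (q * a) (q * b) d)" for a d
  define B where "B a d = (\<Sum>b\<in>Res d. \<Sum>b'\<in>Res q. \<Phi> a (a * b' + b * q) (d * q))" for a d
  have A1: "A a (q * d) = N * S a d" if "a \<noteq> 0" "d \<noteq> 0" for a d
    unfolding A_def S_def N_def using that by (simp add: sc q0 sum_Res_periodic per)
  have A2: "A a d = S (q * a) d" if "a \<noteq> 0" "d \<noteq> 0" "\<not> q dvd d" for a d
    unfolding A_def S_def
  proof (rule sum_Res_perm[where p = "\<lambda>b. q * b" and h = "\<lambda>b. \<Phi> (q * a) b d"])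
    fix b c assume "b \<in> Res d" "c \<in> Res d" "d dvd q * b - q * c"
    then show "b = c" using cop_dvd_mult[OF prime_cop[OF q(2) that(3)], of "b - c"] Res_eqI
      by (simp add: right_diff_distrib)
  qed (use that per q0 in auto)
  have B1: "B (q * a) d = N * S a d" if "a \<noteq> 0" "d \<noteq> 0" for a d
  proof -
    have "(\<Sum>b\<in>Res d. \<Phi> a (a * b' + b) d) = S a d" for b'
      unfolding S_def
      by (rule sum_Res_perm[where p = "\<lambda>b. a * b' + b" and h = "\<lambda>b. \<Phi> a b d"])
         (use that per in \<open>auto intro: Res_eqI\<close>)
    moreover have "\<Phi> (q * a) (q * a * b' + b * q) (d * q) = \<Phi> a (a * b' + b) d" for b b'
      using sc[OF q0, of a "a * b' + b" d] by (simp add: algebra_simps)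
    ultimately show ?thesis unfolding B_def N_def by (subst sum.swap) simp
  qed
  have B2: "B a d = S a (q * d)" if "a \<noteq> 0" "d \<noteq> 0" "\<not> q dvd a" for a d
  proof -
    have qd: "d * q \<noteq> 0" using that q0 by simp
    \<comment> \<open>The entry \<open>a * b' + b * q\<close> as a function of the single residue
      \<open>c = b' + b * q\<close> modulo \<open>d * q\<close>.\<close>
    define p where "p c = a * (c mod q) + (c div q) * q" for c
    have "B a d = (\<Sum>b'\<in>Res q. \<Sum>b\<in>Res d. \<Phi> a (a * b' + b * q) (d * q))"
      unfolding B_def by (rule sum.swap)
    also have "\<dots> = (\<Sum>b'\<in>Res q. \<Sum>b\<in>Res d. \<Phi> a (p (b' + b * q)) (d * q))"
    proof (intro sum.cong refl)
      fix b b' assume "b' \<in> Res q"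
      then have "(b' + b * q) mod q = b'" "(b' + b * q) div q = b"
        using q0 by (simp_all add: Res_mod mod_mult_self1) (auto simp: Res_def div_poly_less)
      then show "\<Phi> a (a * b' + b * q) (d * q) = \<Phi> a (p (b' + b * q)) (d * q)" by (simp add: p_def)
    qed
    also have "\<dots> = (\<Sum>c\<in>Res (d * q). \<Phi> a (p c) (d * q))"
      using sum_Res_mult[of d q "\<lambda>c. \<Phi> a (p c) (d * q)"] that q0 by simp
    also have "\<dots> = (\<Sum>c\<in>Res (d * q). \<Phi> a c (d * q))"
    proof (rule sum_Res_perm)
      fix b c assume bc: "b \<in> Res (d * q)" "c \<in> Res (d * q)" "d * q dvd p b - p c"
      have "q dvd p b - p c" using bc(3) by (rule dvd_mult_right)
      then have "q dvd a * (b mod q - c mod q) + (b div q - c div q) * q" by (simp add: p_def algebra_simps)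
      then have "q dvd a * (b mod q - c mod q)" by (simp add: dvd_add_left_iff)
      then have "q dvd b mod q - c mod q" using cop_dvd_mult[OF cop_sym[OF prime_cop[OF q(2) that(3)]]] by blast
      then have md: "b mod q = c mod q" using q0 Res_eqI mod_Res by blast
      then have "p b - p c = (b div q - c div q) * q" by (simp add: p_def algebra_simps)
      then have "p b - p c = b - c" using md
        by (metis add_diff_cancel_right div_mult_mod_eq left_diff_distrib)
      then show "b = c" using bc Res_eqI by metis
    qed (use qd that per in auto)
    finally show ?thesis by (simp add: S_def mult.commute)
  qed
  have "hecke_op n m (hecke_op n q f) e = (\<Sum>(a, d)\<in>hecke_pairs n m. \<Sum>b\<in>Res d. \<Phi> (q * a) (q * b) d + (\<Sum>b'\<in>Res q. \<Phi> a (b + b' * d) (q * d)))"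
    by (simp add: hecke_op_def sum_hecke_mats[OF m] sum_hecke_mats_prime[OF q] edge_act_mult M2_mult \<Phi>_def)
  also have "\<dots> = (\<Sum>(a, d)\<in>hecke_pairs n m. A a d + S a (q * d))"
  proof (rule sum.cong[OF refl])
    fix x assume "x \<in> hecke_pairs n m"
    then obtain a d where x: "x = (a, d)" "d \<noteq> 0" by (auto simp: hecke_pairs_def)
    show "(case x of (a, d) \<Rightarrow> \<Sum>b\<in>Res d. \<Phi> (q * a) (q * b) d + (\<Sum>b'\<in>Res q. \<Phi> a (b + b' * d) (q * d))) =
        (case x of (a, d) \<Rightarrow> A a d + S a (q * d))"
      using sum_Res_mult[OF q0 x(2), of "\<lambda>c. \<Phi> a c (q * d)"] by (simp add: x(1) A_def S_def sum.distrib)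
  qed
  finally have X1: "hecke_op n m (hecke_op n q f) e = (\<Sum>(a, d)\<in>hecke_pairs n m. A a d) + (\<Sum>(a, d)\<in>hecke_pairs n m. S a (q * d))"
    by (simp add: case_prod_unfold sum.distrib)
  have "hecke_op n q (hecke_op n m f) e = (\<Sum>(a, d)\<in>hecke_pairs n m. \<Sum>b\<in>Res d. \<Phi> (a * q) b d)
      + (\<Sum>b'\<in>Res q. \<Sum>(a, d)\<in>hecke_pairs n m. \<Sum>b\<in>Res d. \<Phi> a (a * b' + b * q) (d * q))"
    by (simp add: hecke_op_def sum_hecke_mats[OF m] sum_hecke_mats_prime[OF q] edge_act_mult M2_mult \<Phi>_def)
  also have "(\<Sum>b'\<in>Res q. \<Sum>(a, d)\<in>hecke_pairs n m. \<Sum>b\<in>Res d. \<Phi> a (a * b' + b * q) (d * q)) = (\<Sum>(a, d)\<in>hecke_pairs n m. B a d)"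
    unfolding B_def case_prod_unfold
    by (rule trans[OF sum.swap]) (rule sum.cong[OF refl], rule sum.swap)
  finally have X2: "hecke_op n q (hecke_op n m f) e = (\<Sum>(a, d)\<in>hecke_pairs n m. S (q * a) d) + (\<Sum>(a, d)\<in>hecke_pairs n m. B a d)"
    by (simp add: S_def mult.commute)
  let ?D1 = "{x \<in> hecke_pairs n m. q dvd snd x}"
  let ?D2 = "{x \<in> hecke_pairs n m. q dvd fst x}"
  have nz: "fst x \<noteq> 0 \<and> snd x \<noteq> 0" if "x \<in> hecke_pairs n m" for x using that by (auto simp: hecke_pairs_def)
  have fin: "finite (hecke_pairs n m)" by (rule finite_hecke_pairs[OF m])
  have L: "(\<Sum>(a, d)\<in>hecke_pairs n m. A a d) - (\<Sum>(a, d)\<in>hecke_pairs n m. S (q * a) d) = (\<Sum>x\<in>?D1. A (fst x) (snd x) - S (q * fst x) (snd x))"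
    unfolding case_prod_unfold sum_subtractf[symmetric]
    by (rule sum.mono_neutral_right) (use fin nz A2 in auto)
  have R: "(\<Sum>(a, d)\<in>hecke_pairs n m. B a d) - (\<Sum>(a, d)\<in>hecke_pairs n m. S a (q * d)) = (\<Sum>x\<in>?D2. B (fst x) (snd x) - S (fst x) (q * snd x))"
    unfolding case_prod_unfold sum_subtractf[symmetric]
    by (rule sum.mono_neutral_right) (use fin nz B2 in auto)
  have cq: "coprime q n" using prime_cop[OF q(2,3)] cop_iff by blast
  have cm: "coprime (q * a) n \<longleftrightarrow> coprime a n" for a
    using cop_mult[of q n a] cq cop_dvd[of "q * a" n a] by (auto simp: cop_iff)
  have "bij_betw (\<lambda>x. (q * fst x, snd x div q)) ?D1 ?D2"
  proof (rule bij_betw_byWitness[where f' = "\<lambda>x. (fst x div q, q * snd x)"])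
    show "\<forall>x\<in>?D1. (fst (q * fst x, snd x div q) div q, q * snd (q * fst x, snd x div q)) = x"
      using q0 by auto
    show "\<forall>x\<in>?D2. (q * fst (fst x div q, q * snd x), snd (fst x div q, q * snd x) div q) = x"
      using q0 by auto
    show "(\<lambda>x. (q * fst x, snd x div q)) ` ?D1 \<subseteq> ?D2"
    proof (rule image_subsetI)
      fix x assume "x \<in> ?D1"
      then obtain a d where x: "x = (a, q * d)" "(a, q * d) \<in> hecke_pairs n m" by (cases x) (auto elim!: dvdE)
      then show "(q * fst x, snd x div q) \<in> ?D2"
        using q0 q(1) cm monic_cancel[of q d] by (simp add: hecke_pairs_def monic_mult mult.assoc mult.left_commute)
    qed
    show "(\<lambda>x. (fst x div q, q * snd x)) ` ?D2 \<subseteq> ?D1"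
    proof (rule image_subsetI)
      fix x assume "x \<in> ?D2"
      then obtain a d where x: "x = (q * a, d)" "(q * a, d) \<in> hecke_pairs n m" by (cases x) (auto elim!: dvdE)
      then show "(fst x div q, q * snd x) \<in> ?D1"
        using q0 q(1) cm monic_cancel[of q a] by (simp add: hecke_pairs_def monic_mult mult.assoc mult.left_commute)
    qed
  qed
  from sum.reindex_bij_betw[OF this, of "\<lambda>x. B (fst x) (snd x) - S (fst x) (q * snd x)"]
  have "(\<Sum>x\<in>?D2. B (fst x) (snd x) - S (fst x) (q * snd x)) =
      (\<Sum>x\<in>?D1. B (q * fst x) (snd x div q) - S (q * fst x) (q * (snd x div q)))"
    unfolding fst_conv snd_conv by (rule sym)
  also have "\<dots> = (\<Sum>x\<in>?D1. A (fst x) (snd x) - S (q * fst x) (snd x))"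
  proof (rule sum.cong[OF refl])
    fix x assume x: "x \<in> ?D1"
    then obtain d where d: "snd x = q * d" by (auto elim!: dvdE)
    have "fst x \<noteq> 0 \<and> snd x \<noteq> 0" using nz x by blast
    then have "fst x \<noteq> 0" "d \<noteq> 0" using d by auto
    then show "B (q * fst x) (snd x div q) - S (q * fst x) (q * (snd x div q)) = A (fst x) (snd x) - S (q * fst x) (snd x)"
      unfolding d using q0 by (simp add: A1 B1)
  qed
  finally show ?thesis using X1 X2 L R by linarith
qed

lemma H0_off: "f \<in> H0 n \<Longrightarrow> e \<notin> edges \<Longrightarrow> f e = 0"
  unfolding H0_def harmonic_def by blast

lemma hecke_op_commute:
  assumes "f \<in> H0 n" "n \<noteq> 0" "monic m" "monic q" "prime_elem q" "\<not> q dvd n"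
  shows "hecke_op n m (hecke_op n q f) = hecke_op n q (hecke_op n m f)"
proof
  fix e
  show "hecke_op n m (hecke_op n q f) e = hecke_op n q (hecke_op n m f) e"
  proof (cases "e \<in> edges")
    case False
    then show ?thesis using assms hecke_op_H0 H0_off by metis
  qed (use assms hecke_op_commute_edge in blast)
qed

lemma ideal_norm_Res: "q \<noteq> 0 \<Longrightarrow> ideal_norm q = card (Res q)"
proof -
  assume q: "q \<noteq> 0"
  let ?r = "{(x, y). q dvd x - y}"
  have "UNIV // ?r = (\<lambda>b. ?r `` {b}) ` Res q"
  proof
    show "UNIV // ?r \<subseteq> (\<lambda>b. ?r `` {b}) ` Res q"
    proof
      fix X assume "X \<in> UNIV // ?r"
      then obtain x where x: "X = ?r `` {x}" by (auto elim: quotientE)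
      have "q dvd x - y \<longleftrightarrow> q dvd x mod q - y" for y by (metis mod_eq_dvd_iff mod_mod_trivial)
      then have "X = ?r `` {x mod q}" unfolding x by auto
      then show "X \<in> (\<lambda>b. ?r `` {b}) ` Res q" using q by auto
    qed
  qed (auto simp: quotient_def)
  moreover have "inj_on (\<lambda>b. ?r `` {b}) (Res q)"
  proof (rule inj_onI)
    fix b c assume bc: "b \<in> Res q" "c \<in> Res q" "?r `` {b} = ?r `` {c}"
    have "c \<in> ?r `` {c}" by simp
    then have "c \<in> ?r `` {b}" using bc(3) by simp
    then show "b = c" using bc Res_eqI by auto
  qed
  ultimately show ?thesis unfolding ideal_norm_def by (simp add: card_image)
qed

section \<open>Finiteness of the quotient and a criterion for divisibility\<close>

section \<open>The maximum principle\<close>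

lemma nu_scalar: "c \<noteq> 0 \<Longrightarrow> x \<noteq> 0 \<Longrightarrow> det g \<noteq> 0 \<Longrightarrow> nu g (c *s x) = nu g x + fls_subdegree c"
  by (simp add: nu_def mulv_scale2 ord2_scale)

text \<open>The order of \<open>V2 1 0\<close> rises by \<open>j * degree q\<close> and the order of
  the determinant falls by the same amount, but the height counts the former twice.\<close>

lemma ht_diag_unbounded:
  assumes g: "det g \<noteq> 0" and q: "degree q > 0"
  shows "\<exists>j. B < ht (em (M2 (q ^ j) 0 0 1) ** g)"
proof -
  have q0: "q \<noteq> 0" using q by auto
  define c where "c = nu g (ev (V2 1 0))"
  have e1: "V2 1 0 \<noteq> (0 :: 'a poly^2)" by (simp add: vec2_eq_iff)
  have "2 * c + fls_subdegree (det g) + int (j * degree q) \<le> ht (em (M2 (q ^ j) 0 0 1) ** g)" for j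
  proof -
    let ?D = "M2 (q ^ j) 0 0 1"
    let ?t = "poly_to_fls (q ^ j)"
    have D: "det (em ?D) \<noteq> 0" using q0 by simp
    have t: "?t \<noteq> 0" "fls_subdegree ?t = - int (j * degree q)"
      using q0 by (simp_all add: pf_subdegree degree_power_eq)
    have "?D *v V2 1 0 = q ^ j *s V2 1 0" by (simp add: vec2_eq_iff matvec2_nth)
    then have "nu (em ?D ** g) (ev (q ^ j *s V2 1 0)) = c" unfolding c_def by (metis nu_em[OF D g])
    then have "nu (em ?D ** g) (ev (V2 1 0)) = c + int (j * degree q)"
      using t D g e1 by (simp add: ev_smult nu_scalar det_mul)
    then have "c + int (j * degree q) \<le> amax (em ?D ** g)"
      using amax_ge[OF _ e1, of "em ?D ** g"] D g by (simp add: det_mul)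
    moreover have "fls_subdegree (det (em ?D ** g)) = - int (j * degree q) + fls_subdegree (det g)"
      using t g by (simp add: det_mul)
    ultimately show ?thesis by (simp add: ht_def)
  qed
  moreover have "B < 2 * c + fls_subdegree (det g) + int (nat (B + 1 - (2 * c + fls_subdegree (det g))) * degree q)"
  proof -
    let ?k = "nat (B + 1 - (2 * c + fls_subdegree (det g)))"
    have "?k * 1 \<le> ?k * degree q" using q by (intro mult_le_mono2) simp
    then have "int ?k \<le> int (?k * degree q)" by (simp only: of_nat_le_iff mult_1_right)
    then show ?thesis by linarith
  qed
  ultimately show ?thesis by (meson less_le_trans)
qed

lemma H0_finite_range:
  fixes f :: "'a::{field,finite} edge \<Rightarrow> int"
  assumes f: "f \<in> H0 n" and n: "n \<noteq> 0"
  shows "finite (range f)"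
proof -
  obtain S where S: "finite S" "S \<subseteq> edges"
    "\<And>g i. det g \<noteq> 0 \<Longrightarrow> ht g \<le> int (degree n) \<Longrightarrow> \<exists>\<gamma>\<in>Gamma0 n. \<exists>s\<in>S. (vtx g, vtx (g ** nb i)) = edge_act \<gamma> s"
    using finite_edges_mod[OF n] by metis
  have "f e \<in> insert 0 (f ` S)" for e
  proof (cases "e \<in> edges")
    case True
    then obtain g i where g: "det g \<noteq> 0" "e = (vtx g, vtx (g ** nb i))" by (rule edges_cases)
    show ?thesis
    proof (cases "int (degree n) < ht g")
      case True
      then show ?thesis using H0_vanish[OF f n g(1)] g by simp
    next
      case False
      then obtain \<gamma> s where \<gamma>: "\<gamma> \<in> Gamma0 n" "s \<in> S" "e = edge_act \<gamma> s" using S(3)[OF g(1)] g(2) by fastforce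
      then have "s \<in> edges" using S(2) by blast
      then have "f e = f s" using f \<gamma> by (simp add: H0_def)
      then show ?thesis using \<gamma> by simp
    qed
  qed (use H0_off[OF f] in simp)
  then show ?thesis by (meson S(1) finite.insertI finite_imageI finite_subset image_subsetI)
qed

text \<open>At an edge where \<open>\<bar>f\<bar>\<close> is maximal, all \<open>|q| + 1\<close> terms of the Hecke sum agree with the maximum.\<close>

lemma no_eisenstein:
  fixes f :: "'a::{field,finite} edge \<Rightarrow> int"
  assumes f: "f \<in> H0 n" and n: "n \<noteq> 0" and q: "monic q" "prime_elem q" "\<not> q dvd n"
    and eig: "\<And>e. hecke_op n q f e = (int (card (Res q)) + 1) * f e"
  shows "f = (\<lambda>e. 0)"
proof (rule ccontr)
  assume "f \<noteq> (\<lambda>e. 0)"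
  then obtain e1 where e1: "f e1 \<noteq> 0" unfolding fun_eq_iff by blast
  have fin: "finite (range (\<lambda>e. \<bar>f e\<bar>))" using H0_finite_range[OF f n]
    by (metis finite_imageI image_image)
  define c where "c = Max (range (\<lambda>e. \<bar>f e\<bar>))"
  have le: "\<bar>f e\<bar> \<le> c" for e unfolding c_def using fin by simp
  obtain e0 where e0: "\<bar>f e0\<bar> = c" using Max_in[OF fin] unfolding c_def by fastforce
  have c0: "c > 0" using le[of e1] e1 by linarith
  define s where "s = sgn (f e0)"
  have s: "s * f e0 = c" "s = 1 \<or> s = -1" using e0 c0 by (auto simp: s_def sgn_if)
  have sle: "s * f e \<le> c" for e using s(2) le[of e] by auto
  have step: "s * f (edge_act (M2 q 0 0 1) e) = c" if "s * f e = c" for e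
  proof -
    have "(int (card (Res q)) + 1) * (s * f e) = s * hecke_op n q f e" using eig[of e] by simp
    also have "\<dots> = s * f (edge_act (M2 q 0 0 1) e) + (\<Sum>b\<in>Res q. s * f (edge_act (M2 1 b 0 q) e))"
      by (simp add: hecke_op_def sum_hecke_mats_prime[OF q] distrib_left sum_distrib_left)
    finally have "(int (card (Res q)) + 1) * c = s * f (edge_act (M2 q 0 0 1) e) + (\<Sum>b\<in>Res q. s * f (edge_act (M2 1 b 0 q) e))"
      using that by simp
    moreover have "(\<Sum>b\<in>Res q. s * f (edge_act (M2 1 b 0 q) e)) \<le> int (card (Res q)) * c"
      using sum_bounded_above[of "Res q" "\<lambda>b. s * f (edge_act (M2 1 b 0 q) e)" c] sle by simp
    ultimately show ?thesis using sle[of "edge_act (M2 q 0 0 1) e"] by (simp add: distrib_right)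
  qed
  have it: "s * f (edge_act (M2 (q ^ j) 0 0 1) e0) = c" for j
  proof (induction j)
    case 0
    have "M2 1 0 0 1 = (mat 1 :: 'a poly^2^2)" by (simp add: mat_M2)
    then show ?case using s by (simp add: edge_act_def vertex_act_eq em_mat)
  next
    case (Suc j)
    have "M2 (q ^ Suc j) 0 0 1 = M2 q 0 0 1 ** M2 (q ^ j) 0 0 1" by (simp add: M2_mult)
    then show ?case using step[OF Suc] by (simp add: edge_act_mult)
  qed
  have "f e0 \<noteq> 0" using s c0 by auto
  then have "e0 \<in> edges" using H0_off[OF f] by blast
  then obtain g i where g: "det g \<noteq> 0" "e0 = (vtx g, vtx (g ** nb i))" by (rule edges_cases)
  have "degree q > 0" using q(2) by (rule prime_degree_pos)
  then obtain j where "int (degree n) < ht (em (M2 (q ^ j) 0 0 1) ** g)" using ht_diag_unbounded[OF g(1)] by blast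
  moreover have "det (em (M2 (q ^ j) 0 0 1) ** g) \<noteq> 0" using g q by (simp add: det_mul)
  ultimately have "f (edge_act (M2 (q ^ j) 0 0 1) e0) = 0"
    using H0_vanish[OF f n, of "em (M2 (q ^ j) 0 0 1) ** g" i] unfolding g(2) edge_act_vtx
    by (simp add: matrix_mul_assoc)
  then show False using it[of j] c0 by simp
qed

section \<open>Subgroups of free abelian groups\<close>

lemma int_subgroup_principal:
  fixes I :: "int set"
  assumes z: "0 \<in> I" and c: "\<And>u v a b. u \<in> I \<Longrightarrow> v \<in> I \<Longrightarrow> a * u + b * v \<in> I"
  shows "\<exists>d\<in>I. \<forall>u\<in>I. d dvd u"
proof (cases "\<exists>u\<in>I. u \<noteq> 0")
  case True
  then obtain u where u: "u \<in> I" "u \<noteq> 0" by blast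
  have "\<bar>u\<bar> \<in> I" using c[OF u(1) z, of "sgn u" 0] by (simp add: abs_sgn mult.commute)
  then have ex: "\<exists>k. 0 < k \<and> int k \<in> I" using u by (intro exI[of _ "nat \<bar>u\<bar>"]) simp
  define k where "k = (LEAST k. 0 < k \<and> int k \<in> I)"
  have k: "0 < k" "int k \<in> I" using LeastI_ex[OF ex] by (simp_all add: k_def)
  have le: "k \<le> m" if "0 < m" "int m \<in> I" for m
    unfolding k_def using that by (intro Least_le) simp
  have "int k dvd v" if v: "v \<in> I" for v
  proof (rule ccontr)
    assume "\<not> int k dvd v"
    then have "v mod int k \<noteq> 0" using mod_0_imp_dvd by blast
    moreover have "v mod int k \<ge> 0" using k(1) by simp
    ultimately have pos: "v mod int k > 0" by linarith
    have "v mod int k = 1 * v + (- (v div int k)) * int k"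
      using div_mult_mod_eq[of v "int k"] by (simp add: algebra_simps)
    then have "v mod int k \<in> I" using c[OF v k(2)] by metis
    then have "k \<le> nat (v mod int k)" using pos le[of "nat (v mod int k)"] by simp
    moreover have "v mod int k < int k" using k(1) by simp
    ultimately show False using pos by linarith
  qed
  then show ?thesis using k by blast
qed (use z in auto)

text \<open>Subgroups of a free abelian group of finite rank are finitely generated. The values at
  \<open>y\<close> are the multiples of one value \<open>g1 y\<close>, and subtracting a multiple of
  \<open>g1\<close> leaves a function vanishing at \<open>y\<close>.\<close>

lemma int_functions_fg:
  fixes G :: "('x \<Rightarrow> int) set"
  assumes "finite X" and "(\<lambda>x. 0) \<in> G"
    and "\<And>g h a b. g \<in> G \<Longrightarrow> h \<in> G \<Longrightarrow> (\<lambda>x. a * g x + b * h x) \<in> G"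
  shows "\<exists>B\<subseteq>G. finite B \<and> (\<forall>g\<in>G. \<exists>c. \<forall>x\<in>X. g x = (\<Sum>b\<in>B. c b * b x))"
  using assms
proof (induction X arbitrary: G rule: finite_induct)
  case empty
  then show ?case by (intro exI[of _ "{}"]) auto
next
  case (insert y X)
  define G0 where "G0 = {g \<in> G. g y = 0}"
  have "\<exists>B\<subseteq>G0. finite B \<and> (\<forall>g\<in>G0. \<exists>c. \<forall>x\<in>X. g x = (\<Sum>b\<in>B. c b * b x))"
    by (rule insert.IH) (use insert.prems in \<open>auto simp: G0_def\<close>)
  then obtain B where B: "B \<subseteq> G0" "finite B" "\<And>g. g \<in> G0 \<Longrightarrow> \<exists>c. \<forall>x\<in>X. g x = (\<Sum>b\<in>B. c b * b x)" by blast
  have "\<exists>d\<in>(\<lambda>g. g y) ` G. \<forall>u\<in>(\<lambda>g. g y) ` G. d dvd u"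
  proof (rule int_subgroup_principal)
    show "0 \<in> (\<lambda>g. g y) ` G" using insert.prems(1) by (rule rev_image_eqI) simp
    show "a * u + b * v \<in> (\<lambda>g. g y) ` G" if "u \<in> (\<lambda>g. g y) ` G" "v \<in> (\<lambda>g. g y) ` G" for u v a b
      using that insert.prems(2) by (auto simp: image_iff)
  qed
  then obtain g1 where g1: "g1 \<in> G" "\<And>g. g \<in> G \<Longrightarrow> g1 y dvd g y" by auto
  show ?case
  proof (cases "g1 y = 0")
    case True
    then have "G0 = G" using g1 by (auto simp: G0_def)
    have "\<exists>c. \<forall>x\<in>insert y X. g x = (\<Sum>b\<in>B. c b * b x)" if g: "g \<in> G" for g
    proof -
      obtain c where "\<forall>x\<in>X. g x = (\<Sum>b\<in>B. c b * b x)" using B(3) g \<open>G0 = G\<close> by blast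
      moreover have "g y = (\<Sum>b\<in>B. c b * b y)"
        using B(1) g \<open>G0 = G\<close> by (subst sum.neutral) (auto simp: G0_def)
      ultimately show ?thesis by blast
    qed
    then show ?thesis using B by (auto simp: G0_def)
  next
    case False
    have "\<exists>c. \<forall>x\<in>insert y X. g x = (\<Sum>b\<in>insert g1 B. c b * b x)" if g: "g \<in> G" for g
    proof -
      obtain k where k: "g y = g1 y * k" using g1(2)[OF g] by blast
      define g' where "g' = (\<lambda>x. 1 * g x + (- k) * g1 x)"
      have "g' \<in> G" unfolding g'_def using insert.prems(2)[OF g g1(1)] .
      then have "g' \<in> G0" by (simp add: G0_def g'_def k)
      then obtain c where c: "\<forall>x\<in>X. g' x = (\<Sum>b\<in>B. c b * b x)" using B(3) by blast
      have n: "g1 \<notin> B" using B(1) False by (auto simp: G0_def)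
      define c' where "c' = c(g1 := k)"
      have e: "(\<Sum>b\<in>insert g1 B. c' b * b x) = k * g1 x + (\<Sum>b\<in>B. c b * b x)" for x
      proof -
        have "(\<Sum>b\<in>B. c' b * b x) = (\<Sum>b\<in>B. c b * b x)"
          by (rule sum.cong) (use n in \<open>auto simp: c'_def\<close>)
        then show ?thesis using n B(2) by (simp add: c'_def)
      qed
      have "(\<Sum>b\<in>B. c b * b y) = 0" using B(1) by (intro sum.neutral) (auto simp: G0_def)
      then have "\<forall>x\<in>insert y X. g x = (\<Sum>b\<in>insert g1 B. c' b * b x)"
        unfolding e using c k by (auto simp: g'_def mult.commute)
      then show ?thesis by blast
    qed
    then show ?thesis using B g1(1) by (intro exI[of _ "insert g1 B"]) (auto simp: G0_def)
  qed
qed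

section \<open>Quotients of rings\<close>

lemma zero_Quot: "\<zero>\<^bsub>A Quot I\<^esub> = I"
  by (simp add: FactRing_def)

lemma carrier_Quot: "carrier (A Quot I) = (\<lambda>t. I +>\<^bsub>A\<^esub> t) ` carrier A"
  by (auto simp: FactRing_def A_RCOSETS_def')

text \<open>Lagrange in the additive group of the quotient. For an infinite quotient
  \<open>card\<close> is \<open>0\<close> and the claim reads that \<open>I\<close> contains
  zero.\<close>

lemma card_quot_in_ideal:
  assumes I: "ideal I A" and x: "x \<in> carrier A"
  shows "add_pow A (card (carrier (A Quot I))) x \<in> I"
proof -
  interpret ideal I A by (rule I)
  let ?Q = "A Quot I"
  interpret Q: ring ?Q by (rule quotient_is_ring)
  interpret h: ring_hom_ring A ?Q "(+>\<^bsub>A\<^esub>) I" by (rule rcos_ring_hom_ring)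
  have pw: "add_pow A k x \<in> carrier A \<and> I +>\<^bsub>A\<^esub> (add_pow A k x) = add_pow ?Q k (I +>\<^bsub>A\<^esub> x)" for k :: nat
  proof (induction k)
    case 0
    show ?case using h.hom_zero by (simp add: add_pow_def nat_pow_def)
  next
    case (Suc k)
    have s: "add_pow A (Suc k) x = add_pow A k x \<oplus>\<^bsub>A\<^esub> x" by (simp add: add_pow_def nat_pow_def)
    have s': "add_pow ?Q (Suc k) (I +>\<^bsub>A\<^esub> x) = add_pow ?Q k (I +>\<^bsub>A\<^esub> x) \<oplus>\<^bsub>?Q\<^esub> (I +>\<^bsub>A\<^esub> x)"
      by (simp add: add_pow_def nat_pow_def)
    show ?case unfolding s s' using Suc x h.hom_add by simp
  qed
  have "I +>\<^bsub>A\<^esub> x \<in> carrier ?Q" using x by simp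
  then have "add_pow ?Q (order (add_monoid ?Q)) (I +>\<^bsub>A\<^esub> x) = \<zero>\<^bsub>?Q\<^esub>"
    using group.pow_order_eq_1[OF Q.a_group, of "I +>\<^bsub>A\<^esub> x"] by (simp add: add_pow_def)
  moreover have "order (add_monoid ?Q) = card (carrier ?Q)" by (simp add: order_def)
  moreover have "\<zero>\<^bsub>?Q\<^esub> = I" by (rule zero_Quot)
  ultimately have "I +>\<^bsub>A\<^esub> (add_pow A (card (carrier ?Q)) x) = I"
    using pw[of "card (carrier ?Q)"] by (simp only:)
  moreover have "add_pow A (card (carrier ?Q)) x \<in> I +>\<^bsub>A\<^esub> (add_pow A (card (carrier ?Q)) x)"
    using pw by (intro a_rcos_self) blast
  ultimately show ?thesis by (simp only:)
qed

lemma finite_quot: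
  assumes I: "ideal I A" and Z: "finite Z" "Z \<subseteq> carrier A"
    and c: "\<And>t. t \<in> carrier A \<Longrightarrow> \<exists>z\<in>Z. t \<ominus>\<^bsub>A\<^esub> z \<in> I"
  shows "finite (carrier (A Quot I))"
proof -
  interpret ideal I A by (rule I)
  have "carrier (A Quot I) \<subseteq> (\<lambda>z. I +>\<^bsub>A\<^esub> z) ` Z"
  proof
    fix y assume "y \<in> carrier (A Quot I)"
    then obtain t where t: "t \<in> carrier A" "y = I +>\<^bsub>A\<^esub> t"
      unfolding carrier_Quot by blast
    obtain z where z: "z \<in> Z" "t \<ominus>\<^bsub>A\<^esub> z \<in> I" using c t by blast
    then show "y \<in> (\<lambda>z. I +>\<^bsub>A\<^esub> z) ` Z" using quotient_eq_iff_same_a_r_cos[OF I t(1), of z] t Z by auto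
  qed
  then show ?thesis using Z finite_subset by blast
qed

section \<open>The ring of endomorphisms\<close>

lemma H0_iff:
  assumes n: "n \<noteq> 0"
  shows "f \<in> H0 n \<longleftrightarrow> harmonic f \<and> invariant (Gamma0 n) f \<and>
    (\<forall>g i. det g \<noteq> 0 \<longrightarrow> int (degree n) < ht g \<longrightarrow> f (vtx g, vtx (g ** nb i)) = 0)"
proof
  assume f: "f \<in> H0 n"
  then have "harmonic f \<and> invariant (Gamma0 n) f" unfolding H0_def invariant_def by blast
  then show "harmonic f \<and> invariant (Gamma0 n) f \<and>
    (\<forall>g i. det g \<noteq> 0 \<longrightarrow> int (degree n) < ht g \<longrightarrow> f (vtx g, vtx (g ** nb i)) = 0)"
    using H0_vanish[OF f n] by blast
next
  assume "harmonic f \<and> invariant (Gamma0 n) f \<and>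
    (\<forall>g i. det g \<noteq> 0 \<longrightarrow> int (degree n) < ht g \<longrightarrow> f (vtx g, vtx (g ** nb i)) = 0)"
  then show "f \<in> H0 n" using H0_I[OF n, of f "degree n"] by blast
qed

lemma H0_harmonic: "f \<in> H0 n \<Longrightarrow> harmonic f"
  unfolding H0_def by blast

lemma harmonic_comb:
  assumes "harmonic f" "harmonic g"
  shows "harmonic (\<lambda>e. a * f e + b * g e)"
  unfolding harmonic_def
proof (intro conjI allI impI ballI)
  fix e :: "'a edge" assume "e \<notin> edges"
  then have "f e = 0" "g e = 0" using assms unfolding harmonic_def by blast+
  then show "a * f e + b * g e = 0" by simp
next
  fix v w :: "'a vertex" assume "(v, w) \<in> edges"
  then have "f (w, v) = - f (v, w)" "g (w, v) = - g (v, w)" using harmonic_flip assms by blast+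
  then show "a * f (v, w) + b * g (v, w) + (a * f (w, v) + b * g (w, v)) = 0" by simp
next
  fix v :: "'a vertex" assume "v \<in> vertices"
  then have "(\<Sum>w | (v, w) \<in> edges. f (v, w)) = 0" "(\<Sum>w | (v, w) \<in> edges. g (v, w)) = 0"
    using assms unfolding harmonic_def by blast+
  then show "(\<Sum>w | (v, w) \<in> edges. a * f (v, w) + b * g (v, w)) = 0"
    by (simp add: sum.distrib sum_distrib_left[symmetric])
qed

lemma H0_comb: "n \<noteq> 0 \<Longrightarrow> f \<in> H0 n \<Longrightarrow> g \<in> H0 n \<Longrightarrow> (\<lambda>e. a * f e + b * g e) \<in> H0 n"
  by (simp add: H0_iff harmonic_comb invariant_def)

lemma H0_zero [simp]: "n \<noteq> 0 \<Longrightarrow> (\<lambda>e. 0) \<in> H0 n"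
  by (simp add: H0_iff invariant_def harmonic_def)

lemma H0_scale: "n \<noteq> 0 \<Longrightarrow> f \<in> H0 n \<Longrightarrow> (\<lambda>e. a * f e) \<in> H0 n"
  using H0_comb[of n f f a 0] by simp

lemma H0_add: "n \<noteq> 0 \<Longrightarrow> f \<in> H0 n \<Longrightarrow> g \<in> H0 n \<Longrightarrow> (\<lambda>e. f e + g e) \<in> H0 n"
  using H0_comb[of n f g 1 1] by simp

lemma H0_minus: "n \<noteq> 0 \<Longrightarrow> f \<in> H0 n \<Longrightarrow> (\<lambda>e. - f e) \<in> H0 n"
  using H0_comb[of n f f "-1" 0] by simp

lemma H0_sum: "n \<noteq> 0 \<Longrightarrow> (\<And>i. i \<in> I \<Longrightarrow> F i \<in> H0 n) \<Longrightarrow> (\<lambda>e. \<Sum>i\<in>I. c i * F i e) \<in> H0 n"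
proof (induction I rule: infinite_finite_induct)
  case (insert x I)
  then show ?case using H0_comb[of n "F x" "\<lambda>e. \<Sum>i\<in>I. c i * F i e" "c x" 1] by simp
qed simp_all

text \<open>\<open>H0 n\<close> is saturated in the group of all integral functions. This is why
  operators preserve divisibility by \<open>k\<close>, see \<open>T_divisible\<close>.\<close>

lemma H0_divide:
  assumes n: "n \<noteq> 0" and f: "f \<in> H0 n" and k: "k \<noteq> 0" "\<And>e. k dvd f e"
  shows "(\<lambda>e. f e div k) \<in> H0 n"
proof -
  have e: "f e = k * (f e div k)" for e using k by simp
  have h: "harmonic f" using f by (rule H0_harmonic)
  have "harmonic (\<lambda>e. f e div k)"
    unfolding harmonic_def
  proof (intro conjI allI impI ballI)
    fix v w :: "'a vertex" assume "(v, w) \<in> edges"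
    then have "k * (f (v, w) div k + f (w, v) div k) = 0"
      unfolding distrib_left e[symmetric] using h unfolding harmonic_def by blast
    then show "f (v, w) div k + f (w, v) div k = 0" using k by simp
  next
    fix v :: "'a vertex" assume "v \<in> vertices"
    then have "k * (\<Sum>w | (v, w) \<in> edges. f (v, w) div k) = 0"
      unfolding sum_distrib_left e[symmetric] using h unfolding harmonic_def by blast
    then show "(\<Sum>w | (v, w) \<in> edges. f (v, w) div k) = 0" using k by simp
  next
    fix e :: "'a edge" assume "e \<notin> edges"
    then have "f e = 0" using h unfolding harmonic_def by blast
    then show "f e div k = 0" by simp
  qed
  then show ?thesis using f by (simp add: H0_iff[OF n] invariant_def)
qed

context
  fixes n :: "'a::{field,finite} poly"
  assumes n0: "n \<noteq> 0"
begin

abbreviation "R \<equiv> End_H0 n"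

lemma R_carrier_iff: "F \<in> carrier R \<longleftrightarrow> F \<in> H0 n \<rightarrow>\<^sub>E H0 n \<and>
    (\<forall>f\<in>H0 n. \<forall>g\<in>H0 n. F (\<lambda>e. f e + g e) = (\<lambda>e. F f e + F g e))"
  by (simp add: End_H0_def)

lemma R_mem: "F \<in> carrier R \<Longrightarrow> f \<in> H0 n \<Longrightarrow> F f \<in> H0 n"
  by (auto simp: R_carrier_iff)

lemma R_additive: "F \<in> carrier R \<Longrightarrow> f \<in> H0 n \<Longrightarrow> g \<in> H0 n \<Longrightarrow> F (\<lambda>e. f e + g e) = (\<lambda>e. F f e + F g e)"
  by (auto simp: R_carrier_iff)

lemma R_ext: "F \<in> carrier R \<Longrightarrow> G \<in> carrier R \<Longrightarrow> (\<And>f. f \<in> H0 n \<Longrightarrow> F f = G f) \<Longrightarrow> F = G"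
  by (rule PiE_ext[of F "H0 n" "\<lambda>_. H0 n" G]) (auto simp: R_carrier_iff)

lemma R_mult [simp]: "f \<in> H0 n \<Longrightarrow> (F \<otimes>\<^bsub>R\<^esub> G) f = F (G f)"
  by (simp add: End_H0_def compose_def)

lemma R_one [simp]: "f \<in> H0 n \<Longrightarrow> \<one>\<^bsub>R\<^esub> f = f"
  by (simp add: End_H0_def)

lemma R_zero [simp]: "f \<in> H0 n \<Longrightarrow> \<zero>\<^bsub>R\<^esub> f = (\<lambda>e. 0)"
  by (simp add: End_H0_def)

lemma R_add [simp]: "f \<in> H0 n \<Longrightarrow> (F \<oplus>\<^bsub>R\<^esub> G) f = (\<lambda>e. F f e + G f e)"
  by (simp add: End_H0_def)

lemma R_carrierI:
  assumes "\<And>f. f \<in> H0 n \<Longrightarrow> F f \<in> H0 n" "\<And>f. f \<notin> H0 n \<Longrightarrow> F f = undefined"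
    "\<And>f g. f \<in> H0 n \<Longrightarrow> g \<in> H0 n \<Longrightarrow> F (\<lambda>e. f e + g e) = (\<lambda>e. F f e + F g e)"
  shows "F \<in> carrier R"
  using assms unfolding R_carrier_iff by (auto simp: PiE_def extensional_def)

lemma R_add_closed: "F \<in> carrier R \<Longrightarrow> G \<in> carrier R \<Longrightarrow> F \<oplus>\<^bsub>R\<^esub> G \<in> carrier R"
  by (rule R_carrierI) (simp_all add: H0_add n0 R_mem R_additive add_ac, simp add: End_H0_def)

lemma R_mult_closed: "F \<in> carrier R \<Longrightarrow> G \<in> carrier R \<Longrightarrow> F \<otimes>\<^bsub>R\<^esub> G \<in> carrier R"
  by (rule R_carrierI) (simp_all add: H0_add n0 R_mem R_additive, simp add: End_H0_def compose_def)

lemma R_zero_closed: "\<zero>\<^bsub>R\<^esub> \<in> carrier R"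
  by (rule R_carrierI) (simp_all add: H0_add n0, simp add: End_H0_def)

lemma R_one_closed: "\<one>\<^bsub>R\<^esub> \<in> carrier R"
  by (rule R_carrierI) (simp_all add: H0_add n0, simp add: End_H0_def)

lemma R_neg_closed: "F \<in> carrier R \<Longrightarrow> (\<lambda>f\<in>H0 n. \<lambda>e. - F f e) \<in> carrier R"
  by (rule R_carrierI) (simp_all add: H0_add H0_minus n0 R_mem R_additive)

lemma R_ring: "ring R"
proof (rule ringI)
  show "abelian_group R"
  proof (rule abelian_groupI)
    fix x assume x: "x \<in> carrier R"
    show "\<exists>y\<in>carrier R. y \<oplus>\<^bsub>R\<^esub> x = \<zero>\<^bsub>R\<^esub>"
      by (intro bexI[of _ "\<lambda>f\<in>H0 n. \<lambda>e. - x f e"] R_ext R_add_closed R_zero_closed R_neg_closed x) simp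
  qed (auto intro!: R_ext simp: R_add_closed R_zero_closed add_ac)
  show "monoid R"
    by (rule monoidI) (auto intro!: R_ext simp: R_mult_closed R_one_closed R_mem)
qed (auto intro!: R_ext simp: R_mult_closed R_add_closed R_mem R_additive)

lemma R_neg: "F \<in> carrier R \<Longrightarrow> \<ominus>\<^bsub>R\<^esub> F = (\<lambda>f\<in>H0 n. \<lambda>e. - F f e)"
proof -
  interpret ring R by (rule R_ring)
  assume F: "F \<in> carrier R"
  show ?thesis
    by (rule minus_equality) (auto intro!: R_ext R_add_closed R_zero_closed R_neg_closed F)
qed

lemma R_neg_app: "F \<in> carrier R \<Longrightarrow> f \<in> H0 n \<Longrightarrow> (\<ominus>\<^bsub>R\<^esub> F) f = (\<lambda>e. - F f e)"
  by (simp add: R_neg)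

lemma R_linear:
  assumes F: "F \<in> carrier R" and f: "f \<in> H0 n"
  shows "F (\<lambda>e. (k::int) * f e) = (\<lambda>e. k * F f e)"
proof -
  have z: "F (\<lambda>e. 0) = (\<lambda>e. 0)"
  proof
    fix e
    show "F (\<lambda>e. 0) e = 0" using fun_cong[OF R_additive[OF F, of "\<lambda>e. 0" "\<lambda>e. 0"], of e] n0 by simp
  qed
  have nat: "F (\<lambda>e. int m * f e) = (\<lambda>e. int m * F f e)" for m
  proof (induction m)
    case (Suc m)
    have "F (\<lambda>e. int m * f e + f e) = (\<lambda>e. F (\<lambda>e. int m * f e) e + F f e)"
      using R_additive[OF F H0_scale[OF n0 f, of "int m"] f] .
    then show ?case unfolding Suc.IH by (simp add: algebra_simps)
  qed (simp add: z)
  have neg: "F (\<lambda>e. - (int m * f e)) = (\<lambda>e. - (int m * F f e))" for m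
  proof -
    have mf: "(\<lambda>e. int m * f e) \<in> H0 n" by (rule H0_scale[OF n0 f])
    have "(\<lambda>e. F (\<lambda>e. int m * f e) e + F (\<lambda>e. - (int m * f e)) e) = (\<lambda>e. 0)"
      using R_additive[OF F mf H0_minus[OF n0 mf]] z by simp
    then have "int m * F f e + F (\<lambda>e. - (int m * f e)) e = 0" for e unfolding nat by (rule fun_cong)
    then show ?thesis by (intro ext) (simp add: eq_neg_iff_add_eq_0 add.commute)
  qed
  show ?thesis
  proof (cases "k \<ge> 0")
    case True
    then show ?thesis using nat[of "nat k"] by simp
  next
    case False
    then show ?thesis using neg[of "nat (- k)"] by simp
  qed
qed

lemma R_sum:
  assumes F: "F \<in> carrier R" and "\<And>i. i \<in> I \<Longrightarrow> g i \<in> H0 n"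
  shows "F (\<lambda>e. \<Sum>i\<in>I. c i * g i e) = (\<lambda>e. \<Sum>i\<in>I. c i * F (g i) e)"
  using assms(2)
proof (induction I rule: infinite_finite_induct)
  case (insert x I)
  have "F (\<lambda>e. c x * g x e + (\<Sum>i\<in>I. c i * g i e)) = (\<lambda>e. F (\<lambda>e. c x * g x e) e + F (\<lambda>e. \<Sum>i\<in>I. c i * g i e) e)"
    using insert.prems by (intro R_additive[OF F] H0_scale H0_sum n0) auto
  then show ?case using insert R_linear[OF F] by simp
qed (use R_linear[OF F H0_zero[OF n0], of 0] in simp_all)

lemma hecke_carrier: "monic m \<Longrightarrow> hecke n m \<in> carrier R"
  by (rule R_carrierI) (simp_all add: hecke_eq_hecke_op hecke_op_H0 n0 H0_add, simp_all add: hecke_def hecke_op_def sum.distrib)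

lemma add_pow_one: "add_pow R (k::nat) \<one>\<^bsub>R\<^esub> \<in> carrier R \<and> (\<forall>f\<in>H0 n. add_pow R k \<one>\<^bsub>R\<^esub> f = (\<lambda>e. int k * f e))"
proof (induction k)
  case 0
  then show ?case by (simp add: add_pow_def nat_pow_def R_zero_closed)
next
  case (Suc k)
  have s: "add_pow R (Suc k) \<one>\<^bsub>R\<^esub> = add_pow R k \<one>\<^bsub>R\<^esub> \<oplus>\<^bsub>R\<^esub> \<one>\<^bsub>R\<^esub>" by (simp add: add_pow_def nat_pow_def)
  show ?case unfolding s using Suc by (simp add: R_add_closed R_one_closed algebra_simps)
qed

definition cgen :: "'a poly \<Rightarrow> ('a edge \<Rightarrow> int) \<Rightarrow> 'a edge \<Rightarrow> int" where
  "cgen q = hecke n q \<ominus>\<^bsub>R\<^esub> add_pow R (ideal_norm q) \<one>\<^bsub>R\<^esub> \<ominus>\<^bsub>R\<^esub> \<one>\<^bsub>R\<^esub>"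

lemma cgen_carrier: "monic q \<Longrightarrow> cgen q \<in> carrier R"
proof -
  interpret ring R by (rule R_ring)
  assume "monic q"
  then show ?thesis using hecke_carrier add_pow_one by (simp add: cgen_def)
qed

lemma cgen_app: "monic q \<Longrightarrow> f \<in> H0 n \<Longrightarrow> cgen q f = (\<lambda>e. hecke_op n q f e - (int (ideal_norm q) + 1) * f e)"
proof -
  interpret ring R by (rule R_ring)
  assume q: "monic q" and f: "f \<in> H0 n"
  have "add_pow R (ideal_norm q) \<one>\<^bsub>R\<^esub> \<in> carrier R" "add_pow R (ideal_norm q) \<one>\<^bsub>R\<^esub> f = (\<lambda>e. int (ideal_norm q) * f e)"
    using add_pow_one f by auto
  then show ?thesis using q f hecke_carrier[OF q]
    by (simp add: cgen_def a_minus_def R_neg_app hecke_eq_hecke_op R_one_closed algebra_simps)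
qed

lemma eisenstein_gens_eq: "eisenstein_gens n = {cgen q | q. monic q \<and> prime_elem q \<and> \<not> q dvd n}"
  by (simp add: eisenstein_gens_def cgen_def)

lemma generate_lin:
  assumes S: "S \<subseteq> carrier R" and t: "t \<in> generate_ring R S" "t' \<in> generate_ring R S"
  shows "(\<lambda>f\<in>H0 n. \<lambda>e. (a::int) * t f e + b * t' f e) \<in> generate_ring R S"
proof -
  interpret ring R by (rule R_ring)
  let ?T = "generate_ring R S"
  have sub: "?T \<subseteq> carrier R" by (rule generate_ring_incl[OF S])
  have nat: "(\<lambda>f\<in>H0 n. \<lambda>e. int m * t f e) \<in> ?T" if t: "t \<in> ?T" for m t
  proof (induction m)
    case 0
    have "(\<lambda>f\<in>H0 n. \<lambda>e. int 0 * t f e) = \<zero>\<^bsub>R\<^esub>" by (simp add: End_H0_def)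
    then show ?case using zero_in_generate by simp
  next
    case (Suc m)
    have "(\<lambda>f\<in>H0 n. \<lambda>e. int (Suc m) * t f e) = (\<lambda>f\<in>H0 n. \<lambda>e. int m * t f e) \<oplus>\<^bsub>R\<^esub> t"
      by (rule ext) (simp add: End_H0_def algebra_simps)
    then show ?case using generate_ring.eng_add[OF Suc t] by (simp only:)
  qed
  have int: "(\<lambda>f\<in>H0 n. \<lambda>e. k * t f e) \<in> ?T" if t: "t \<in> ?T" for k :: int and t
  proof (cases "k \<ge> 0")
    case True
    then show ?thesis using nat[OF t, of "nat k"] by simp
  next
    case False
    have m: "(\<lambda>f\<in>H0 n. \<lambda>e. int (nat (- k)) * t f e) \<in> ?T" by (rule nat[OF t])
    then have "\<ominus>\<^bsub>R\<^esub> (\<lambda>f\<in>H0 n. \<lambda>e. int (nat (- k)) * t f e) = (\<lambda>f\<in>H0 n. \<lambda>e. k * t f e)"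
      using sub False by (subst R_neg) (auto simp: restrict_def fun_eq_iff)
    then show ?thesis using generate_ring.a_inv[OF m] by simp
  qed
  have "(\<lambda>f\<in>H0 n. \<lambda>e. a * t f e + b * t' f e) = (\<lambda>f\<in>H0 n. \<lambda>e. a * t f e) \<oplus>\<^bsub>R\<^esub> (\<lambda>f\<in>H0 n. \<lambda>e. b * t' f e)"
    by (rule ext) (simp add: End_H0_def)
  then show ?thesis using generate_ring.eng_add[OF int[OF t(1)] int[OF t(2)]] by simp
qed

lemma generate_sum:
  assumes S: "S \<subseteq> carrier R" and t: "\<And>i. i \<in> I \<Longrightarrow> t i \<in> generate_ring R S"
  shows "(\<lambda>f\<in>H0 n. \<lambda>e. \<Sum>i\<in>I. (c i::int) * t i f e) \<in> generate_ring R S"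
proof -
  interpret ring R by (rule R_ring)
  have z: "(\<lambda>f\<in>H0 n. \<lambda>e. 0) \<in> generate_ring R S"
    using zero_in_generate[of S] by (simp add: End_H0_def)
  show ?thesis using t
  proof (induction I rule: infinite_finite_induct)
    case (insert x I)
    have i: "(\<lambda>f\<in>H0 n. \<lambda>e. \<Sum>i\<in>I. c i * t i f e) \<in> generate_ring R S"
      by (rule insert.IH) (use insert.prems in blast)
    have x: "t x \<in> generate_ring R S" using insert.prems by blast
    have "(\<lambda>f\<in>H0 n. \<lambda>e. \<Sum>i\<in>insert x I. c i * t i f e) =
        (\<lambda>f\<in>H0 n. \<lambda>e. c x * t x f e + 1 * (\<lambda>f\<in>H0 n. \<lambda>e. \<Sum>i\<in>I. c i * t i f e) f e)"
      using insert by (intro restrict_ext) simp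
    then show ?case using generate_lin[OF S x i, of "c x" 1] by (simp only:)
  qed (use z in simp_all)
qed

end

declare split_paired_All [simp del] split_paired_Ex [simp del]

section \<open>The quotient by the Eisenstein ideal\<close>

text \<open>Any prime factor of \<open>n + 1\<close> will do.\<close>

lemma exists_prime_not_dvd:
  fixes n :: "'a::{field,finite} poly"
  assumes "degree n > 0"
  shows "\<exists>q. monic q \<and> prime_elem q \<and> \<not> q dvd n"
proof -
  have "degree (n + 1) = degree n" using assms by (intro degree_add_eq_left) simp
  then obtain q where q: "monic q" "prime_elem q" "q dvd n + 1" using prime_factor_exists[of "n + 1"] assms by auto
  have "\<not> q dvd n"
  proof
    assume "q dvd n"
    then have "q dvd 1" using q(3) by (metis dvd_add_right_iff)
    then show False using q(2) by (simp add: prime_elem_def)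
  qed
  then show ?thesis using q by blast
qed

text \<open>One argument for both algebras: \<open>S\<close> consists of all Hecke operators, or of
  those with index prime to \<open>n\<close>. Either way it contains the operators at the primes not
  dividing \<open>n\<close>, from which the ideal is generated.\<close>

context
  fixes n :: "'a::{field,finite} poly" and S :: "(('a edge \<Rightarrow> int) \<Rightarrow> 'a edge \<Rightarrow> int) set"
  assumes n0: "n \<noteq> 0" and dn: "degree n > 0"
    and S_sub: "S \<subseteq> {hecke n m | m. monic m}"
    and S_gens: "\<And>q. monic q \<Longrightarrow> prime_elem q \<Longrightarrow> \<not> q dvd n \<Longrightarrow> hecke n q \<in> S"
begin

abbreviation "E \<equiv> End_H0 n"
abbreviation "T \<equiv> generate_ring (End_H0 n) S"
abbreviation "A \<equiv> (End_H0 n) \<lparr>carrier := generate_ring (End_H0 n) S\<rparr>"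
abbreviation "J \<equiv> genideal ((End_H0 n) \<lparr>carrier := generate_ring (End_H0 n) S\<rparr>) (eisenstein_gens n)"

lemma S_carrier: "S \<subseteq> carrier E"
  using S_sub hecke_carrier[OF n0] by blast

lemma T_carrier: "t \<in> T \<Longrightarrow> t \<in> carrier E"
  using ring.generate_ring_incl[OF R_ring[OF n0] S_carrier] by blast

lemma T_H0: "t \<in> T \<Longrightarrow> f \<in> H0 n \<Longrightarrow> t f \<in> H0 n"
  using T_carrier R_mem[OF n0] by blast

lemma A_ring: "ring A"
  by (rule ring.generate_ring_is_ring[OF R_ring[OF n0] S_carrier])

lemma A_pow: "add_pow A (k::nat) x = add_pow E k x"
  by (simp add: add_pow_def nat_pow_def)

lemma cgen_T:
  assumes q: "monic q" "prime_elem q" "\<not> q dvd n"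
  shows "cgen n q \<in> T"
proof -
  have h: "hecke n q \<in> T" using S_gens[OF q] by (rule generate_ring.incl)
  have o: "\<one>\<^bsub>E\<^esub> \<in> T" by (rule generate_ring.one)
  have t: "(\<lambda>f\<in>H0 n. \<lambda>e. 1 * hecke n q f e + (- (int (ideal_norm q) + 1)) * \<one>\<^bsub>E\<^esub> f e) \<in> T"
    by (rule generate_lin[OF n0 S_carrier h o])
  have "cgen n q = (\<lambda>f\<in>H0 n. \<lambda>e. 1 * hecke n q f e + (- (int (ideal_norm q) + 1)) * \<one>\<^bsub>E\<^esub> f e)"
  proof (rule R_ext[OF n0 cgen_carrier[OF n0 q(1)] T_carrier[OF t]])
    fix f assume f: "f \<in> H0 n"
    show "cgen n q f = (\<lambda>f\<in>H0 n. \<lambda>e. 1 * hecke n q f e + (- (int (ideal_norm q) + 1)) * \<one>\<^bsub>E\<^esub> f e) f"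
      using f by (simp add: cgen_app[OF n0 q(1) f] hecke_eq_hecke_op R_one[OF n0] algebra_simps)
  qed
  then show ?thesis using t by (simp only:)
qed

lemma gens_T: "eisenstein_gens n \<subseteq> T"
  unfolding eisenstein_gens_eq[OF n0] using cgen_T by blast

lemma J_ideal: "ideal J A"
  using ring.genideal_ideal[OF A_ring] gens_T by simp

lemma cgen_J: "monic q \<Longrightarrow> prime_elem q \<Longrightarrow> \<not> q dvd n \<Longrightarrow> cgen n q \<in> J"
proof -
  assume "monic q" "prime_elem q" "\<not> q dvd n"
  then have "cgen n q \<in> eisenstein_gens n" unfolding eisenstein_gens_eq[OF n0] by blast
  moreover have "eisenstein_gens n \<subseteq> J"
    by (rule ring.genideal_self[OF A_ring]) (use gens_T in simp)
  ultimately show "cgen n q \<in> J" by blast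
qed

lemma cgen_injective:
  assumes q: "monic q" "prime_elem q" "\<not> q dvd n" and f: "f \<in> H0 n" and z: "cgen n q f = (\<lambda>e. 0)"
  shows "f = (\<lambda>e. 0)"
proof (rule no_eisenstein[OF f n0 q])
  fix e
  have "hecke_op n q f e - (int (ideal_norm q) + 1) * f e = 0"
    using fun_cong[OF z, of e] unfolding cgen_app[OF n0 q(1) f] .
  then show "hecke_op n q f e = (int (card (Res q)) + 1) * f e" using q by (simp add: ideal_norm_Res)
qed

lemma H0_fg:
  obtains B where "finite B" "B \<subseteq> H0 n" "\<And>g. g \<in> H0 n \<Longrightarrow> \<exists>c. g = (\<lambda>e. \<Sum>b\<in>B. c b * b e)"
proof -
  obtain X where X: "finite X" "\<And>f. f \<in> H0 n \<Longrightarrow> (\<And>s. s \<in> X \<Longrightarrow> f s = 0) \<Longrightarrow> f = (\<lambda>e. 0)"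
    using H0_determined[OF n0] by blast
  have "\<exists>B\<subseteq>H0 n. finite B \<and> (\<forall>g\<in>H0 n. \<exists>c. \<forall>x\<in>X. g x = (\<Sum>b\<in>B. c b * b x))"
    by (rule int_functions_fg[OF X(1)]) (simp_all add: n0 H0_comb)
  then obtain B where B: "B \<subseteq> H0 n" "finite B" "\<And>g. g \<in> H0 n \<Longrightarrow> \<exists>c. \<forall>x\<in>X. g x = (\<Sum>b\<in>B. c b * b x)"
    by blast
  have "\<exists>c. g = (\<lambda>e. \<Sum>b\<in>B. c b * b e)" if g: "g \<in> H0 n" for g
  proof -
    obtain c where c: "\<forall>x\<in>X. g x = (\<Sum>b\<in>B. c b * b x)" using B(3)[OF g] by blast
    have s: "(\<lambda>e. \<Sum>b\<in>B. c b * b e) \<in> H0 n" using B(1) by (intro H0_sum n0) auto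
    have eq: "(\<lambda>e. 1 * g e + (-1) * (\<Sum>b\<in>B. c b * b e)) = (\<lambda>e. 0)"
      by (rule X(2)[OF H0_comb[OF n0 g s]]) (use c in simp)
    have "g e = (\<Sum>b\<in>B. c b * b e)" for e using fun_cong[OF eq, of e] by simp
    then show ?thesis by blast
  qed
  then show ?thesis using that B by blast
qed

text \<open>Operators as integral functions of a cochain and an edge, so that
  \<open>int_functions_fg\<close> applies to sets of operators.\<close>

definition Phi :: "(('a edge \<Rightarrow> int) \<Rightarrow> 'a edge \<Rightarrow> int) \<Rightarrow> ('a edge \<Rightarrow> int) \<times> 'a edge \<Rightarrow> int" where
  "Phi t x = (if fst x \<in> H0 n then t (fst x) (snd x) else 0)"

lemma Phi_sum: "Phi (\<lambda>f\<in>H0 n. \<lambda>e. \<Sum>i\<in>I. c i * t i f e) x = (\<Sum>i\<in>I. c i * Phi (t i) x)"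
  by (simp add: Phi_def)

lemma Phi_lin: "Phi (\<lambda>f\<in>H0 n. \<lambda>e. a * t f e + b * t' f e) x = a * Phi t x + b * Phi t' x"
  by (simp add: Phi_def)

text \<open>An additive operator is known from its values on generators of \<open>H0 n\<close>, and
  each of these from its restriction to a determining set of edges.\<close>

lemma T_coordinates:
  obtains X where "finite X"
    "\<And>t t'. t \<in> T \<Longrightarrow> t' \<in> T \<Longrightarrow> (\<And>x. x \<in> X \<Longrightarrow> Phi t x = Phi t' x) \<Longrightarrow> t = t'"
proof -
  obtain X where X: "finite X" "\<And>f. f \<in> H0 n \<Longrightarrow> (\<And>s. s \<in> X \<Longrightarrow> f s = 0) \<Longrightarrow> f = (\<lambda>e. 0)"
    using H0_determined[OF n0] by blast
  obtain B where B: "finite B" "B \<subseteq> H0 n" "\<And>g. g \<in> H0 n \<Longrightarrow> \<exists>c. g = (\<lambda>e. \<Sum>b\<in>B. c b * b e)"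
    using H0_fg by blast
  show ?thesis
  proof (rule that[of "B \<times> X"])
    show "finite (B \<times> X)" using X B by simp
    fix t t' assume t: "t \<in> T" "t' \<in> T" and eq: "\<And>x. x \<in> B \<times> X \<Longrightarrow> Phi t x = Phi t' x"
    have b: "t b = t' b" if b: "b \<in> B" for b
    proof -
      have bH: "b \<in> H0 n" using B b by blast
      have eq: "(\<lambda>e. 1 * t b e + (-1) * t' b e) = (\<lambda>e. 0)"
      proof (rule X(2)[OF H0_comb[OF n0 T_H0[OF t(1) bH] T_H0[OF t(2) bH]]])
        fix s assume "s \<in> X"
        then show "1 * t b s + (-1) * t' b s = 0" using eq[of "(b, s)"] b bH by (simp add: Phi_def)
      qed
      show ?thesis
      proof
        fix e show "t b e = t' b e" using fun_cong[OF eq, of e] by simp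
      qed
    qed
    show "t = t'"
    proof (rule R_ext[OF n0 T_carrier[OF t(1)] T_carrier[OF t(2)]])
      fix g assume g: "g \<in> H0 n"
      then obtain c where c: "g = (\<lambda>e. \<Sum>b\<in>B. c b * b e)" using B(3) by blast
      have "t g = (\<lambda>e. \<Sum>b\<in>B. c b * t b e)" "t' g = (\<lambda>e. \<Sum>b\<in>B. c b * t' b e)"
        unfolding c using B(2) t by (intro R_sum[OF n0] T_carrier; auto)+
      then show "t g = t' g" using b by simp
    qed
  qed
qed

lemma T_fg:
  obtains B \<tau> where "finite (B :: (('a edge \<Rightarrow> int) \<times> 'a edge \<Rightarrow> int) set)" "\<And>b. b \<in> B \<Longrightarrow> \<tau> b \<in> T"
    "\<And>t. t \<in> T \<Longrightarrow> \<exists>c. t = (\<lambda>f\<in>H0 n. \<lambda>e. \<Sum>b\<in>B. c b * \<tau> b f e)"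
proof -
  obtain X where X: "finite X"
    and ex: "\<And>t t'. t \<in> T \<Longrightarrow> t' \<in> T \<Longrightarrow> (\<And>x. x \<in> X \<Longrightarrow> Phi t x = Phi t' x) \<Longrightarrow> t = t'"
    using T_coordinates by metis
  define G where "G = Phi ` T"
  have "\<exists>B\<subseteq>G. finite B \<and> (\<forall>g\<in>G. \<exists>c. \<forall>x\<in>X. g x = (\<Sum>b\<in>B. c b * b x))"
  proof (rule int_functions_fg[OF X])
    have comb: "(\<lambda>x. a * Phi t x + b * Phi t' x) \<in> G" if "t \<in> T" "t' \<in> T" for a b t t'
    proof -
      have "(\<lambda>x. a * Phi t x + b * Phi t' x) = Phi (\<lambda>f\<in>H0 n. \<lambda>e. a * t f e + b * t' f e)" by (rule HOL.ext) (simp only: Phi_lin)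
      then show ?thesis unfolding G_def using generate_lin[OF n0 S_carrier that] by blast
    qed
    show "(\<lambda>x. 0) \<in> G" using comb[OF generate_ring.one generate_ring.one, of 0 0] by simp
    show "(\<lambda>x. a * g x + b * h x) \<in> G" if "g \<in> G" "h \<in> G" for g h a b
      using that comb unfolding G_def by blast
  qed
  then obtain B where B: "B \<subseteq> G" "finite B" "\<And>g. g \<in> G \<Longrightarrow> \<exists>c. \<forall>x\<in>X. g x = (\<Sum>b\<in>B. c b * b x)" by blast
  have "\<forall>b\<in>B. \<exists>t. t \<in> T \<and> Phi t = b" using B(1) by (auto simp: G_def)
  then obtain \<tau> where \<tau>: "\<And>b. b \<in> B \<Longrightarrow> \<tau> b \<in> T" "\<And>b. b \<in> B \<Longrightarrow> Phi (\<tau> b) = b" by metis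
  show ?thesis
  proof (rule that[OF B(2) \<tau>(1)])
    fix t assume t: "t \<in> T"
    then obtain c where c: "\<forall>x\<in>X. Phi t x = (\<Sum>b\<in>B. c b * b x)" using B(3)[of "Phi t"] by (auto simp: G_def)
    have "t = (\<lambda>f\<in>H0 n. \<lambda>e. \<Sum>b\<in>B. c b * \<tau> b f e)"
      by (rule ex[OF t generate_sum[OF n0 S_carrier \<tau>(1)]]) (simp_all add: c Phi_sum \<tau>)
    then show "\<exists>c. t = (\<lambda>f\<in>H0 n. \<lambda>e. \<Sum>b\<in>B. c b * \<tau> b f e)" by blast
  qed
qed

text \<open>Integrality of \<open>C = cgen n q\<close>: the polynomials in \<open>C\<close> form a
  finitely generated group, so a nonzero integral polynomial annihilates \<open>C\<close>. In one of
  least degree the constant term \<open>a\<close> is nonzero, because \<open>C\<close> is injective.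
  Then \<open>a\<close> equals \<open>C\<close> times a polynomial in \<open>C\<close> and lies in
  the ideal.\<close>

lemma multiple_in_J:
  "\<exists>a::int. a \<noteq> 0 \<and> (\<lambda>f\<in>H0 n. \<lambda>e. a * f e) \<in> J"
proof -
  obtain q where q: "monic q" "prime_elem q" "\<not> q dvd n" using exists_prime_not_dvd[OF dn] by blast
  define C where "C = cgen n q"
  have CT: "C \<in> T" unfolding C_def by (rule cgen_T[OF q])
  have CJ: "C \<in> J" unfolding C_def by (rule cgen_J[OF q])
  define Cp where "Cp i = (\<lambda>f\<in>H0 n. (C ^^ i) f)" for i
  have CpT: "Cp i \<in> T" for i
  proof (induction i)
    case 0
    have "Cp 0 = \<one>\<^bsub>E\<^esub>" by (simp add: Cp_def End_H0_def)
    then show ?case using generate_ring.one by (simp only:)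
  next
    case (Suc i)
    have "Cp (Suc i) = C \<otimes>\<^bsub>E\<^esub> Cp i" by (rule HOL.ext) (simp add: Cp_def End_H0_def compose_def)
    then show ?case using generate_ring.eng_mult[OF CT Suc] by (simp only:)
  qed
  have CpS: "Cp (Suc i) f = C (Cp i f)" "Cp 0 f = f" if "f \<in> H0 n" for i f
    using that by (simp_all add: Cp_def)
  \<comment> \<open>The value of the integral polynomial \<open>r\<close> at
    \<open>C\<close>.\<close>
  define P where "P r = (\<lambda>f\<in>H0 n. \<lambda>e. \<Sum>i\<le>degree r. coeff r i * Cp i f e)" for r
  have PT: "P r \<in> T" for r unfolding P_def by (rule generate_sum[OF n0 S_carrier CpT])
  have Pd: "P r f e = (\<Sum>i\<le>M. coeff r i * Cp i f e)" if "degree r \<le> M" "f \<in> H0 n" for r M f e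
  proof -
    have "(\<Sum>i\<le>M. coeff r i * Cp i f e) = (\<Sum>i\<le>degree r. coeff r i * Cp i f e)"
      by (rule sum.mono_neutral_right) (use that(1) in \<open>auto simp: coeff_eq_0\<close>)
    then show ?thesis using that by (simp add: P_def)
  qed
  obtain X where X: "finite X"
    and ex: "\<And>t t'. t \<in> T \<Longrightarrow> t' \<in> T \<Longrightarrow> (\<And>x. x \<in> X \<Longrightarrow> Phi t x = Phi t' x) \<Longrightarrow> t = t'"
    using T_coordinates by metis
  have PhiP: "Phi (P r) x = (\<Sum>i\<le>M. coeff r i * Phi (Cp i) x)" if "degree r \<le> M" for r M x
  proof -
    have "P r = (\<lambda>f\<in>H0 n. \<lambda>e. \<Sum>i\<le>M. coeff r i * Cp i f e)"
      unfolding P_def using that Pd[OF that] by (intro restrict_ext HOL.ext) (simp add: P_def)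
    then show ?thesis by (simp only: Phi_sum)
  qed
  define G where "G = range (\<lambda>r. Phi (P r))"
  have "\<exists>B\<subseteq>G. finite B \<and> (\<forall>g\<in>G. \<exists>c. \<forall>x\<in>X. g x = (\<Sum>b\<in>B. c b * b x))"
  proof (rule int_functions_fg[OF X])
    have comb: "(\<lambda>x. a * Phi (P r) x + b * Phi (P s) x) \<in> G" for a b r s
    proof -
      define M where "M = max (degree r) (degree s)"
      have "degree (smult a r + smult b s) \<le> M" unfolding M_def
        by (intro degree_add_le order_trans[OF degree_smult_le]) auto
      then have "(\<lambda>x. a * Phi (P r) x + b * Phi (P s) x) = Phi (P (smult a r + smult b s))"
        by (intro HOL.ext) (simp add: PhiP[of _ M] M_def sum_distrib_left sum.distrib[symmetric] algebra_simps)
      then show ?thesis unfolding G_def by blast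
    qed
    show "(\<lambda>x. 0) \<in> G" using comb[of 0 0 0 0] by simp
    show "(\<lambda>x. a * g x + b * h x) \<in> G" if "g \<in> G" "h \<in> G" for g h a b
      using that comb unfolding G_def by blast
  qed
  then obtain B where B: "B \<subseteq> G" "finite B" "\<And>g. g \<in> G \<Longrightarrow> \<exists>c. \<forall>x\<in>X. g x = (\<Sum>b\<in>B. c b * b x)" by blast
  have "\<forall>b\<in>B. \<exists>r. Phi (P r) = b" using B(1) by (auto simp: G_def)
  then obtain \<rho> where \<rho>: "\<And>b. b \<in> B \<Longrightarrow> Phi (P (\<rho> b)) = b" by metis
  \<comment> \<open>\<open>M\<close> exceeds the degrees of the polynomials behind the generators.
    Writing the power \<open>M\<close> of \<open>C\<close> in these generators yields the monic
    relation \<open>r0\<close>.\<close>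
  define M where "M = Suc (Max (insert 0 ((\<lambda>b. degree (\<rho> b)) ` B)))"
  have dM: "degree (\<rho> b) < M" if "b \<in> B" for b unfolding M_def using that B(2) by (simp add: le_imp_less_Suc)
  obtain c where c: "\<forall>x\<in>X. Phi (P (monom 1 M)) x = (\<Sum>b\<in>B. c b * b x)" using B(3)[of "Phi (P (monom 1 M))"] by (auto simp: G_def)
  have Pm: "P (monom 1 M) = (\<lambda>f\<in>H0 n. \<lambda>e. \<Sum>b\<in>B. c b * P (\<rho> b) f e)"
    by (rule ex[OF PT generate_sum[OF n0 S_carrier PT]]) (simp add: c Phi_sum PT \<rho>)
  define r0 where "r0 = monom 1 M - (\<Sum>b\<in>B. smult (c b) (\<rho> b))"
  have cr0: "coeff r0 i = coeff (monom 1 M) i - (\<Sum>b\<in>B. c b * coeff (\<rho> b) i)" for i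
    by (simp add: r0_def coeff_sum)
  have "coeff r0 M = 1" using dM by (simp add: cr0 coeff_eq_0)
  then have r00: "r0 \<noteq> 0" by auto
  have dr0: "degree r0 \<le> M"
    by (rule degree_le) (use dM in \<open>auto simp: cr0 coeff_eq_0 intro!: sum.neutral\<close>, metis coeff_eq_0 less_trans)
  have Pr0: "P r0 f e = 0" if f: "f \<in> H0 n" for f e
  proof -
    have "P r0 f e = (\<Sum>i\<le>M. coeff (monom 1 M) i * Cp i f e) - (\<Sum>i\<le>M. \<Sum>b\<in>B. c b * coeff (\<rho> b) i * Cp i f e)"
      unfolding Pd[OF dr0 f] cr0 by (simp add: left_diff_distrib sum_subtractf sum_distrib_right)
    also have "(\<Sum>i\<le>M. \<Sum>b\<in>B. c b * coeff (\<rho> b) i * Cp i f e) = (\<Sum>b\<in>B. c b * P (\<rho> b) f e)"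
      by (subst sum.swap) (use dM f in \<open>auto simp: Pd[of _ M] less_imp_le sum_distrib_left mult.assoc intro!: sum.cong\<close>)
    also have "(\<Sum>i\<le>M. coeff (monom 1 M) i * Cp i f e) = P (monom 1 M) f e"
      using Pd[of "monom 1 M" M f e] f by (simp add: degree_monom_eq)
    finally show ?thesis unfolding Pm using f by simp
  qed
  define good where "good r \<longleftrightarrow> r \<noteq> 0 \<and> (\<forall>f\<in>H0 n. \<forall>e. P r f e = 0)" for r
  obtain r where r: "good r" "\<And>s. good s \<Longrightarrow> degree r \<le> degree s"
    using ex_has_least_nat[of good r0 degree] r00 Pr0 by (auto simp: good_def)
  obtain a s where as: "r = pCons a s" by (cases r)
  have split: "P r f e = a * f e + C (P s f) e" if f: "f \<in> H0 n" for f e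
  proof -
    have d: "degree r \<le> Suc (degree s)" by (simp add: as)
    have "C (\<lambda>e. \<Sum>i\<le>degree s. coeff s i * Cp i f e) = (\<lambda>e. \<Sum>i\<le>degree s. coeff s i * C (Cp i f) e)"
      using T_H0[OF CpT f] by (intro R_sum[OF n0 T_carrier[OF CT]]) auto
    from fun_cong[OF this, of e] have Ps: "(\<Sum>i\<le>degree s. coeff s i * C (Cp i f) e) = C (P s f) e"
      using f by (simp add: P_def)
    have "P r f e = (\<Sum>i\<le>Suc (degree s). coeff r i * Cp i f e)" by (rule Pd[OF d f])
    also have "\<dots> = a * f e + (\<Sum>i\<le>degree s. coeff s i * C (Cp i f) e)"
      unfolding sum.atMost_Suc_shift by (simp add: as CpS f)
    finally show ?thesis unfolding Ps .
  qed
  have a0: "a \<noteq> 0"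
  proof
    assume a: "a = 0"
    then have s0: "s \<noteq> 0" using r(1) as by (auto simp: good_def)
    have "P s f = (\<lambda>e. 0)" if f: "f \<in> H0 n" for f
    proof (rule cgen_injective[OF q T_H0[OF PT f]])
      show "cgen n q (P s f) = (\<lambda>e. 0)" using r(1) split[OF f] f a by (auto simp: good_def C_def)
    qed
    then have "good s" using s0 by (simp add: good_def)
    then have "degree r \<le> degree s" by (rule r(2))
    then show False using as s0 by simp
  qed
  have af: "a * f e = - C (P s f) e" if "f \<in> H0 n" for f e
    using split[OF that, of e] r(1) that by (simp add: good_def)
  define D where "D = (\<lambda>f\<in>H0 n. \<lambda>e. (-1) * P s f e + 0 * P s f e)"
  have DT: "D \<in> T" unfolding D_def by (rule generate_lin[OF n0 S_carrier PT PT])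
  have "C \<otimes>\<^bsub>E\<^esub> D = (\<lambda>f\<in>H0 n. \<lambda>e. a * f e)"
  proof (rule HOL.ext)
    fix f
    show "(C \<otimes>\<^bsub>E\<^esub> D) f = (\<lambda>f\<in>H0 n. \<lambda>e. a * f e) f"
    proof (cases "f \<in> H0 n")
      case True
      have "C (\<lambda>e. (-1) * P s f e) = (\<lambda>e. (-1) * C (P s f) e)"
        by (rule R_linear[OF n0 T_carrier[OF CT] T_H0[OF PT True]])
      then show ?thesis using True af[OF True] by (simp add: R_mult[OF n0] D_def)
    qed (simp add: End_H0_def compose_def)
  qed
  moreover have "C \<otimes>\<^bsub>E\<^esub> D \<in> J" using ideal.I_r_closed[OF J_ideal CJ, of D] DT by simp
  ultimately show ?thesis using a0 by auto
qed

text \<open>\<open>T\<close> is additively generated by finitely many \<open>\<tau> b\<close>, and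
  the ideal contains \<open>a\<close> times \<open>T\<close>; so all coefficients can be reduced
  modulo \<open>\<bar>a\<bar>\<close>.\<close>

lemma finite_quotient: "finite (carrier (A Quot J))"
proof -
  obtain a :: int where a: "a \<noteq> 0" "(\<lambda>f\<in>H0 n. \<lambda>e. a * f e) \<in> J" using multiple_in_J by blast
  obtain B \<tau> where B: "finite (B :: (('a edge \<Rightarrow> int) \<times> 'a edge \<Rightarrow> int) set)" "\<And>b. b \<in> B \<Longrightarrow> \<tau> b \<in> T"
    "\<And>t. t \<in> T \<Longrightarrow> \<exists>c. t = (\<lambda>f\<in>H0 n. \<lambda>e. \<Sum>b\<in>B. c b * \<tau> b f e)" using T_fg by blast
  define cmb where "cmb c = (\<lambda>f\<in>H0 n. \<lambda>e. \<Sum>b\<in>B. (c b :: int) * \<tau> b f e)" for c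
  have cT: "cmb c \<in> T" for c unfolding cmb_def by (rule generate_sum[OF n0 S_carrier B(2)])
  define Z where "Z = cmb ` (PiE B (\<lambda>_. {0..<\<bar>a\<bar>}))"
  interpret A: ring A by (rule A_ring)
  show ?thesis
  proof (rule finite_quot[OF J_ideal, of Z])
    show "finite Z" unfolding Z_def using B(1) by (intro finite_imageI finite_PiE) auto
    show "Z \<subseteq> carrier A" unfolding Z_def using cT by auto
    fix t assume t: "t \<in> carrier A"
    then obtain c where c: "t = cmb c" using B(3)[of t] by (auto simp: cmb_def)
    define z where "z = cmb (\<lambda>b\<in>B. c b mod \<bar>a\<bar>)"
    \<comment> \<open>The factor \<open>sgn a\<close> turns division by \<open>\<bar>a\<bar>\<close>
      into division by \<open>a\<close>.\<close>
    define k where "k b = sgn a * (c b div \<bar>a\<bar>)" for b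
    have ck: "c b = a * k b + c b mod \<bar>a\<bar>" for b
    proof -
      have "a * k b = \<bar>a\<bar> * (c b div \<bar>a\<bar>)" by (simp add: k_def abs_sgn mult.assoc)
      then show ?thesis by simp
    qed
    have zZ: "z \<in> Z" unfolding z_def Z_def using a(1) by (intro imageI) auto
    define w where "w = (\<lambda>f\<in>H0 n. \<lambda>e. a * f e) \<otimes>\<^bsub>E\<^esub> cmb k"
    have wJ: "w \<in> J" unfolding w_def using ideal.I_r_closed[OF J_ideal a(2), of "cmb k"] cT by simp
    have wT: "w \<in> carrier A" using wJ ideal.Icarr[OF J_ideal] by blast
    have "w \<oplus>\<^bsub>A\<^esub> z = t"
    proof (rule HOL.ext)
      fix f
      show "(w \<oplus>\<^bsub>A\<^esub> z) f = t f"
      proof (cases "f \<in> H0 n")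
        case True
        have "cmb k f \<in> H0 n" using T_H0[OF cT True] .
        then have wf: "w f = (\<lambda>e. a * cmb k f e)" unfolding w_def using True by (simp add: R_mult[OF n0])
        have "a * (\<Sum>b\<in>B. k b * \<tau> b f e) + (\<Sum>b\<in>B. (c b mod \<bar>a\<bar>) * \<tau> b f e) = (\<Sum>b\<in>B. c b * \<tau> b f e)" for e
          unfolding sum_distrib_left sum.distrib[symmetric]
          by (rule sum.cong[OF refl]) (metis ck distrib_right mult.assoc)
        then show ?thesis using True wf by (simp add: R_add[OF n0] c z_def cmb_def cong: sum.cong)
      qed (simp add: End_H0_def c cmb_def)
    qed
    then have "t \<ominus>\<^bsub>A\<^esub> z = (w \<oplus>\<^bsub>A\<^esub> z) \<oplus>\<^bsub>A\<^esub> (\<ominus>\<^bsub>A\<^esub> z)" by (simp only: A.minus_eq)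
    moreover have "z \<in> carrier A" using cT by (simp add: z_def)
    then have "(w \<oplus>\<^bsub>A\<^esub> z) \<oplus>\<^bsub>A\<^esub> (\<ominus>\<^bsub>A\<^esub> z) = w"
      using wT A.a_assoc A.r_neg A.r_zero A.a_inv_closed by metis
    ultimately have "t \<ominus>\<^bsub>A\<^esub> z = w" by (simp only:)
    then show "\<exists>z\<in>Z. t \<ominus>\<^bsub>A\<^esub> z \<in> J" using wJ zZ by auto
  qed
qed

text \<open>Induction over the generated ring, starting from \<open>hecke_op_commute\<close>. It
  makes the set \<open>W\<close> in \<open>prime_dvd_quotient\<close> stable under
  \<open>T\<close>.\<close>

lemma cgen_comm:
  assumes q: "monic q" "prime_elem q" "\<not> q dvd n" and t: "t \<in> T"
  shows "t \<otimes>\<^bsub>E\<^esub> cgen n q = cgen n q \<otimes>\<^bsub>E\<^esub> t"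
proof -
  interpret E: ring E by (rule R_ring[OF n0])
  let ?c = "cgen n q"
  have c: "?c \<in> carrier E" by (rule cgen_carrier[OF n0 q(1)])
  have sub: "x \<in> carrier E" if "x \<in> T" for x using T_carrier that .
  show ?thesis using t
  proof (induction t rule: generate_ring.induct)
    case one
    then show ?case using c by simp
  next
    case (incl h)
    then obtain m where m: "h = hecke n m" "monic m" using S_sub by blast
    have h: "h \<in> carrier E" using m hecke_carrier[OF n0] by simp
    show ?case
    proof (rule R_ext[OF n0 E.m_closed[OF h c] E.m_closed[OF c h]])
      fix f assume f: "f \<in> H0 n"
      have Tq: "hecke_op n q f \<in> H0 n" "hecke_op n m f \<in> H0 n" using hecke_op_H0[OF f _ n0] q m by auto
      have ha: "h g = hecke_op n m g" if "g \<in> H0 n" for g using that by (simp add: m hecke_eq_hecke_op)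
      let ?k = "int (ideal_norm q) + 1"
      have "?c f = (\<lambda>e. hecke_op n q f e + (- ?k) * f e)" unfolding cgen_app[OF n0 q(1) f]
        by (rule HOL.ext) (simp add: algebra_simps)
      then have "h (?c f) = (\<lambda>e. h (hecke_op n q f) e + h (\<lambda>e. (- ?k) * f e) e)"
        using R_additive[OF n0 h Tq(1) H0_scale[OF n0 f, of "- ?k"]] by simp
      also have "\<dots> = (\<lambda>e. hecke_op n m (hecke_op n q f) e + (- ?k) * hecke_op n m f e)"
        unfolding R_linear[OF n0 h f] ha[OF Tq(1)] ha[OF f] ..
      also have "\<dots> = ?c (h f)"
        unfolding ha[OF f] cgen_app[OF n0 q(1) Tq(2)] hecke_op_commute[OF f n0 m(2) q] by (simp add: algebra_simps)
      finally show "(h \<otimes>\<^bsub>E\<^esub> ?c) f = (?c \<otimes>\<^bsub>E\<^esub> h) f" using f by (simp add: R_mult[OF n0])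
    qed
  next
    case (a_inv h)
    then show ?case using c sub[OF a_inv(1)] by (simp add: E.l_minus E.r_minus)
  next
    case (eng_add h1 h2)
    then show ?case using c sub[OF eng_add(1)] sub[OF eng_add(2)] by (simp add: E.l_distr E.r_distr)
  next
    case (eng_mult h1 h2)
    then show ?case using c sub[OF eng_mult(1)] sub[OF eng_mult(2)] by (metis E.m_assoc)
  qed
qed

lemma T_divisible:
  assumes t: "t \<in> T" and u: "u \<in> H0 n" and k: "k \<noteq> 0" "\<And>e. (k::int) dvd u e"
  shows "k dvd t u e"
proof -
  have v: "(\<lambda>e. u e div k) \<in> H0 n" by (rule H0_divide[OF n0 u k])
  have "u = (\<lambda>e. k * (u e div k))" using k by simp
  then have "t u = (\<lambda>e. k * t (\<lambda>e. u e div k) e)" using R_linear[OF n0 T_carrier[OF t] v, of k] by metis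
  then show ?thesis by simp
qed

text \<open>Let \<open>W\<close> be the cochains sent to multiples of \<open>p\<close> by all
  generators of the ideal. \<open>T\<close> preserves \<open>W\<close>, so the operators that vanish
  on \<open>W\<close> modulo \<open>p\<close> form an ideal \<open>J'\<close>, which contains the
  Eisenstein ideal. The order of the quotient, as an operator, lies in \<open>J'\<close>; evaluate
  it on \<open>f\<close> at \<open>e0\<close>.\<close>

lemma prime_dvd_quotient:
  fixes p :: nat
  assumes p: "prime p" and f: "f \<in> H0 n" and e0: "\<not> int p dvd f e0"
    and eig: "\<And>q e. monic q \<Longrightarrow> prime_elem q \<Longrightarrow> \<not> q dvd n \<Longrightarrow> int p dvd cgen n q f e"
  shows "p dvd card (carrier (A Quot J))"
proof -
  interpret A: ring A by (rule A_ring)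
  have p0: "int p \<noteq> 0" using p by (simp add: prime_gt_0_nat)
  define W where "W = {g \<in> H0 n. \<forall>q e. monic q \<longrightarrow> prime_elem q \<longrightarrow> \<not> q dvd n \<longrightarrow> int p dvd cgen n q g e}"
  have fW: "f \<in> W" using f eig by (simp add: W_def)
  have stab: "t g \<in> W" if t: "t \<in> T" and g: "g \<in> W" for t g
  proof -
    have gH: "g \<in> H0 n" using g by (simp add: W_def)
    have "int p dvd cgen n q (t g) e" if q: "monic q" "prime_elem q" "\<not> q dvd n" for q e
    proof -
      have "cgen n q (t g) = t (cgen n q g)"
        using fun_cong[OF cgen_comm[OF q t], of g] gH by (simp add: R_mult[OF n0])
      moreover have "cgen n q g \<in> H0 n" using T_H0[OF cgen_T[OF q] gH] .
      moreover have "int p dvd cgen n q g e" for e using g q by (simp add: W_def)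
      ultimately show ?thesis using T_divisible[OF t _ p0] by simp
    qed
    then show ?thesis using T_H0[OF t gH] by (simp add: W_def)
  qed
  define J' where "J' = {t \<in> T. \<forall>g\<in>W. \<forall>e. int p dvd t g e}"
  have WH: "g \<in> H0 n" if "g \<in> W" for g using that by (simp add: W_def)
  have "ideal J' A"
  proof (rule idealI[OF A_ring])
    show "subgroup J' (add_monoid A)"
    proof (rule group.subgroupI[OF A.a_group])
      show "J' \<subseteq> carrier (add_monoid A)" by (auto simp: J'_def)
      have "\<zero>\<^bsub>E\<^esub> \<in> J'" using ring.zero_in_generate[OF R_ring[OF n0]] WH by (auto simp: J'_def R_zero[OF n0])
      then show "J' \<noteq> {}" by blast
      fix t assume t: "t \<in> J'"
      have tT: "t \<in> T" using t by (simp add: J'_def)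
      have "inv\<^bsub>add_monoid A\<^esub> t = \<ominus>\<^bsub>E\<^esub> t"
      proof -
        have nT: "\<ominus>\<^bsub>E\<^esub> t \<in> T" by (rule generate_ring.a_inv[OF tT])
        have "\<ominus>\<^bsub>E\<^esub> t \<oplus>\<^bsub>E\<^esub> t = \<zero>\<^bsub>E\<^esub>" using ring.ring_simprules(9)[OF R_ring[OF n0] T_carrier[OF tT]] .
        then have "\<ominus>\<^bsub>A\<^esub> t = \<ominus>\<^bsub>E\<^esub> t" using A.minus_equality[of "\<ominus>\<^bsub>E\<^esub> t" t] nT tT by simp
        then show ?thesis by (simp add: a_inv_def)
      qed
      then show "inv\<^bsub>add_monoid A\<^esub> t \<in> J'" using t generate_ring.a_inv[OF tT] WH
        by (simp add: J'_def R_neg_app[OF n0 T_carrier[OF tT]])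
      fix s assume "s \<in> J'"
      then show "t \<otimes>\<^bsub>add_monoid A\<^esub> s \<in> J'" using t WH
        by (simp add: J'_def generate_ring.eng_add R_add[OF n0])
    qed
    fix t x assume t: "t \<in> J'" and x: "x \<in> carrier A"
    have tT: "t \<in> T" "x \<in> T" using t x by (simp_all add: J'_def)
    have "int p dvd x (t g) e" if g: "g \<in> W" for g e
      using T_divisible[OF tT(2) T_H0[OF tT(1) WH[OF g]] p0] t g by (simp add: J'_def)
    then show "x \<otimes>\<^bsub>A\<^esub> t \<in> J'" using tT WH by (simp add: J'_def generate_ring.eng_mult R_mult[OF n0])
    show "t \<otimes>\<^bsub>A\<^esub> x \<in> J'" using t tT WH stab by (simp add: J'_def generate_ring.eng_mult R_mult[OF n0])
  qed
  moreover have "eisenstein_gens n \<subseteq> J'"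
    unfolding eisenstein_gens_eq[OF n0] J'_def using cgen_T by (auto simp: W_def)
  ultimately have JJ: "J \<subseteq> J'" by (rule A.genideal_minimal)
  let ?N = "card (carrier (A Quot J))"
  have "\<one>\<^bsub>E\<^esub> \<in> carrier A" by (simp add: generate_ring.one)
  then have "add_pow A ?N \<one>\<^bsub>E\<^esub> \<in> J" by (rule card_quot_in_ideal[OF J_ideal])
  then have "add_pow E ?N \<one>\<^bsub>E\<^esub> \<in> J'" using JJ A_pow by auto
  then have "int p dvd add_pow E ?N \<one>\<^bsub>E\<^esub> f e0" using fW by (simp add: J'_def)
  then have "int p dvd int ?N * f e0" using add_pow_one[OF n0, of ?N] f by simp
  moreover have "prime (int p)" using p by simp
  ultimately have "int p dvd int ?N" using e0 prime_dvd_mult_iff by blast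
  then show ?thesis by simp
qed

end

section \<open>The Eisenstein potential and its Hecke congruence modulo the characteristic\<close>

section \<open>An Eisenstein cochain\<close>

definition Q :: "'a::{field,finite} itself \<Rightarrow> int" where
  "Q _ = int CARD('a)"

text \<open>
  The power of \<open>Q\<close> is chosen such that the Laplacian of \<open>eis_pot\<close> is constant. The constant disappears in the
  difference \<open>eis_dif\<close>, which is therefore harmonic as a function on vertices.
\<close>

definition eis_pot :: "'a::{field,finite} fls^2^2 \<Rightarrow> int" where
  "eis_pot g = Q TYPE('a) ^ (nat (ht g) + 1) - (Q TYPE('a) ^ 2 - 1) * amax g"

lemma sum_option_if:
  fixes X Y :: int
  shows "(\<Sum>i\<in>(UNIV :: 'a::{field,finite} option set). if i = j then X else Y) = X + Q TYPE('a) * Y"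
proof -
  have "(\<Sum>i\<in>(UNIV :: 'a option set). if i = j then X else Y) = X + (\<Sum>i\<in>UNIV - {j}. Y)"
    by (subst sum.remove[of _ j]) (auto intro!: sum.cong)
  moreover have "card (UNIV - {j}) = CARD('a)" by (simp add: card_Diff_singleton)
  ultimately show ?thesis by (simp add: Q_def)
qed

text \<open>Origin of the factor \<open>Q ^ 2 - 1\<close>: at positive height the power of
  \<open>Q\<close> is harmonic, while \<open>amax\<close> drops by one at \<open>Q\<close> of the
  neighbours and has defect \<open>- Q\<close>. At height 0 all neighbours have height 1 and the
  same \<open>amax\<close>, so the power alone has a defect, namely \<open>Q * (Q ^ 2 - 1)\<close>.
  The factor makes both defects equal.\<close>

lemma eis_pot_harmonic:
  fixes g :: "'a::{field,finite} fls^2^2"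
  assumes g: "det g \<noteq> 0"
  shows "(\<Sum>i\<in>UNIV. eis_pot (g ** nb i)) = (Q TYPE('a) + 1) * eis_pot g + Q TYPE('a) * (Q TYPE('a) ^ 2 - 1)"
proof (cases "ht g > 0")
  case True
  obtain j where j: "\<And>i. amax (g ** nb i) = amax g - (if i = j then 0 else 1)" using amax_nb_pos[OF g True] by blast
  obtain k where k: "ht g = int k + 1" using True by (metis add.commute zero_less_imp_eq_int int_ops(4) Suc_pred of_nat_Suc plus_1_eq_Suc)
  define q where "q = Q TYPE('a)"
  have h: "ht (g ** nb i) = (if i = j then int k + 2 else int k)" for i using ht_nb[OF g, of i] j[of i] k by simp
  have "eis_pot (g ** nb i) = (if i = j then q ^ (k + 3) - (q ^ 2 - 1) * amax g else q ^ (k + 1) - (q ^ 2 - 1) * (amax g - 1))" for i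
  proof -
    have "nat (int k + 2) = k + 2" by simp
    then show ?thesis unfolding eis_pot_def h j q_def[symmetric] by (simp add: power_add eval_nat_numeral)
  qed
  then have S: "(\<Sum>i\<in>UNIV. eis_pot (g ** nb i)) = q ^ (k + 3) - (q ^ 2 - 1) * amax g + q * (q ^ (k + 1) - (q ^ 2 - 1) * (amax g - 1))"
    unfolding q_def by (simp add: sum_option_if)
  have U: "eis_pot g = q ^ (k + 2) - (q ^ 2 - 1) * amax g"
  proof -
    have "nat (int k + 1) = k + 1" by simp
    then show ?thesis unfolding eis_pot_def k q_def[symmetric] by simp
  qed
  show ?thesis unfolding S U q_def[symmetric] by (simp add: algebra_simps power_add eval_nat_numeral)
next
  case False
  then have 0: "ht g = 0" using ht_nonneg[OF g] by simp
  have a: "amax (g ** nb i) = amax g" for i by (rule amax_nb_zero[OF g 0])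
  have "ht (g ** nb i) = 1" for i using ht_nb[OF g, of i] a 0 by simp
  then have u: "eis_pot (g ** nb i) = Q TYPE('a) ^ 2 - (Q TYPE('a) ^ 2 - 1) * amax g" for i
    by (simp add: eis_pot_def a eval_nat_numeral)
  have c: "int (card (UNIV :: 'a option set)) = Q TYPE('a) + 1" by (simp add: Q_def)
  have S: "(\<Sum>i\<in>UNIV. eis_pot (g ** nb i)) = (Q TYPE('a) + 1) * (Q TYPE('a) ^ 2 - (Q TYPE('a) ^ 2 - 1) * amax g)"
    unfolding u sum_constant c[symmetric] by simp
  have U: "eis_pot g = Q TYPE('a) - (Q TYPE('a) ^ 2 - 1) * amax g" by (simp add: eis_pot_def 0)
  show ?thesis unfolding S U by (simp add: algebra_simps eval_nat_numeral)
qed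

lemma eis_pot_scale:
  fixes g :: "'a::{field,finite} fls^2^2"
  assumes "det g \<noteq> 0" "c \<noteq> 0" "k \<in> GLO"
  shows "eis_pot (mat c ** g ** k) = eis_pot g + (Q TYPE('a) ^ 2 - 1) * fls_subdegree c"
proof -
  have "ht (mat c ** g ** k) = ht g" using ht_vinv assms unfolding vinv_def by blast
  then show ?thesis using assms by (simp add: eis_pot_def amax_scale algebra_simps)
qed

lemma eis_pot_em: "det g \<noteq> 0 \<Longrightarrow> \<gamma> \<in> GL2A \<Longrightarrow> eis_pot (em \<gamma> ** g) = eis_pot g"
  by (simp add: eis_pot_def ht_em amax_em)

lemma eis_pot_mod: "Q TYPE('a) dvd eis_pot (g :: 'a::{field,finite} fls^2^2) - amax g"
proof -
  have "eis_pot g - amax g = Q TYPE('a) * (Q TYPE('a) ^ nat (ht g) - Q TYPE('a) * amax g)"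
    by (simp add: eis_pot_def algebra_simps power2_eq_square)
  then show ?thesis by simp
qed

definition eis_dif :: "'a::{field,finite} poly \<Rightarrow> 'a fls^2^2 \<Rightarrow> int" where
  "eis_dif y g = eis_pot g - eis_pot (em (M2 y 0 0 1) ** g)"

lemma eis_dif_vinv: "y \<noteq> 0 \<Longrightarrow> vinv (eis_dif y)"
  unfolding vinv_def
proof (intro allI impI)
  fix g :: "'a fls^2^2" and c :: "'a fls" and k :: "'a fls^2^2"
  assume a: "y \<noteq> 0" "det g \<noteq> 0" "c \<noteq> 0" "k \<in> GLO"
  have "em (M2 y 0 0 1) ** (mat c ** g ** k) = mat c ** (em (M2 y 0 0 1) ** g) ** k"
    by (simp add: matrix_mul_assoc[symmetric] mat_left_comm2)
  then show "eis_dif y (mat c ** g ** k) = eis_dif y g" using a by (simp add: eis_dif_def eis_pot_scale det_mul)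
qed

lemma eis_dif_harmonic:
  fixes g :: "'a::{field,finite} fls^2^2"
  assumes y: "y \<noteq> 0" and g: "det g \<noteq> 0"
  shows "(\<Sum>i\<in>UNIV. eis_dif y (g ** nb i)) = (Q TYPE('a) + 1) * eis_dif y g"
proof -
  have "det (em (M2 y 0 0 1) ** g) \<noteq> 0" using y g by (simp add: det_mul)
  then show ?thesis using eis_pot_harmonic[OF g] eis_pot_harmonic[of "em (M2 y 0 0 1) ** g"]
    by (simp add: eis_dif_def sum_subtractf matrix_mul_assoc algebra_simps)
qed

text \<open>Conjugation by \<open>diag(y, 1)\<close> carries \<open>Gamma0 y\<close> into
  \<open>GL2A\<close>.\<close>

lemma eis_dif_Gamma0:
  assumes y: "y \<noteq> 0" and g: "det g \<noteq> 0" and \<gamma>: "\<gamma> \<in> Gamma0 y"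
  shows "eis_dif y (em \<gamma> ** g) = eis_dif y g"
proof -
  obtain a b c d where m: "\<gamma> = M2 a b (y * c) d"
    using \<gamma> M2_eta[of \<gamma>] by (metis (mono_tags, lifting) Gamma0_def dvdE mem_Collect_eq)
  define \<delta> where "\<delta> = M2 a (y * b) c d"
  have "M2 y 0 0 1 ** \<gamma> = \<delta> ** M2 y 0 0 1" by (simp add: m \<delta>_def M2_mult mult.commute)
  then have eq: "em (M2 y 0 0 1) ** (em \<gamma> ** g) = em \<delta> ** (em (M2 y 0 0 1) ** g)"
    by (simp add: matrix_mul_assoc em_mult[symmetric])
  have \<delta>: "\<delta> \<in> GL2A" using \<gamma> by (simp add: Gamma0_def GL2A_def m \<delta>_def algebra_simps)
  have "det (em (M2 y 0 0 1) ** g) \<noteq> 0" using y g by (simp add: det_mul)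
  then show ?thesis using g Gamma0_GL2A[OF \<gamma>] \<delta> by (simp add: eis_dif_def eq eis_pot_em)
qed

lemma eis_dif_mod: "Q TYPE('a) dvd eis_dif y (g :: 'a::{field,finite} fls^2^2) - (amax g - amax (em (M2 y 0 0 1) ** g))"
proof -
  have "eis_dif y g - (amax g - amax (em (M2 y 0 0 1) ** g)) =
      (eis_pot g - amax g) - (eis_pot (em (M2 y 0 0 1) ** g) - amax (em (M2 y 0 0 1) ** g))"
    by (simp add: eis_dif_def)
  then show ?thesis using eis_pot_mod dvd_diff by metis
qed

section \<open>Counting lattice points modulo the characteristic\<close>

text \<open>Unless \<open>V\<close> is trivial, a coefficient functional \<open>l\<close> that is
  nonzero at some \<open>x\<close> splits \<open>V\<close> into the line through \<open>x\<close>
  and the kernel of \<open>l\<close>.\<close>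

lemma card_subspace:
  fixes V :: "('a::{field,finite} poly^2) set"
  assumes fin: "finite V" and 0: "0 \<in> V" and add: "\<And>x y. x \<in> V \<Longrightarrow> y \<in> V \<Longrightarrow> x + y \<in> V"
    and sc: "\<And>c x. x \<in> V \<Longrightarrow> [:c:] *s x \<in> V"
  shows "Q TYPE('a) dvd int (card V) - of_bool (V = {0})"
proof (cases "V = {0}")
  case False
  then obtain x where x: "x \<in> V" "x \<noteq> 0" using 0 by blast
  then obtain i where "x $ i \<noteq> 0" by (auto simp: vec_eq_iff)
  define n where "n = degree (x $ i)"
  define l where "l v = coeff (v $ i) n" for v :: "'a poly^2"
  have lx: "l x \<noteq> 0" using \<open>x $ i \<noteq> 0\<close> by (simp add: l_def n_def)
  have ll: "l (v + w) = l v + l w" "l ([:c:] *s v) = c * l v" for v w c by (simp_all add: l_def)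
  have sc': "[:c:] *s x + v \<in> V" if "v \<in> V" for c v using add sc x that by blast
  have cl: "[:c:] *s v + [:d:] *s v = [:c + d:] *s v" for c d and v :: "'a poly^2"
    by (simp add: vec2_eq_iff smult_add_left)
  have "bij_betw (\<lambda>(c, v). [:c:] *s x + v) (UNIV \<times> {v \<in> V. l v = 0}) V"
  proof (rule bij_betw_byWitness[where f' = "\<lambda>v. (l v / l x, [:- (l v / l x):] *s x + v)"])
    show "\<forall>a\<in>UNIV \<times> {v \<in> V. l v = 0}. (l (case a of (c, v) \<Rightarrow> [:c:] *s x + v) / l x,
        [:- (l (case a of (c, v) \<Rightarrow> [:c:] *s x + v) / l x):] *s x + (case a of (c, v) \<Rightarrow> [:c:] *s x + v)) = a"
      using lx by (auto simp: ll add.assoc[symmetric] cl)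
    show "\<forall>a'\<in>V. (case (l a' / l x, [:- (l a' / l x):] *s x + a') of (c, v) \<Rightarrow> [:c:] *s x + v) = a'"
      by (auto simp: add.assoc[symmetric] cl)
    show "(\<lambda>(c, v). [:c:] *s x + v) ` (UNIV \<times> {v \<in> V. l v = 0}) \<subseteq> V" using sc' by auto
    show "(\<lambda>v. (l v / l x, [:- (l v / l x):] *s x + v)) ` V \<subseteq> UNIV \<times> {v \<in> V. l v = 0}"
      using sc' lx by (auto simp: ll)
  qed
  then have "card ((UNIV :: 'a set) \<times> {v \<in> V. l v = 0}) = card V" by (rule bij_betw_same_card)
  then have "card V = CARD('a) * card {v \<in> V. l v = 0}" by (simp add: card_cartesian_product)
  then show ?thesis using False by (simp add: Q_def)
qed simp

lemma ev_0 [simp]: "ev 0 = 0"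
  by simp

definition Vj :: "'a::{field,finite} fls^2^2 \<Rightarrow> int \<Rightarrow> ('a poly^2) set" where
  "Vj g j = {x. oge2 j (inv2 g *v ev x)}"

lemma Vj_iff: "det g \<noteq> 0 \<Longrightarrow> x \<in> Vj g j \<longleftrightarrow> x = 0 \<or> j \<le> nu g (ev x)"
  by (cases "x = 0") (simp_all add: Vj_def nu_def oge2_ord2)

lemma finite_Vj: "det g \<noteq> 0 \<Longrightarrow> finite (Vj g j)"
proof -
  assume g: "det g \<noteq> 0"
  have "Vj g j = {x. x = 0 \<or> j \<le> nu g (ev x)}" using Vj_iff[OF g] by blast
  then show ?thesis using finite_nu_ge[OF g] by simp
qed

lemma Vj_closed:
  assumes "det g \<noteq> 0"
  shows "0 \<in> Vj g j" "x \<in> Vj g j \<Longrightarrow> y \<in> Vj g j \<Longrightarrow> x + y \<in> Vj g j" "x \<in> Vj g j \<Longrightarrow> [:c:] *s x \<in> Vj g j"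
proof -
  have 0: "ev (0 :: 'a poly^2) = 0" by simp
  show "0 \<in> Vj g j" unfolding Vj_def by (simp only: 0 matrix_vector_mult_0_right oge2_zero mem_Collect_eq)
  show "x + y \<in> Vj g j" if "x \<in> Vj g j" "y \<in> Vj g j"
    using that by (simp add: Vj_def ev_add matrix_vector_right_distrib oge2_def oge_add)
  show "[:c:] *s x \<in> Vj g j" if "x \<in> Vj g j"
    using that by (simp add: Vj_def ev_smult pf_const mulv_scale2 oge2_def oge_mult0)
qed

text \<open>The sublattice that \<open>M\<close> maps onto the multiples of \<open>det M\<close>.
  Through it, orders for \<open>em M ** g\<close> become orders for \<open>g\<close> itself.\<close>

definition adjlat :: "'a::{field,finite} poly^2^2 \<Rightarrow> ('a poly^2) set" where
  "adjlat M = range (\<lambda>z. adj2 M *v z)"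

lemma nu_adj:
  assumes M: "det M = q" "q \<noteq> 0" and g: "det g \<noteq> 0" and x: "x \<noteq> 0"
  shows "nu (em M ** g) (ev x) = nu g (ev (adj2 M *v x)) + int (degree q)" "adj2 M *v x \<noteq> 0"
proof -
  let ?q = "poly_to_fls q"
  have dM: "det (em M) \<noteq> 0" using M by simp
  have "M *v (adj2 M *v x) = q *s x" by (simp add: matrix_vector_mul_assoc adj2_right M mat_mulv2)
  moreover have "q *s x \<noteq> 0" using x M by (simp add: vec2_eq_iff)
  ultimately show nz: "adj2 M *v x \<noteq> 0" by auto
  have "ev (q *s x) = em M *v ev (adj2 M *v x)" by (simp add: em_mulv[symmetric] matrix_vector_mul_assoc adj2_right M mat_mulv2)
  then have "nu (em M ** g) (?q *s ev x) = nu g (ev (adj2 M *v x))" using nu_mult'[OF g dM] by (simp add: ev_smult)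
  moreover have "nu (em M ** g) (?q *s ev x) = nu (em M ** g) (ev x) + fls_subdegree ?q"
    using M x g dM by (intro nu_scalar) (simp_all add: det_mul)
  ultimately show "nu (em M ** g) (ev x) = nu g (ev (adj2 M *v x)) + int (degree q)" by (simp add: pf_subdegree)
qed

text \<open>By \<open>nu_adj\<close>, \<open>amax (em M ** g) - degree q\<close> is the maximal
  order for \<open>g\<close> of a nonzero vector in \<open>adjlat M\<close>. The bounds hold because
  this sublattice contains \<open>q\<close> times every vector.\<close>

lemma amax_adj:
  assumes M: "det M = q" "q \<noteq> 0" and g: "det g \<noteq> 0"
  shows "Vj g j \<inter> adjlat M = {0} \<longleftrightarrow> amax (em M ** g) - int (degree q) < j"
    and "amax (em M ** g) \<le> amax g + int (degree q)" and "amax g \<le> amax (em M ** g)"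
proof -
  have d: "det (em M ** g) \<noteq> 0" using M g by (simp add: det_mul)
  obtain x where x: "x \<noteq> 0" "nu (em M ** g) (ev x) = amax (em M ** g)" using amax_attained[OF d] by blast
  note xx = nu_adj[OF M g x(1)]
  show "amax (em M ** g) \<le> amax g + int (degree q)" using xx x amax_ge[OF g xx(2)] by simp
  obtain z where z: "z \<noteq> 0" "nu g (ev z) = amax g" using amax_attained[OF g] by blast
  have "M *v z \<noteq> 0" using z M by (metis det_em em_mulv ev_eq_0 mulv_eq_0 pf_eq_0)
  then show "amax g \<le> amax (em M ** g)" using amax_ge[OF d, of "M *v z"] nu_em[of M g z] z M g by simp
  have 0: "0 \<in> Vj g j \<inter> adjlat M" using Vj_closed(1)[OF g] by (auto simp: adjlat_def intro: rev_image_eqI[of 0])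
  show "Vj g j \<inter> adjlat M = {0} \<longleftrightarrow> amax (em M ** g) - int (degree q) < j"
  proof
    assume e: "Vj g j \<inter> adjlat M = {0}"
    have "adj2 M *v x \<notin> Vj g j" using e xx(2) by (auto simp: adjlat_def)
    then show "amax (em M ** g) - int (degree q) < j" using xx x Vj_iff[OF g] by auto
  next
    assume l: "amax (em M ** g) - int (degree q) < j"
    have "w = 0" if w: "w \<in> Vj g j" "w \<in> adjlat M" for w
    proof (rule ccontr)
      assume w0: "w \<noteq> 0"
      obtain u where u: "w = adj2 M *v u" using w(2) by (auto simp: adjlat_def)
      have u0: "u \<noteq> 0" using w0 u by auto
      have "j \<le> nu g (ev w)" using w(1) w0 Vj_iff[OF g] by blast
      then show False using nu_adj(1)[OF M g u0] amax_ge[OF d u0] l u by simp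
    qed
    then show "Vj g j \<inter> adjlat M = {0}" using 0 by blast
  qed
qed

lemma adjlat_diag: "x \<in> adjlat (M2 q 0 0 1) \<longleftrightarrow> q dvd x $ 2"
proof
  assume "q dvd x $ 2"
  then obtain k where k: "x $ 2 = q * k" by (elim dvdE)
  then have "x = adj2 (M2 q 0 0 1) *v V2 (x $ 1) k" by (simp add: vec2_eq_iff adj2_def matvec2_nth)
  then show "x \<in> adjlat (M2 q 0 0 1)" unfolding adjlat_def by blast
qed (auto simp: adjlat_def adj2_def matvec2_nth)

lemma adjlat_unip: "x \<in> adjlat (M2 1 b 0 q) \<longleftrightarrow> q dvd x $ 1 + b * x $ 2"
proof
  assume "q dvd x $ 1 + b * x $ 2"
  then obtain k where k: "x $ 1 + b * x $ 2 = q * k" by (elim dvdE)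
  then have "x = adj2 (M2 1 b 0 q) *v V2 k (x $ 2)"
    by (simp add: vec2_eq_iff adj2_def matvec2_nth) (metis add_diff_cancel_right')
  then show "x \<in> adjlat (M2 1 b 0 q)" unfolding adjlat_def by blast
qed (auto simp: adjlat_def adj2_def matvec2_nth)

lemma adjlat_closed: "x \<in> adjlat M \<Longrightarrow> y \<in> adjlat M \<Longrightarrow> x + y \<in> adjlat M" "x \<in> adjlat M \<Longrightarrow> c *s x \<in> adjlat M"
  unfolding adjlat_def by (auto simp: matrix_vector_right_distrib[symmetric] mulv_scale2[symmetric])

lemma linear_residue_unique:
  assumes q: "prime_elem q" "\<not> q dvd v"
  shows "\<exists>!b. b \<in> Res q \<and> q dvd u + b * v"
proof -
  have q0: "q \<noteq> 0" using q by auto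
  obtain s t where st: "s * v + t * q = 1" using cop_sym[OF prime_cop[OF q]] by (auto simp: cop_def)
  define b where "b = (- s * u) mod q"
  have "u + (- s * u) * v = u * (1 - s * v)" by (simp add: algebra_simps)
  also have "1 - s * v = t * q" using st by (simp add: algebra_simps)
  finally have 1: "q dvd u + (- s * u) * v" by simp
  have "u + b * v = u + (- s * u) * v - ((- s * u) div q) * q * v"
    unfolding b_def minus_div_mult_eq_mod[symmetric] by (simp add: algebra_simps)
  then have bq: "q dvd u + b * v" using 1 by (metis dvd_diff dvd_mult dvd_mult2 dvd_triv_right)
  show ?thesis
  proof (rule ex1I[of _ b])
    have bR: "b \<in> Res q" unfolding b_def by (rule mod_Res[OF q0])
    then show "b \<in> Res q \<and> q dvd u + b * v" using bq by blast
    fix c assume c: "c \<in> Res q \<and> q dvd u + c * v"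
    have "q dvd (u + c * v) - (u + b * v)" using c bq dvd_diff by blast
    then have "q dvd v * (c - b)" by (simp add: algebra_simps)
    then have "q dvd c - b" using q prime_elem_dvd_mult_iff by blast
    then show "c = b" using c bR Res_eqI by blast
  qed
qed

lemma card_Res_Q: "degree q > 0 \<Longrightarrow> Q TYPE('a) dvd int (card (Res (q :: 'a::{field,finite} poly)))"
  by (simp add: card_Res Q_def dvd_power)

lemma count_adjlat:
  fixes x :: "'a::{field,finite} poly^2"
  assumes q: "prime_elem q"
  shows "of_bool (x \<in> adjlat (M2 q 0 0 1)) + (\<Sum>b\<in>Res q. of_bool (x \<in> adjlat (M2 1 b 0 q)))
    = 1 + (if q dvd x $ 1 \<and> q dvd x $ 2 then int (card (Res q)) else 0)"
proof (cases "q dvd x $ 2")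
  case True
  then have "q dvd x $ 1 + b * x $ 2 \<longleftrightarrow> q dvd x $ 1" for b by (simp add: dvd_add_left_iff)
  then show ?thesis using True by (simp add: adjlat_diag adjlat_unip)
next
  case False
  obtain b where b: "b \<in> Res q" "q dvd x $ 1 + b * x $ 2" "\<And>c. c \<in> Res q \<Longrightarrow> q dvd x $ 1 + c * x $ 2 \<Longrightarrow> c = b"
    using linear_residue_unique[OF q False] by metis
  have "(\<Sum>c\<in>Res q. of_bool (q dvd x $ 1 + c * x $ 2)) = (\<Sum>c\<in>Res q. if c = b then 1 else (0::int))"
  proof (rule sum.cong[OF refl])
    fix c assume c: "c \<in> Res q"
    then have "q dvd x $ 1 + c * x $ 2 \<longleftrightarrow> c = b" using b by blast
    then show "of_bool (q dvd x $ 1 + c * x $ 2) = (if c = b then 1 else (0::int))" by simp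
  qed
  then show ?thesis using False b(1) by (simp add: adjlat_diag adjlat_unip)
qed

text \<open>
  Modulo \<open>Q\<close>, the number of lattice points in a finite subspace only tells whether the subspace is zero.
  Every vector lies in exactly one of the \<open>|q| + 1\<close> sublattices of index \<open>|q|\<close>, or in all of them; summing the counts of
  vectors of order at least \<open>j\<close> over all \<open>j\<close> gives the maxima.
\<close>

lemma hecke_amax:
  fixes q :: "'a::{field,finite} poly"
  assumes q: "prime_elem q" and g: "det g \<noteq> 0"
  shows "Q TYPE('a) dvd amax (em (M2 q 0 0 1) ** g) + (\<Sum>b\<in>Res q. amax (em (M2 1 b 0 q) ** g)) - amax g - int (degree q)"
proof -
  define I where "I = insert (M2 q 0 0 1) ((\<lambda>b. M2 1 b 0 q) ` Res q)"
  have q0: "q \<noteq> 0" using q by auto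
  have dq: "degree q > 0" using q by (rule prime_degree_pos)
  have "q \<noteq> 1" using q by auto
  have nin: "M2 q 0 0 1 \<notin> (\<lambda>b. M2 1 b 0 q) ` Res q" using \<open>q \<noteq> 1\<close> by (auto simp: M2_inject)
  have inj: "inj_on (\<lambda>b. M2 1 b 0 q) (Res q)" by (auto simp: inj_on_def M2_inject)
  have sumI: "(\<Sum>M\<in>I. F M) = F (M2 q 0 0 1) + (\<Sum>b\<in>Res q. F (M2 1 b 0 q))" for F :: "'a poly^2^2 \<Rightarrow> int"
    unfolding I_def using nin by (simp add: sum.reindex[OF inj])
  have detI: "det M = q" if "M \<in> I" for M using that by (auto simp: I_def)
  have finI: "finite I" by (simp add: I_def)
  let ?d = "int (degree q)"
  let ?Q = "Q TYPE('a)"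
  define aM where "aM M = amax (em M ** g) - ?d" for M
  have cj: "?Q dvd of_bool (Vj g j = {0}) - (\<Sum>M\<in>I. of_bool (aM M < j))" for j
  proof -
    have c1: "?Q dvd int (card (Vj g j)) - of_bool (Vj g j = {0})"
      using Vj_closed[OF g] by (intro card_subspace finite_Vj[OF g]) auto
    have c2: "?Q dvd int (card (Vj g j \<inter> adjlat M)) - of_bool (aM M < j)" if "M \<in> I" for M
    proof -
      have 0: "0 \<in> adjlat M" by (auto simp: adjlat_def intro: rev_image_eqI[of 0])
      have "?Q dvd int (card (Vj g j \<inter> adjlat M)) - of_bool (Vj g j \<inter> adjlat M = {0})"
        using Vj_closed[OF g] adjlat_closed 0 by (intro card_subspace finite_Int disjI1 finite_Vj[OF g]) auto
      then show ?thesis using amax_adj(1)[OF detI[OF that] q0 g, of j] by (simp add: aM_def)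
    qed
    have "(\<Sum>M\<in>I. int (card (Vj g j \<inter> adjlat M))) = (\<Sum>M\<in>I. \<Sum>x\<in>Vj g j. of_bool (x \<in> adjlat M))"
      using finite_Vj[OF g] by (intro sum.cong refl) (simp add: of_bool_def sum.If_cases Int_def)
    also have "\<dots> = (\<Sum>x\<in>Vj g j. \<Sum>M\<in>I. of_bool (x \<in> adjlat M))" by (rule sum.swap)
    also have "\<dots> = (\<Sum>x\<in>Vj g j. 1 + (if q dvd x $ 1 \<and> q dvd x $ 2 then int (card (Res q)) else 0))"
      by (rule sum.cong[OF refl]) (simp only: sumI count_adjlat[OF q])
    also have "\<dots> = int (card (Vj g j)) + (\<Sum>x\<in>Vj g j. if q dvd x $ 1 \<and> q dvd x $ 2 then int (card (Res q)) else 0)"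
      by (simp add: sum.distrib)
    finally have 3: "(\<Sum>M\<in>I. int (card (Vj g j \<inter> adjlat M))) - int (card (Vj g j))
      = (\<Sum>x\<in>Vj g j. if q dvd x $ 1 \<and> q dvd x $ 2 then int (card (Res q)) else 0)" by simp
    have c3: "?Q dvd (\<Sum>M\<in>I. int (card (Vj g j \<inter> adjlat M))) - int (card (Vj g j))"
      unfolding 3 using card_Res_Q[OF dq] by (intro dvd_sum) simp
    have c4: "?Q dvd (\<Sum>M\<in>I. int (card (Vj g j \<inter> adjlat M)) - of_bool (aM M < j))"
      using c2 by (intro dvd_sum)
    have eq: "of_bool (Vj g j = {0}) - (\<Sum>M\<in>I. of_bool (aM M < j)) =
      (\<Sum>M\<in>I. int (card (Vj g j \<inter> adjlat M)) - of_bool (aM M < j))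
      - ((\<Sum>M\<in>I. int (card (Vj g j \<inter> adjlat M))) - int (card (Vj g j)))
      - (int (card (Vj g j)) - of_bool (Vj g j = {0}))" by (simp add: sum_subtractf)
    show ?thesis unfolding eq by (intro dvd_diff c1 c3 c4)
  qed
  \<comment> \<open>All \<open>aM M\<close> lie between the ends of this interval, so summing over
    it sees every jump; and within it \<open>Vj g j\<close> is nonzero, so the first term of
    \<open>cj\<close> vanishes.\<close>
  let ?J = "{amax g - ?d<..amax g}"
  have V0: "\<not> Vj g j = {0}" if "j \<in> ?J" for j
  proof -
    obtain x where "x \<noteq> 0" "nu g (ev x) = amax g" using amax_attained[OF g] by blast
    then have "x \<in> Vj g j" using that Vj_iff[OF g] by auto
    then show ?thesis using \<open>x \<noteq> 0\<close> by auto
  qed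
  have sJ: "(\<Sum>j\<in>?J. of_bool (aM M < j)) = amax g - aM M" if "M \<in> I" for M
  proof -
    have b: "aM M \<le> amax g" "amax g - ?d \<le> aM M" using amax_adj(2,3)[OF detI[OF that] q0 g] by (simp_all add: aM_def)
    have "{j \<in> ?J. aM M < j} = {aM M<..amax g}" using b by auto
    moreover have "(\<Sum>j\<in>?J. of_bool (aM M < j)) = int (card {j \<in> ?J. aM M < j})"
      by (simp add: of_bool_def sum.If_cases Int_def)
    ultimately show ?thesis using b by simp
  qed
  have "?Q dvd (\<Sum>j\<in>?J. of_bool (Vj g j = {0}) - (\<Sum>M\<in>I. of_bool (aM M < j)))"
    using cj by (intro dvd_sum)
  also have "(\<Sum>j\<in>?J. (of_bool (Vj g j = {0}) :: int) - (\<Sum>M\<in>I. of_bool (aM M < j))) = - (\<Sum>j\<in>?J. \<Sum>M\<in>I. of_bool (aM M < j))"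
  proof -
    have "(\<Sum>j\<in>?J. (of_bool (Vj g j = {0}) :: int) - (\<Sum>M\<in>I. of_bool (aM M < j))) = (\<Sum>j\<in>?J. - (\<Sum>M\<in>I. of_bool (aM M < j)))"
      by (rule sum.cong[OF refl]) (use V0 in simp)
    then show ?thesis by (simp only: sum_negf)
  qed
  also have "(\<Sum>j\<in>?J. \<Sum>M\<in>I. of_bool (aM M < j)) = (\<Sum>M\<in>I. amax g - aM M)"
    by (subst sum.swap) (simp only: sJ cong: sum.cong)
  finally have d1: "?Q dvd (\<Sum>M\<in>I. amax g - aM M)" by simp
  have cI: "int (card I) = int (card (Res q)) + 1" unfolding I_def using nin by (simp add: card_image[OF inj])
  have eq: "(\<Sum>M\<in>I. amax (em M ** g)) - amax g - ?d = int (card (Res q)) * (amax g + ?d) - (\<Sum>M\<in>I. amax g - aM M)"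
    by (simp add: aM_def sum_subtractf cI algebra_simps sum.distrib)
  have "?Q dvd int (card (Res q)) * (amax g + ?d)" using card_Res_Q[OF dq] by simp
  then have "?Q dvd (\<Sum>M\<in>I. amax (em M ** g)) - amax g - ?d" unfolding eq using d1 by (intro dvd_diff)
  then show ?thesis unfolding sumI .
qed

section \<open>The correcting flow and its values at the cusps\<close>

section \<open>Flows along geodesics\<close>

lemma nth_mult_low: "oge m x \<Longrightarrow> oge k y \<Longrightarrow> (x * y) $$ (m + k) = x $$ m * y $$ k"
proof -
  assume x: "oge m x" and y: "oge k y"
  have "oge 0 (fls_shift m x)" "oge 0 (fls_shift k y)" using x y by (simp_all add: oge_def)
  then have "(fls_shift m x * fls_shift k y) $$ 0 = fls_shift m x $$ 0 * fls_shift k y $$ 0" by (rule nth0_mult)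
  then show ?thesis by (simp add: fls_times_both_shifted_simp)
qed

text \<open>Leading coefficient vectors in different directions are linearly independent, so the
  leading terms of the determinant do not cancel.\<close>

lemma ldir_det:
  assumes u: "u \<noteq> 0" and w: "w \<noteq> 0" and ne: "ldir u \<noteq> ldir w"
  shows "fls_subdegree (u$1 * w$2 - u$2 * w$1) \<le> ord2 u + ord2 w"
proof -
  define a b c d where "a = (u$1) $$ ord2 u" and "b = (u$2) $$ ord2 u" and "c = (w$1) $$ ord2 w" and "d = (w$2) $$ ord2 w"
  have ou: "oge (ord2 u) (u$1)" "oge (ord2 u) (u$2)" using oge2_ord2[OF u, of "ord2 u"] by (simp_all add: oge2_def)
  have ow: "oge (ord2 w) (w$1)" "oge (ord2 w) (w$2)" using oge2_ord2[OF w, of "ord2 w"] by (simp_all add: oge2_def)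
  have ab: "a \<noteq> 0 \<or> b \<noteq> 0"
    using oge2_ord2[OF u, of "ord2 u + 1"] ou unfolding a_def b_def by (auto simp: oge2_def oge_Suc)
  have cd: "c \<noteq> 0 \<or> d \<noteq> 0"
    using oge2_ord2[OF w, of "ord2 w + 1"] ow unfolding c_def d_def by (auto simp: oge2_def oge_Suc)
  have n: "(u$1 * w$2 - u$2 * w$1) $$ (ord2 u + ord2 w) = a * d - b * c"
    using ou ow by (simp add: nth_mult_low a_def b_def c_def d_def)
  have l: "ldir u = (if b = 0 then None else Some (a / b))" "ldir w = (if d = 0 then None else Some (c / d))"
    unfolding ldir_def a_def b_def c_def d_def by simp_all
  have "a * d - b * c \<noteq> 0"
  proof
    assume "a * d - b * c = 0"
    then have e: "a * d = b * c" by simp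
    show False
    proof (cases "b = 0")
      case True
      then have "d = 0" using e ab by auto
      then show False using True ne l by simp
    next
      case False
      then have "d \<noteq> 0" using e cd by auto
      then have "a / b = c / d" using e False by (simp add: field_simps)
      then show False using False \<open>d \<noteq> 0\<close> ne l by simp
    qed
  qed
  then show ?thesis using n by (intro fls_subdegree_leI) simp
qed

text \<open>This function has slope one along the geodesic from \<open>\<sigma> 0\<close> to \<open>\<sigma> \<infinity>\<close> and is constant on the branches off it.\<close>

definition geo :: "'a::{field,finite} poly^2^2 \<Rightarrow> 'a fls^2^2 \<Rightarrow> int" where
  "geo \<sigma> g = nu g (ev (\<sigma> *v V2 1 0)) - nu g (ev (\<sigma> *v V2 0 1))"

lemma e12_nz: "V2 1 0 \<noteq> (0::'a::{field,finite} poly^2)" "V2 0 1 \<noteq> (0::'a poly^2)"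
  by (simp_all add: vec2_eq_iff)

lemma cols_nz: "\<sigma> \<in> GL2A \<Longrightarrow> ev (\<sigma> *v V2 1 0) \<noteq> 0" "\<sigma> \<in> GL2A \<Longrightarrow> ev (\<sigma> *v V2 0 1) \<noteq> 0"
  using e12_nz by simp_all

lemma geo_vinv: "\<sigma> \<in> GL2A \<Longrightarrow> vinv (geo \<sigma>)"
  unfolding vinv_def geo_def by (simp add: nu_scale cols_nz del: ev_eq_0)

lemma geo_nb:
  assumes "det g \<noteq> 0" "\<sigma> \<in> GL2A"
  shows "geo \<sigma> (g ** nb i) - geo \<sigma> g = of_bool (i = ldir (inv2 g *v ev (\<sigma> *v V2 1 0))) - of_bool (i = ldir (inv2 g *v ev (\<sigma> *v V2 0 1)))"
  using assms unfolding geo_def by (simp add: nu_nb cols_nz del: ev_eq_0)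

lemma geo_harmonic:
  assumes "det g \<noteq> 0" "\<sigma> \<in> GL2A"
  shows "(\<Sum>i\<in>UNIV. geo \<sigma> (g ** nb i) - geo \<sigma> g) = 0"
proof -
  have "(\<Sum>i\<in>(UNIV :: 'a option set). of_bool (i = j)) = (1::int)" for j
    by (simp add: of_bool_def)
  then show ?thesis by (simp add: geo_nb[OF assms] sum_subtractf)
qed

lemma geo_em:
  assumes "\<gamma> \<in> GL2A" "det g \<noteq> 0"
  shows "geo (\<gamma> ** \<tau>) (em \<gamma> ** g) = geo \<tau> g"
  using assms by (simp add: geo_def nu_em matrix_vector_mul_assoc[symmetric])

text \<open>A jump at \<open>g\<close> means that the columns of \<open>\<sigma>\<close> point in
  different directions. By \<open>ldir_det\<close> the sum of their orders is at least
  \<open>- fls_subdegree (det g)\<close>, as \<open>det \<sigma>\<close> is a unit. Each order is at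
  most \<open>amax g\<close>, so both are bounded below.\<close>

lemma finite_geo:
  fixes g :: "'a::{field,finite} fls^2^2"
  assumes g: "det g \<noteq> 0"
  shows "finite {\<sigma> \<in> GL2A. \<exists>i. geo \<sigma> (g ** nb i) \<noteq> geo \<sigma> g}"
proof -
  define j where "j = - fls_subdegree (det g) - amax g"
  let ?F = "{x. x = 0 \<or> j \<le> nu g (ev x)}"
  have "{\<sigma> \<in> GL2A. \<exists>i. geo \<sigma> (g ** nb i) \<noteq> geo \<sigma> g} \<subseteq> (\<lambda>(x, y). M2 (x$1) (y$1) (x$2) (y$2)) ` (?F \<times> ?F)"
  proof
    fix \<sigma> assume "\<sigma> \<in> {\<sigma> \<in> GL2A. \<exists>i. geo \<sigma> (g ** nb i) \<noteq> geo \<sigma> g}"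
    then obtain i where \<sigma>: "\<sigma> \<in> GL2A" "geo \<sigma> (g ** nb i) \<noteq> geo \<sigma> g" by blast
    define x y where "x = \<sigma> *v V2 1 0" and "y = \<sigma> *v V2 0 1"
    have xy0: "x \<noteq> 0" "y \<noteq> 0" using \<sigma> e12_nz by (simp_all add: x_def y_def)
    define u w where "u = inv2 g *v ev x" and "w = inv2 g *v ev y"
    have uw0: "u \<noteq> 0" "w \<noteq> 0" using xy0 g by (simp_all add: u_def w_def)
    have "ldir u \<noteq> ldir w" using \<sigma>(2) geo_nb[OF g \<sigma>(1), of i] by (auto simp: u_def w_def x_def y_def)
    then have le: "fls_subdegree (u$1 * w$2 - u$2 * w$1) \<le> nu g (ev x) + nu g (ev y)"
      using ldir_det[OF uw0] by (simp add: nu_def u_def w_def)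
    have uX: "u = (inv2 g ** em \<sigma>) *v V2 1 0" "w = (inv2 g ** em \<sigma>) *v V2 0 1"
      unfolding u_def w_def x_def y_def by (simp_all add: em_mulv ev_V2 matrix_vector_mul_assoc)
    have "u$1 * w$2 - u$2 * w$1 = det (inv2 g ** em \<sigma>)"
      unfolding uX by (simp add: det_2 matvec2_nth)
    then have "u$1 * w$2 - u$2 * w$1 = inverse (det g) * poly_to_fls (det \<sigma>)"
      using g by (simp add: det_mul det_inv2 divide_inverse)
    then have "fls_subdegree (u$1 * w$2 - u$2 * w$1) = - fls_subdegree (det g)"
      using g \<sigma>(1) by simp
    then have "x \<in> ?F" "y \<in> ?F" using le amax_ge[OF g xy0(1)] amax_ge[OF g xy0(2)] by (auto simp: j_def)
    moreover have "\<sigma> = M2 (x$1) (y$1) (x$2) (y$2)" by (simp add: x_def y_def mat2_eq_iff matvec2_nth)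
    ultimately show "\<sigma> \<in> (\<lambda>(x, y). M2 (x$1) (y$1) (x$2) (y$2)) ` (?F \<times> ?F)"
      by (intro image_eqI[of _ _ "(x, y)"]) auto
  qed
  then show ?thesis by (rule finite_subset) (intro finite_imageI finite_cartesian_product finite_nu_ge g)
qed

text \<open>The weighted number of geodesics through the edge, with orientation. Only nonzero jumps
  are summed, which are finitely many on an edge by \<open>finite_geo\<close>; a sum over an
  infinite set would read \<open>0\<close>.\<close>

definition gflow :: "('a::{field,finite} poly^2^2) set \<Rightarrow> ('a poly^2^2 \<Rightarrow> int) \<Rightarrow> 'a vertex \<Rightarrow> 'a vertex \<Rightarrow> int" where
  "gflow X W v w = (\<Sum>\<sigma> | \<sigma> \<in> X \<and> vfun (geo \<sigma>) w \<noteq> vfun (geo \<sigma>) v. W \<sigma> * (vfun (geo \<sigma>) w - vfun (geo \<sigma>) v))"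

lemma gflow_antisym: "gflow X W w v = - gflow X W v w"
proof -
  have "{\<sigma>. \<sigma> \<in> X \<and> vfun (geo \<sigma>) v \<noteq> vfun (geo \<sigma>) w} = {\<sigma>. \<sigma> \<in> X \<and> vfun (geo \<sigma>) w \<noteq> vfun (geo \<sigma>) v}" by auto
  then show ?thesis unfolding gflow_def by (simp add: sum_negf[symmetric] algebra_simps)
qed

lemma gflow_vtx:
  assumes X: "X \<subseteq> GL2A" and g: "det g \<noteq> 0" "det h \<noteq> 0"
  shows "gflow X W (vtx g) (vtx h) = (\<Sum>\<sigma> | \<sigma> \<in> X \<and> geo \<sigma> h \<noteq> geo \<sigma> g. W \<sigma> * (geo \<sigma> h - geo \<sigma> g))"
proof -
  have "vfun (geo \<sigma>) (vtx g) = geo \<sigma> g" "vfun (geo \<sigma>) (vtx h) = geo \<sigma> h" if "\<sigma> \<in> X" for \<sigma>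
    using that X geo_vinv g vfun_vtx by blast+
  then show ?thesis unfolding gflow_def by (intro sum.cong) auto
qed

lemma gflow_harmonic:
  assumes X: "X \<subseteq> GL2A" and g: "det g \<noteq> 0"
  shows "(\<Sum>i\<in>UNIV. gflow X W (vtx g) (vtx (g ** nb i))) = 0"
proof -
  define F where "F = {\<sigma> \<in> X. \<exists>i. geo \<sigma> (g ** nb i) \<noteq> geo \<sigma> g}"
  have "F \<subseteq> {\<sigma> \<in> GL2A. \<exists>i. geo \<sigma> (g ** nb i) \<noteq> geo \<sigma> g}" using X by (auto simp: F_def)
  then have F: "finite F" using finite_geo[OF g] finite_subset by blast
  have "gflow X W (vtx g) (vtx (g ** nb i)) = (\<Sum>\<sigma>\<in>F. W \<sigma> * (geo \<sigma> (g ** nb i) - geo \<sigma> g))" for i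
  proof -
    have "det (g ** nb i) \<noteq> 0" using g by (simp add: det_mul)
    then have "gflow X W (vtx g) (vtx (g ** nb i)) = (\<Sum>\<sigma> | \<sigma> \<in> X \<and> geo \<sigma> (g ** nb i) \<noteq> geo \<sigma> g. W \<sigma> * (geo \<sigma> (g ** nb i) - geo \<sigma> g))"
      by (rule gflow_vtx[OF X g])
    also have "\<dots> = (\<Sum>\<sigma>\<in>F. W \<sigma> * (geo \<sigma> (g ** nb i) - geo \<sigma> g))"
      by (rule sum.mono_neutral_left) (use F in \<open>auto simp: F_def\<close>)
    finally show ?thesis .
  qed
  then have "(\<Sum>i\<in>UNIV. gflow X W (vtx g) (vtx (g ** nb i))) = (\<Sum>\<sigma>\<in>F. \<Sum>i\<in>UNIV. W \<sigma> * (geo \<sigma> (g ** nb i) - geo \<sigma> g))"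
    by (simp add: sum.swap[of _ UNIV])
  also have "\<dots> = (\<Sum>\<sigma>\<in>F. W \<sigma> * (\<Sum>i\<in>UNIV. geo \<sigma> (g ** nb i) - geo \<sigma> g))" by (simp only: sum_distrib_left)
  also have "\<dots> = 0"
  proof (rule sum.neutral, rule ballI)
    fix \<sigma> assume "\<sigma> \<in> F"
    then have "\<sigma> \<in> GL2A" using X by (auto simp: F_def)
    then show "W \<sigma> * (\<Sum>i\<in>UNIV. geo \<sigma> (g ** nb i) - geo \<sigma> g) = 0" by (simp only: geo_harmonic[OF g] mult_zero_right)
  qed
  finally show ?thesis .
qed

lemma gflow_translate:
  assumes X: "X \<subseteq> GL2A" and \<gamma>: "\<gamma> \<in> GL2A" and g: "det g \<noteq> 0" "det h \<noteq> 0"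
  shows "gflow X W (vtx (em \<gamma> ** g)) (vtx (em \<gamma> ** h)) =
    (\<Sum>\<tau> | \<gamma> ** \<tau> \<in> X \<and> geo \<tau> h \<noteq> geo \<tau> g. W (\<gamma> ** \<tau>) * (geo \<tau> h - geo \<tau> g))"
proof -
  obtain \<delta> where \<delta>: "\<delta> \<in> GL2A" "\<gamma> ** \<delta> = mat 1" "\<delta> ** \<gamma> = mat 1" using GL2A_inverse[OF \<gamma>] by blast
  have d: "det (em \<gamma> ** g) \<noteq> 0" "det (em \<gamma> ** h) \<noteq> 0" using g \<gamma> by (simp_all add: det_mul)
  have c1: "\<gamma> ** (\<delta> ** \<sigma>) = \<sigma>" "\<delta> ** (\<gamma> ** \<sigma>) = \<sigma>" for \<sigma> :: "'a poly^2^2"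
    using \<delta> by (simp_all add: matrix_mul_assoc)
  have p: "geo (\<gamma> ** \<tau>) (em \<gamma> ** g) = geo \<tau> g" "geo (\<gamma> ** \<tau>) (em \<gamma> ** h) = geo \<tau> h" for \<tau>
    using geo_em[OF \<gamma>] g by blast+
  have "bij_betw (\<lambda>\<tau>. \<gamma> ** \<tau>) {\<tau>. \<gamma> ** \<tau> \<in> X \<and> geo \<tau> h \<noteq> geo \<tau> g}
      {\<sigma>. \<sigma> \<in> X \<and> geo \<sigma> (em \<gamma> ** h) \<noteq> geo \<sigma> (em \<gamma> ** g)}"
  proof (rule bij_betw_byWitness[where f' = "\<lambda>\<sigma>. \<delta> ** \<sigma>"])
    show "(\<lambda>\<tau>. \<delta> ** \<tau>) ` {\<sigma>. \<sigma> \<in> X \<and> geo \<sigma> (em \<gamma> ** h) \<noteq> geo \<sigma> (em \<gamma> ** g)} \<subseteq> {\<tau>. \<gamma> ** \<tau> \<in> X \<and> geo \<tau> h \<noteq> geo \<tau> g}"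
    proof (rule image_subsetI)
      fix \<sigma> assume "\<sigma> \<in> {\<sigma>. \<sigma> \<in> X \<and> geo \<sigma> (em \<gamma> ** h) \<noteq> geo \<sigma> (em \<gamma> ** g)}"
      then show "\<delta> ** \<sigma> \<in> {\<tau>. \<gamma> ** \<tau> \<in> X \<and> geo \<tau> h \<noteq> geo \<tau> g}"
        using p[of "\<delta> ** \<sigma>"] by (simp add: c1)
    qed
  qed (auto simp: c1 p)
  from sum.reindex_bij_betw[OF this, of "\<lambda>\<sigma>. W \<sigma> * (geo \<sigma> (em \<gamma> ** h) - geo \<sigma> (em \<gamma> ** g))"]
  show ?thesis unfolding gflow_vtx[OF X d] p by (rule sym)
qed

section \<open>Weights\<close>

lemma dvd_add_mult: "(k::'r::comm_ring_1) dvd s + k * t \<longleftrightarrow> k dvd s"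
  by (rule dvd_add_left_iff) simp

text \<open>
  These weights are invariant under matrices with upper right entry divisible by \<open>P\<close> and lower left entry divisible
  by \<open>P * y\<close>, and their sum over each unipotent coset at either end of the geodesic is \<open>1\<close>. The flow
  through an edge far out in a cusp therefore only depends on its height and on whether the cusp is equivalent to \<open>\<infinity>\<close> or to \<open>0\<close>.
\<close>

definition flow_wt :: "'a::{field,finite} poly \<Rightarrow> 'a poly \<Rightarrow> 'a poly^2^2 \<Rightarrow> int" where
  "flow_wt P y \<sigma> = of_bool (P dvd \<sigma>$1$2) + of_bool (P * y dvd \<sigma>$2$1)
    - int (card (Res P)) * of_bool (P dvd \<sigma>$1$2 \<and> P * y dvd \<sigma>$2$1)
    + of_bool (P dvd \<sigma>$1$1 \<and> P dvd \<sigma>$2$2)"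

lemma sum_unique_residue:
  assumes P: "prime_elem P" "\<not> P dvd v"
  shows "(\<Sum>z\<in>Res P. of_bool (P dvd u + z * v)) = (1::int)"
proof -
  obtain b where b: "b \<in> Res P" "P dvd u + b * v" "\<And>c. c \<in> Res P \<Longrightarrow> P dvd u + c * v \<Longrightarrow> c = b"
    using linear_residue_unique[OF P] by metis
  have "(\<Sum>z\<in>Res P. of_bool (P dvd u + z * v)) = (\<Sum>z\<in>Res P. if z = b then 1 else (0::int))"
  proof (rule sum.cong[OF refl])
    fix c assume c: "c \<in> Res P"
    then have "P dvd u + c * v \<longleftrightarrow> c = b" using b by blast
    then show "of_bool (P dvd u + c * v) = (if c = b then 1 else (0::int))" by simp
  qed
  then show ?thesis using b(1) by simp
qed

context
  fixes P y :: "'a::{field,finite} poly"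
  assumes P: "monic P" "prime_elem P" and y: "monic y" "prime_elem y"
begin

lemma unit_not_dvd: "P dvd a * d - b * c \<Longrightarrow> \<not> (a * d - b * c) dvd 1"
  using P(2) by (meson dvd_trans not_prime_unit prime_elem_def)

text \<open>If \<open>P\<close> does not divide \<open>a\<close>, exactly one \<open>z\<close>
  solves the first congruence; if \<open>P * y\<close> divides \<open>c\<close> as well, the second
  term contributes \<open>|P|\<close> and the third removes it. If \<open>P\<close> divides
  \<open>a\<close>, then \<open>b\<close> and \<open>c\<close> are prime to \<open>P\<close>, and
  only the last term contributes, for exactly one \<open>z\<close>.\<close>

lemma flow_wt_sum_upper:
  assumes \<sigma>: "\<sigma> \<in> Gamma0 y"
  shows "(\<Sum>z\<in>Res P. flow_wt P y (\<sigma> ** M2 1 z 0 1)) = 1"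
proof -
  obtain a b c d where m: "\<sigma> = M2 a b c d" by (rule M2_cases)
  have u: "(a * d - b * c) dvd 1" and yc: "y dvd c" using \<sigma> by (simp_all add: Gamma0_def m)
  let ?L = "int (card (Res P))"
  have w: "flow_wt P y (\<sigma> ** M2 1 z 0 1) = of_bool (P dvd b + z * a) + of_bool (P * y dvd c)
      - ?L * of_bool (P dvd b + z * a \<and> P * y dvd c) + of_bool (P dvd a \<and> P dvd d + z * c)" for z
    by (simp add: flow_wt_def m M2_mult algebra_simps)
  show ?thesis
  proof (cases "P dvd a")
    case True
    have nbc: "\<not> P dvd b * c" using unit_not_dvd[of a d b c] u True by auto
    then have nb: "\<not> P dvd b" and nc: "\<not> P dvd c" by auto
    have "\<not> P * y dvd c" using nc dvd_mult_left by blast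
    moreover have "\<not> P dvd b + z * a" for z using nb True by (simp add: dvd_add_left_iff)
    ultimately have "flow_wt P y (\<sigma> ** M2 1 z 0 1) = of_bool (P dvd d + z * c)" for z unfolding w using True by simp
    then show ?thesis using sum_unique_residue[OF P(2) nc, of d] by simp
  next
    case False
    show ?thesis
    proof (cases "P * y dvd c")
      case True
      then show ?thesis unfolding w using False sum_unique_residue[OF P(2) False, of b]
        by (simp add: sum.distrib sum_subtractf sum_distrib_left[symmetric])
    next
      case F: False
      then show ?thesis unfolding w using False sum_unique_residue[OF P(2) False, of b] by simp
    qed
  qed
qed

text \<open>The mirror image, with \<open>d\<close> in the role of \<open>a\<close>. If
  \<open>P\<close> divides \<open>d\<close>, the determinant shows that \<open>P\<close> does not
  divide \<open>y * b\<close>, so the congruence for \<open>z\<close> is solvable even with the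
  factor \<open>y\<close>.\<close>

lemma flow_wt_sum_lower:
  assumes \<sigma>: "\<sigma> \<in> Gamma0 y"
  shows "(\<Sum>z\<in>Res P. flow_wt P y (\<sigma> ** M2 1 0 (y * z) 1)) = 1"
proof -
  obtain a b c0 d where m0: "\<sigma> = M2 a b c0 d" by (rule M2_cases)
  have "y dvd c0" using \<sigma> by (simp add: Gamma0_def m0)
  then obtain c where c: "c0 = y * c" by (elim dvdE)
  have m: "\<sigma> = M2 a b (y * c) d" using m0 c by simp
  have u: "(a * d - b * (y * c)) dvd 1" using \<sigma> by (simp add: Gamma0_def m)
  let ?L = "int (card (Res P))"
  have y0: "y \<noteq> 0" using y by simp
  have M: "\<sigma> ** M2 1 0 (y * z) 1 = M2 (a + z * (y * b)) b ((c + z * d) * y) d" for z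
    by (simp add: m M2_mult M2_inject algebra_simps)
  have w: "flow_wt P y (\<sigma> ** M2 1 0 (y * z) 1) = of_bool (P dvd b) + of_bool (P dvd c + z * d)
      - ?L * of_bool (P dvd b \<and> P dvd c + z * d) + of_bool (P dvd a + z * (y * b) \<and> P dvd d)" for z
    unfolding M using y0 by (simp add: flow_wt_def)
  show ?thesis
  proof (cases "P dvd d")
    case True
    have nbc: "\<not> P dvd b * (y * c)" using unit_not_dvd[of a d b "y * c"] u True by auto
    then have nb: "\<not> P dvd b" and nc: "\<not> P dvd c" and ny: "\<not> P dvd y" by auto
    have nyb: "\<not> P dvd y * b" using nb ny P(2) prime_elem_dvd_mult_iff by blast
    have "\<not> P dvd c + z * d" for z using nc True by (simp add: dvd_add_left_iff)
    then have "flow_wt P y (\<sigma> ** M2 1 0 (y * z) 1) = of_bool (P dvd a + z * (y * b))" for z unfolding w using True nb by simp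
    then show ?thesis using sum_unique_residue[OF P(2) nyb, of a] by simp
  next
    case False
    show ?thesis
    proof (cases "P dvd b")
      case True
      then show ?thesis unfolding w using False sum_unique_residue[OF P(2) False, of c]
        by (simp add: sum.distrib sum_subtractf sum_distrib_left[symmetric])
    next
      case F: False
      then show ?thesis unfolding w using False sum_unique_residue[OF P(2) False, of c] by simp
    qed
  qed
qed

lemma flow_wt_periodic_upper:
  "flow_wt P y (\<sigma> ** M2 1 (z + x * P) 0 1) = flow_wt P y (\<sigma> ** M2 1 z 0 1)"
proof -
  obtain a b c d where m: "\<sigma> = M2 a b c d" by (rule M2_cases)
  have e: "a * (z + x * P) + b = (a * z + b) + P * (a * x)" "c * (z + x * P) + d = (c * z + d) + P * (c * x)"
    by (simp_all add: algebra_simps)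
  have "P dvd a * (z + x * P) + b \<longleftrightarrow> P dvd a * z + b" "P dvd c * (z + x * P) + d \<longleftrightarrow> P dvd c * z + d"
    unfolding e by (rule dvd_add_mult)+
  then show ?thesis by (simp add: flow_wt_def m M2_mult)
qed

lemma flow_wt_periodic_lower:
  "flow_wt P y (\<sigma> ** M2 1 0 (y * (z + x * P)) 1) = flow_wt P y (\<sigma> ** M2 1 0 (y * z) 1)"
proof -
  obtain a b c d where m: "\<sigma> = M2 a b c d" by (rule M2_cases)
  have e: "a + b * (y * (z + x * P)) = (a + b * (y * z)) + P * (b * y * x)"
    "c + d * (y * (z + x * P)) = (c + d * (y * z)) + (P * y) * (d * x)" by (simp_all add: algebra_simps)
  have "P dvd a + b * (y * (z + x * P)) \<longleftrightarrow> P dvd a + b * (y * z)"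
    "P * y dvd c + d * (y * (z + x * P)) \<longleftrightarrow> P * y dvd c + d * (y * z)" unfolding e by (rule dvd_add_mult)+
  then show ?thesis by (simp add: flow_wt_def m M2_mult)
qed

text \<open>Modulo \<open>P\<close> the matrix is diagonal with invertible entries, and modulo
  \<open>P * y\<close> it is upper triangular with invertible \<open>d\<close>; so every
  divisibility in the weight is preserved.\<close>

lemma flow_wt_left:
  assumes \<sigma>: "\<sigma> \<in> Gamma0 y" and \<gamma>: "M2 a (P * b) (P * y * c) d \<in> GL2A"
  shows "flow_wt P y (M2 a (P * b) (P * y * c) d ** \<sigma>) = flow_wt P y \<sigma>"
proof -
  obtain p q r0 s where m: "\<sigma> = M2 p q r0 s" by (rule M2_cases)
  have u: "(a * d - P * b * (P * y * c)) dvd 1" using \<gamma> by (simp add: GL2A_def)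
  have na: "\<not> P dvd a" using u unit_not_dvd[of a d "P * b" "P * y * c"] by auto
  have cd: "cop d (P * y)"
  proof -
    have "cop (a * d) (P * y)" using cop_add[OF cop_unit[OF u], of "P * b * c" "P * y"] by (simp add: algebra_simps)
    then show ?thesis by (rule cop_dvd) simp
  qed
  have nd: "\<not> P dvd d" using u unit_not_dvd[of a d "P * b" "P * y * c"] by auto
  have e12: "P dvd a * q + P * b * s \<longleftrightarrow> P dvd q"
    using na P(2) by (simp add: mult.assoc dvd_add_left_iff prime_elem_dvd_mult_iff)
  have e11: "P dvd a * p + P * b * r0 \<longleftrightarrow> P dvd p"
    using na P(2) by (simp add: mult.assoc dvd_add_left_iff prime_elem_dvd_mult_iff)
  have e22: "P dvd P * y * c * q + d * s \<longleftrightarrow> P dvd s"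
    using nd P(2) by (simp add: mult.assoc dvd_add_right_iff prime_elem_dvd_mult_iff)
  have e21: "P * y dvd P * y * c * p + d * r0 \<longleftrightarrow> P * y dvd r0"
  proof -
    have "P * y dvd P * y * c * p + d * r0 \<longleftrightarrow> P * y dvd d * r0" by (simp add: mult.assoc dvd_add_right_iff)
    also have "\<dots> \<longleftrightarrow> P * y dvd r0" using cop_dvd_mult[OF cd, of r0] by auto
    finally show ?thesis .
  qed
  show ?thesis by (simp add: flow_wt_def m M2_mult e11 e12 e21 e22)
qed

end

section \<open>Evaluation at the cusps\<close>

lemma nu_Lam_jump:
  assumes "x \<noteq> 0"
  shows "nu (Lam (Suc k)) (ev x) - nu (Lam k) (ev x) = of_bool (x$2 = 0 \<or> (x$1 \<noteq> 0 \<and> k + degree (x$2) < degree (x$1)))"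
  using assms by (auto simp: nu_Lam vec2_eq_iff)

text \<open>\<open>a * d\<close> has positive degree and the determinant is constant, so the leading
  terms of \<open>a * d\<close> and \<open>b * c\<close> cancel: \<open>a / c\<close> and
  \<open>b / d\<close> have equal degrees.\<close>

lemma GL2A_degree_bound:
  assumes u: "(a * d - b * c) dvd (1 :: 'a::{field,finite} poly)"
    and a: "a \<noteq> 0" "d \<noteq> 0" "k + degree c < degree a"
  shows "b \<noteq> 0 \<and> (c \<noteq> 0 \<longrightarrow> k + degree d < degree b)"
proof (rule ccontr)
  assume n: "\<not> (b \<noteq> 0 \<and> (c \<noteq> 0 \<longrightarrow> k + degree d < degree b))"
  have "degree (b * c) < degree (a * d)"
  proof (cases "b = 0 \<or> c = 0")
    case True
    then show ?thesis using a by (auto simp: degree_mult_eq)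
  next
    case False
    then show ?thesis using n a by (auto simp: degree_mult_eq)
  qed
  then have "degree (a * d + - (b * c)) = degree (a * d)" by (intro degree_add_eq_left) simp
  then have "degree (a * d - b * c) = degree a + degree d" using a by (simp add: degree_mult_eq)
  moreover have "degree (a * d - b * c) = 0" using u by (auto simp: is_unit_poly_iff)
  ultimately show False using a by simp
qed

text \<open>A geodesic of \<open>GL2A\<close> uses an edge of the ray only if it ends in the cusp
  \<open>\<infinity>\<close>: \<open>c = 0\<close> says that
  \<open>\<sigma> \<infinity> = \<infinity>\<close> and \<open>d = 0\<close> that
  \<open>\<sigma> 0 = \<infinity>\<close>. The degree bound says that it has joined the ray by
  height \<open>k\<close>. If neither end is \<open>\<infinity>\<close>, the two jumps cancel by
  \<open>GL2A_degree_bound\<close>.\<close>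

lemma geo_jump:
  assumes \<tau>: "M2 a b c d \<in> GL2A"
  shows "geo (M2 a b c d) (Lam (Suc k)) - geo (M2 a b c d) (Lam k) = of_bool (c = 0 \<and> degree b \<le> k) - of_bool (d = 0 \<and> degree a \<le> k)"
proof -
  have u: "(a * d - b * c) dvd 1" using \<tau> by (simp add: GL2A_def)
  have u': "(b * c - a * d) dvd 1" using u by (metis minus_diff_eq minus_dvd_iff)
  have cols: "M2 a b c d *v V2 1 0 = V2 a c" "M2 a b c d *v V2 0 1 = V2 b d" by (simp_all add: M2_mulv)
  have nz: "V2 a c \<noteq> 0" "V2 b d \<noteq> 0" using u by (auto simp: vec2_eq_iff)
  have "geo (M2 a b c d) (Lam (Suc k)) - geo (M2 a b c d) (Lam k) =
      of_bool (c = 0 \<or> (a \<noteq> 0 \<and> k + degree c < degree a)) - of_bool (d = 0 \<or> (b \<noteq> 0 \<and> k + degree d < degree b))"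
    using nu_Lam_jump[OF nz(1), of k] nu_Lam_jump[OF nz(2), of k] unfolding geo_def cols by simp
  also have "\<dots> = of_bool (c = 0 \<and> degree b \<le> k) - of_bool (d = 0 \<and> degree a \<le> k)"
  proof -
    consider "c = 0" | "d = 0" | "c \<noteq> 0" "d \<noteq> 0" by blast
    then show ?thesis
    proof cases
      case 1
      then have "d dvd 1" using u by (auto dest: dvd_mult_right)
      then have "d \<noteq> 0" "degree d = 0" by (auto simp: is_unit_poly_iff)
      then show ?thesis using 1 by (cases "b = 0") auto
    next
      case 2
      then have "c dvd 1" using u' by (auto dest: dvd_mult_right)
      then have "c \<noteq> 0" "degree c = 0" by (auto simp: is_unit_poly_iff)
      then show ?thesis using 2 by (cases "a = 0") auto
    next
      case 3
      have "(a \<noteq> 0 \<and> k + degree c < degree a) \<longleftrightarrow> (b \<noteq> 0 \<and> k + degree d < degree b)"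
        using GL2A_degree_bound[OF u, of k] GL2A_degree_bound[OF u', of k] 3 by blast
      then show ?thesis using 3 by simp
    qed
  qed
  finally show ?thesis .
qed

lemma Res_degree: "degree D = Suc k \<Longrightarrow> b \<in> Res D \<longleftrightarrow> degree b \<le> k"
  by (auto simp: Res_def)

lemma unit_const: "(a :: 'a::field poly) dvd 1 \<Longrightarrow> \<exists>c. c \<noteq> 0 \<and> a = [:c:]"
  by (auto simp: is_unit_poly_iff)

lemma const_unit: "c \<noteq> 0 \<Longrightarrow> [:c:] dvd (1 :: 'a::field poly)"
  by (simp add: is_unit_const_poly_iff dvd_field_iff)

context
  fixes P y :: "'a::{field,finite} poly"
  assumes P: "monic P" "prime_elem P" and y: "monic y" "prime_elem y"
begin

lemma nz_Py: "P \<noteq> 0" "y \<noteq> 0"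
  using P y by simp_all

text \<open>\<open>Res (s * P)\<close> consists of \<open>card (Res s)\<close> complete residue
  systems modulo \<open>P\<close>, and scaling by the constant \<open>a\<close> permutes it.\<close>

lemma flow_wt_inner_upper:
  assumes \<sigma>: "\<sigma> \<in> Gamma0 y" and a: "a \<noteq> 0" and s: "s \<noteq> 0"
  shows "(\<Sum>b\<in>Res (s * P). flow_wt P y (\<sigma> ** M2 1 (smult a b) 0 1)) = int (card (Res s))"
proof -
  let ?h = "\<lambda>z. flow_wt P y (\<sigma> ** M2 1 z 0 1)"
  have "?h (b + x * (s * P)) = ?h b" for b x
    using flow_wt_periodic_upper[OF P y, of \<sigma> b "x * s"] by (simp add: mult.assoc)
  then have "(\<Sum>b\<in>Res (s * P). ?h (smult a b)) = (\<Sum>b\<in>Res (s * P). ?h b)"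
    using s nz_Py a
    by (intro sum_Res_perm) (auto simp: smult_diff_right[symmetric] dvd_smult_iff intro: Res_eqI)
  also have "\<dots> = int (card (Res s)) * (\<Sum>b\<in>Res P. ?h b)"
    by (rule sum_Res_periodic[OF s nz_Py(1)]) (rule flow_wt_periodic_upper[OF P y])
  finally show ?thesis by (simp add: flow_wt_sum_upper[OF P y \<sigma>])
qed

lemma flow_wt_inner_lower:
  assumes \<sigma>: "\<sigma> \<in> Gamma0 y" and a: "a \<noteq> 0" and s: "s \<noteq> 0"
  shows "(\<Sum>b\<in>Res (s * P). flow_wt P y (\<sigma> ** M2 1 0 (y * smult a b) 1)) = int (card (Res s))"
proof -
  let ?h = "\<lambda>z. flow_wt P y (\<sigma> ** M2 1 0 (y * z) 1)"
  have "?h (b + x * (s * P)) = ?h b" for b x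
    using flow_wt_periodic_lower[OF P y, of \<sigma> b "x * s"] by (simp add: mult.assoc)
  then have "(\<Sum>b\<in>Res (s * P). ?h (smult a b)) = (\<Sum>b\<in>Res (s * P). ?h b)"
    using s nz_Py a
    by (intro sum_Res_perm) (auto simp: smult_diff_right[symmetric] dvd_smult_iff intro: Res_eqI)
  also have "\<dots> = int (card (Res s)) * (\<Sum>b\<in>Res P. ?h b)"
    by (rule sum_Res_periodic[OF s nz_Py(1)]) (rule flow_wt_periodic_lower[OF P y])
  finally show ?thesis by (simp add: flow_wt_sum_lower[OF P y \<sigma>])
qed

lemma card_nonzero: "int (card {a :: 'a. a \<noteq> 0}) = Q TYPE('a) - 1"
proof -
  have "{a :: 'a. a \<noteq> 0} = UNIV - {0}" by auto
  then have "card {a :: 'a. a \<noteq> 0} = CARD('a) - 1" by (simp add: card_Diff_singleton)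
  moreover have "CARD('a) \<ge> 1" using zero_less_card_finite[where 'a='a] by linarith
  ultimately show ?thesis by (simp add: Q_def of_nat_diff)
qed

lemma card_Res_power: "int (card (Res (s :: 'a poly))) = Q TYPE('a) ^ degree s"
  by (simp add: card_Res Q_def)

lemma Gamma0_GL2A_cancel: "\<gamma> \<in> GL2A \<Longrightarrow> \<gamma> ** \<tau> \<in> Gamma0 n \<Longrightarrow> \<tau> \<in> GL2A"
  unfolding GL2A_def Gamma0_def by (auto simp: det_mul dest: dvd_mult_right)

text \<open>Only upper triangular \<open>\<tau>\<close> count: \<open>d = 0\<close> would make the
  lower left entry a unit, yet it is divisible by \<open>y\<close>. The diagonals contribute
  \<open>(Q - 1) ^ 2\<close>, and the translations of degree at most \<open>k\<close> contribute
  \<open>Q ^ (Suc k - degree P)\<close> by the coset sums.\<close>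

lemma gflow_cusp_inf:
  assumes \<gamma>: "\<gamma> \<in> Gamma0 y" and k: "degree P \<le> k"
  shows "int (card (Res P)) * gflow (Gamma0 y) (flow_wt P y) (vtx (em \<gamma> ** Lam k)) (vtx (em \<gamma> ** Lam (Suc k)))
    = (Q TYPE('a) - 1) ^ 2 * Q TYPE('a) ^ Suc k"
proof -
  have \<gamma>': "\<gamma> \<in> GL2A" using \<gamma> by (rule Gamma0_GL2A)
  have X: "Gamma0 y \<subseteq> GL2A" using Gamma0_GL2A by blast
  \<comment> \<open>Any \<open>s\<close> of this degree would do: \<open>Res (s * P)\<close> becomes
    the set of polynomials of degree at most \<open>k\<close>.\<close>
  define s where "s = monom (1::'a) (Suc k - degree P)"
  have s: "s \<noteq> 0" "degree s = Suc k - degree P" by (simp_all add: s_def degree_monom_eq)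
  have dD: "degree (s * P) = Suc k" using s nz_Py k by (simp add: degree_mult_eq)
  let ?N = "{a :: 'a. a \<noteq> 0}"
  let ?F = "\<lambda>(a, d, b). M2 [:a:] b 0 [:d:]"
  let ?Y = "{\<tau>. \<gamma> ** \<tau> \<in> Gamma0 y \<and> geo \<tau> (Lam (Suc k)) \<noteq> geo \<tau> (Lam k)}"
  have Yj: "\<tau> \<in> ?Y \<longleftrightarrow> \<tau> \<in> ?F ` (?N \<times> ?N \<times> Res (s * P))" "\<tau> \<in> ?Y \<Longrightarrow> geo \<tau> (Lam (Suc k)) - geo \<tau> (Lam k) = 1" for \<tau>
  proof -
    obtain a b c d where m: "\<tau> = M2 a b c d" by (rule M2_cases)
    have *: "c = 0 \<and> degree b \<le> k \<and> geo \<tau> (Lam (Suc k)) - geo \<tau> (Lam k) = 1" if \<tau>: "\<tau> \<in> ?Y"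
    proof -
      have t: "\<tau> \<in> GL2A" using \<tau> Gamma0_GL2A_cancel[OF \<gamma>'] by blast
      obtain \<delta> where \<delta>: "\<delta> \<in> Gamma0 y" "\<delta> ** \<gamma> = mat 1" using Gamma0_inverse[OF \<gamma>] by blast
      have "\<delta> ** (\<gamma> ** \<tau>) \<in> Gamma0 y" using Gamma0_mult[OF \<delta>(1)] \<tau> by blast
      then have yc: "y dvd c" unfolding matrix_mul_assoc \<delta>(2) by (simp add: Gamma0_def m)
      have "d \<noteq> 0"
      proof
        assume "d = 0"
        then have "c dvd 1" using t by (auto simp: GL2A_def m dest: dvd_mult_right)
        then show False using yc y(2) dvd_trans unfolding prime_elem_def by blast
      qed
      then have "geo \<tau> (Lam (Suc k)) - geo \<tau> (Lam k) = of_bool (c = 0 \<and> degree b \<le> k)"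
        using geo_jump[of a b c d k] t m by simp
      then show ?thesis using \<tau> by (auto simp: of_bool_def split: if_splits)
    qed
    then show "\<tau> \<in> ?Y \<Longrightarrow> geo \<tau> (Lam (Suc k)) - geo \<tau> (Lam k) = 1" by blast
    show "\<tau> \<in> ?Y \<longleftrightarrow> \<tau> \<in> ?F ` (?N \<times> ?N \<times> Res (s * P))"
    proof
      assume \<tau>: "\<tau> \<in> ?Y"
      then have t: "\<tau> \<in> GL2A" using Gamma0_GL2A_cancel[OF \<gamma>'] by blast
      have c0: "c = 0" and b: "degree b \<le> k" using *[OF \<tau>] by blast+
      have "a dvd 1" "d dvd 1" using t c0 by (auto simp: GL2A_def m dest: dvd_mult_left dvd_mult_right)
      then obtain a' d' where "a' \<noteq> 0" "a = [:a':]" "d' \<noteq> 0" "d = [:d':]" using unit_const by metis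
      then show "\<tau> \<in> ?F ` (?N \<times> ?N \<times> Res (s * P))" using c0 b
        by (intro image_eqI[of _ _ "(a', d', b)"]) (simp_all add: m Res_degree[OF dD])
    next
      assume "\<tau> \<in> ?F ` (?N \<times> ?N \<times> Res (s * P))"
      then obtain a' d' b' where t: "a' \<noteq> 0" "d' \<noteq> 0" "b' \<in> Res (s * P)" "\<tau> = M2 [:a':] b' 0 [:d':]" by auto
      have g: "\<tau> \<in> Gamma0 y" using const_unit[of "d' * a'"] const_unit[of "a' * d'"] t by (simp add: Gamma0_def)
      have "geo \<tau> (Lam (Suc k)) - geo \<tau> (Lam k) = 1"
        using geo_jump[of "[:a':]" b' 0 "[:d':]" k] Gamma0_GL2A[OF g] t Res_degree[OF dD, of b'] by simp
      then show "\<tau> \<in> ?Y" using Gamma0_mult[OF \<gamma> g] by auto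
    qed
  qed
  have Yeq: "?Y = ?F ` (?N \<times> ?N \<times> Res (s * P))" using Yj(1) by blast
  have inj: "inj_on ?F (?N \<times> ?N \<times> Res (s * P))" by (auto simp: inj_on_def M2_inject)
  have inner: "(\<Sum>b\<in>Res (s * P). flow_wt P y (\<gamma> ** M2 [:a:] b 0 [:d:])) = int (card (Res s))" if "a \<noteq> 0" "d \<noteq> 0" for a d
  proof -
    have eq: "\<gamma> ** M2 [:a:] b 0 [:d:] = \<gamma> ** M2 [:a:] 0 0 [:d:] ** M2 1 (smult (1 / a) b) 0 1" for b
      using that by (simp add: matrix_mul_assoc[symmetric] M2_mult)
    have "[:a:] * [:d:] dvd 1" using const_unit[of "d * a"] const_unit[of "a * d"] that by simp
    then have "\<gamma> ** M2 [:a:] 0 0 [:d:] \<in> Gamma0 y" by (intro Gamma0_mult[OF \<gamma>]) (simp add: Gamma0_def)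
    then have "(\<Sum>b\<in>Res (s * P). flow_wt P y (\<gamma> ** M2 [:a:] 0 0 [:d:] ** M2 1 (smult (1 / a) b) 0 1)) = int (card (Res s))"
      using that s(1) by (intro flow_wt_inner_upper) simp_all
    then show ?thesis by (simp only: eq[symmetric])
  qed
  have "gflow (Gamma0 y) (flow_wt P y) (vtx (em \<gamma> ** Lam k)) (vtx (em \<gamma> ** Lam (Suc k))) = (\<Sum>\<tau>\<in>?Y. flow_wt P y (\<gamma> ** \<tau>) * (geo \<tau> (Lam (Suc k)) - geo \<tau> (Lam k)))"
    by (rule gflow_translate[OF X \<gamma>']) simp_all
  also have "\<dots> = (\<Sum>\<tau>\<in>?Y. flow_wt P y (\<gamma> ** \<tau>))" by (rule sum.cong[OF refl]) (simp add: Yj(2))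
  also have "\<dots> = (\<Sum>x\<in>?N \<times> ?N \<times> Res (s * P). flow_wt P y (\<gamma> ** ?F x))" unfolding Yeq by (simp add: sum.reindex[OF inj])
  also have "\<dots> = (\<Sum>a\<in>?N. \<Sum>d\<in>?N. \<Sum>b\<in>Res (s * P). flow_wt P y (\<gamma> ** M2 [:a:] b 0 [:d:]))"
    by (simp add: sum.cartesian_product case_prod_unfold)
  also have "\<dots> = (\<Sum>a\<in>?N. \<Sum>d\<in>?N. int (card (Res s)))" by (intro sum.cong refl inner) auto
  also have "\<dots> = (Q TYPE('a) - 1) ^ 2 * Q TYPE('a) ^ (Suc k - degree P)"
    by (simp add: card_nonzero card_Res_power s power2_eq_square)
  finally show ?thesis using k by (simp add: card_Res_power power_add[symmetric] del: power_Suc)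
qed

text \<open>Now \<open>c = 0\<close> is excluded and \<open>d = 0\<close> remains, which is
  traversed in the opposite sense. The condition at level \<open>y\<close> fixes \<open>a\<close>
  modulo \<open>y\<close>, which costs the factor \<open>Q ^ degree y\<close>.\<close>

lemma gflow_cusp_zero:
  assumes \<gamma>': "\<gamma> \<in> GL2A" and ny: "\<not> y dvd \<gamma>$2$1" and k: "degree P + degree y \<le> k"
  shows "int (card (Res P)) * gflow (Gamma0 y) (flow_wt P y) (vtx (em \<gamma> ** Lam k)) (vtx (em \<gamma> ** Lam (Suc k)))
    = - ((Q TYPE('a) - 1) ^ 2 * Q TYPE('a) ^ (Suc k - degree y))"
proof -
  have X: "Gamma0 y \<subseteq> GL2A" using Gamma0_GL2A by blast
  define s where "s = monom (1::'a) (Suc k - degree P - degree y)"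
  have s: "s \<noteq> 0" "degree s = Suc k - degree P - degree y" by (simp_all add: s_def degree_monom_eq)
  have sP: "s * P \<noteq> 0" using s nz_Py by simp
  have dD: "degree (s * P * y) = Suc k" using s nz_Py k by (simp add: degree_mult_eq)
  obtain \<alpha> \<beta> g \<delta> where mg: "\<gamma> = M2 \<alpha> \<beta> g \<delta>" by (rule M2_cases)
  have ng: "\<not> y dvd g" using ny by (simp add: mg)
  have "\<exists>b. b \<in> Res y \<and> y dvd c * \<delta> + b * g" for c using linear_residue_unique[OF y(2) ng] by blast
  \<comment> \<open>\<open>a0 c\<close> is the class of \<open>a\<close> modulo \<open>y\<close>
    that makes the lower left entry of \<open>\<gamma> ** \<tau>\<close> divisible by
    \<open>y\<close>.\<close>
  then obtain a0 where a0: "\<And>c. a0 c \<in> Res y" "\<And>c. y dvd c * \<delta> + a0 c * g" by metis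
  have a0u: "b = a0 c" if "b \<in> Res y" "y dvd c * \<delta> + b * g" for b c
    using linear_residue_unique[OF y(2) ng] a0 that by metis
  let ?N = "{a :: 'a. a \<noteq> 0}"
  let ?F = "\<lambda>(b, c, z). M2 (a0 [:c:] + z * y) [:b:] [:c:] 0"
  let ?Y = "{\<tau>. \<gamma> ** \<tau> \<in> Gamma0 y \<and> geo \<tau> (Lam (Suc k)) \<noteq> geo \<tau> (Lam k)}"
  have low: "(\<gamma> ** M2 a b c d) $ 2 $ 1 = c * \<delta> + a * g" for a b c d by (simp add: mg M2_mult algebra_simps)
  have det_unit: "det (\<gamma> ** M2 a b c d) dvd 1 \<longleftrightarrow> (a * d - b * c) dvd 1" for a b c d
    using \<gamma>' by (auto simp: det_mul GL2A_def dest: dvd_mult_right intro: mult_dvd_mono[of _ 1 _ 1, simplified])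
  have Yj: "\<tau> \<in> ?Y \<longleftrightarrow> \<tau> \<in> ?F ` (?N \<times> ?N \<times> Res (s * P))" "\<tau> \<in> ?Y \<Longrightarrow> geo \<tau> (Lam (Suc k)) - geo \<tau> (Lam k) = -1" for \<tau>
  proof -
    obtain a b c d where m: "\<tau> = M2 a b c d" by (rule M2_cases)
    have *: "d = 0 \<and> degree a \<le> k \<and> geo \<tau> (Lam (Suc k)) - geo \<tau> (Lam k) = -1" if \<tau>: "\<tau> \<in> ?Y"
    proof -
      have t: "\<tau> \<in> GL2A" using \<tau> Gamma0_GL2A_cancel[OF \<gamma>'] by blast
      have ya: "y dvd c * \<delta> + a * g" using \<tau> low[of a b c d] by (simp add: Gamma0_def m)
      have "c \<noteq> 0"
      proof
        assume c: "c = 0"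
        then have "a dvd 1" using t by (auto simp: GL2A_def m dest: dvd_mult_left)
        moreover have "y dvd a" using ya c ng y(2) by (simp add: prime_elem_dvd_mult_iff)
        ultimately show False using y(2) dvd_trans unfolding prime_elem_def by blast
      qed
      then have "geo \<tau> (Lam (Suc k)) - geo \<tau> (Lam k) = - of_bool (d = 0 \<and> degree a \<le> k)"
        using geo_jump[of a b c d k] t m by simp
      then show ?thesis using \<tau> by (auto simp: of_bool_def split: if_splits)
    qed
    then show "\<tau> \<in> ?Y \<Longrightarrow> geo \<tau> (Lam (Suc k)) - geo \<tau> (Lam k) = -1" by blast
    show "\<tau> \<in> ?Y \<longleftrightarrow> \<tau> \<in> ?F ` (?N \<times> ?N \<times> Res (s * P))"
    proof
      assume \<tau>: "\<tau> \<in> ?Y"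
      then have t: "\<tau> \<in> GL2A" using Gamma0_GL2A_cancel[OF \<gamma>'] by blast
      have d0: "d = 0" and a: "degree a \<le> k" using *[OF \<tau>] by blast+
      have "b * c dvd 1" using t d0 by (simp add: GL2A_def m)
      then have "b dvd 1" "c dvd 1" by (auto dest: dvd_mult_left dvd_mult_right)
      then obtain b' c' where bc: "b' \<noteq> 0" "b = [:b':]" "c' \<noteq> 0" "c = [:c':]" using unit_const by metis
      have ya: "y dvd c * \<delta> + a * g" using \<tau> low[of a b c d] by (simp add: Gamma0_def m)
      have eq: "c * \<delta> + (a mod y) * g = (c * \<delta> + a * g) + y * (- (a div y) * g)"
        unfolding minus_div_mult_eq_mod[symmetric] by (simp add: algebra_simps)
      have "y dvd c * \<delta> + (a mod y) * g" unfolding eq using ya by (simp only: dvd_add_mult)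
      then have am: "a mod y = a0 c" using nz_Py by (intro a0u) auto
      have "a = a0 c + (a div y) * y" using am by (metis mod_div_mult_eq)
      moreover have "a div y \<in> Res (s * P)" using a Res_degree[OF dD] nz_Py sP by (intro div_Res) auto
      ultimately show "\<tau> \<in> ?F ` (?N \<times> ?N \<times> Res (s * P))" using d0 bc
        by (intro image_eqI[of _ _ "(b', c', a div y)"]) (simp_all add: m)
    next
      assume "\<tau> \<in> ?F ` (?N \<times> ?N \<times> Res (s * P))"
      then obtain b' c' z where t: "b' \<noteq> 0" "c' \<noteq> 0" "z \<in> Res (s * P)" "\<tau> = M2 (a0 [:c':] + z * y) [:b':] [:c':] 0" by auto
      have u: "- ([:b':] * [:c':]) dvd 1" using const_unit[of "- (c' * b')"] const_unit[of "- (b' * c')"] t by simp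
      have "y dvd ([:c':] * \<delta> + a0 [:c':] * g) + y * (z * g)" using a0(2)[of "[:c':]"] by (simp only: dvd_add_mult)
      then have yl: "y dvd [:c':] * \<delta> + (a0 [:c':] + z * y) * g" by (simp add: algebra_simps)
      have g': "\<gamma> ** \<tau> \<in> Gamma0 y" unfolding Gamma0_def t(4) using yl u det_unit low by (simp del: mult_pCons_left)
      have "\<tau> \<in> GL2A" using Gamma0_GL2A_cancel[OF \<gamma>' g'] .
      moreover have "degree (a0 [:c':] + z * y) \<le> k"
        using Res_mult_comb[OF a0(1) t(3) sP nz_Py(2)] Res_degree[OF dD] by blast
      ultimately have "geo \<tau> (Lam (Suc k)) - geo \<tau> (Lam k) = -1"
        using geo_jump[of "a0 [:c':] + z * y" "[:b':]" "[:c':]" 0 k] t by simp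
      then show "\<tau> \<in> ?Y" using g' by auto
    qed
  qed
  have Yeq: "?Y = ?F ` (?N \<times> ?N \<times> Res (s * P))" using Yj(1) by blast
  have inj: "inj_on ?F (?N \<times> ?N \<times> Res (s * P))" using nz_Py by (auto simp: inj_on_def M2_inject)
  have inner: "(\<Sum>z\<in>Res (s * P). flow_wt P y (\<gamma> ** M2 (a0 [:c:] + z * y) [:b:] [:c:] 0)) = int (card (Res s))" if "b \<noteq> 0" "c \<noteq> 0" for b c
  proof -
    have eq: "\<gamma> ** M2 (a0 [:c:] + z * y) [:b:] [:c:] 0 = \<gamma> ** M2 (a0 [:c:]) [:b:] [:c:] 0 ** M2 1 0 (y * smult (1 / b) z) 1" for z
      using that by (simp add: matrix_mul_assoc[symmetric] M2_mult mult.commute)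
    have u: "- ([:b:] * [:c:]) dvd 1" using const_unit[of "- (c * b)"] const_unit[of "- (b * c)"] that by simp
    have "\<gamma> ** M2 (a0 [:c:]) [:b:] [:c:] 0 \<in> Gamma0 y"
      unfolding Gamma0_def using a0(2)[of "[:c:]"] u det_unit low by (simp del: mult_pCons_left)
    then show ?thesis unfolding eq using flow_wt_inner_lower[of _ "1 / b" s] that s(1) by simp
  qed
  have "gflow (Gamma0 y) (flow_wt P y) (vtx (em \<gamma> ** Lam k)) (vtx (em \<gamma> ** Lam (Suc k))) = (\<Sum>\<tau>\<in>?Y. flow_wt P y (\<gamma> ** \<tau>) * (geo \<tau> (Lam (Suc k)) - geo \<tau> (Lam k)))"
    by (rule gflow_translate[OF X \<gamma>']) simp_all
  also have "\<dots> = (\<Sum>\<tau>\<in>?Y. - flow_wt P y (\<gamma> ** \<tau>))" by (rule sum.cong[OF refl]) (simp add: Yj(2))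
  also have "\<dots> = - (\<Sum>x\<in>?N \<times> ?N \<times> Res (s * P). flow_wt P y (\<gamma> ** ?F x))" unfolding Yeq by (simp add: sum.reindex[OF inj] sum_negf)
  also have "(\<Sum>x\<in>?N \<times> ?N \<times> Res (s * P). flow_wt P y (\<gamma> ** ?F x)) = (\<Sum>b\<in>?N. \<Sum>c\<in>?N. \<Sum>z\<in>Res (s * P). flow_wt P y (\<gamma> ** M2 (a0 [:c:] + z * y) [:b:] [:c:] 0))"
    by (simp add: sum.cartesian_product case_prod_unfold)
  also have "\<dots> = (\<Sum>b\<in>?N. \<Sum>c\<in>?N. int (card (Res s)))" by (intro sum.cong refl inner) auto
  also have "\<dots> = (Q TYPE('a) - 1) ^ 2 * Q TYPE('a) ^ (Suc k - degree P - degree y)"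
    by (simp add: card_nonzero card_Res_power s power2_eq_square)
  finally show ?thesis using k by (simp add: card_Res_power power_add[symmetric] del: power_Suc)
qed

end

lemma amax_diag:
  fixes x :: "'a::{field,finite} fls"
  assumes "x \<noteq> 0" "fls_subdegree x = - int k"
  shows "amax (M2 x 0 0 1) = int k"
proof -
  define t where "t = poly_to_fls (monom (1::'a) k)"
  have t: "t \<noteq> 0" "fls_subdegree t = - int k" by (simp_all add: t_def subdegree_monom)
  have "Lam k = M2 t 0 0 1" unfolding Lam_def t_def ..
  then have "M2 x 0 0 1 = mat 1 ** Lam k ** M2 (x / t) 0 0 1" using t(1) by (simp add: M2_mult)
  moreover have "M2 (x / t) 0 0 1 \<in> GLO" using t assms by (simp del: GLO_det add: GLO_def oge_iff divide_inverse)
  ultimately show ?thesis using amax_scale[of "Lam k" 1 "M2 (x / t) 0 0 1"] by (simp add: amax_Lam)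
qed

section \<open>The cochain of level \<open>P ^ 2 * m\<close> and the theorem\<close>

section \<open>The congruence\<close>

lemma em_diag_Lam: "em (M2 y 0 0 1) ** Lam k = M2 (poly_to_fls y * poly_to_fls (monom 1 k)) 0 0 1"
  by (simp add: em_M2 Lam_def M2_mult)

lemma eis_dif_cusp_inf:
  fixes y :: "'a::{field,finite} poly"
  assumes y: "y \<noteq> 0" and \<gamma>: "\<gamma> \<in> Gamma0 y"
  shows "eis_dif y (em \<gamma> ** Lam k) = Q TYPE('a) ^ (k + 1) - Q TYPE('a) ^ (k + degree y + 1) + (Q TYPE('a) ^ 2 - 1) * int (degree y)"
proof -
  let ?g = "em (M2 y 0 0 1) ** Lam k :: 'a fls^2^2"
  have a: "amax ?g = int (k + degree y)"
    unfolding em_diag_Lam using y by (intro amax_diag) (simp_all add: pf_subdegree degree_monom_eq)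
  have h: "ht ?g = int (k + degree y)"
    unfolding ht_def a using y by (simp add: em_diag_Lam pf_subdegree degree_monom_eq)
  have n: "nat (ht ?g) = k + degree y" unfolding h by simp
  have "eis_dif y (em \<gamma> ** Lam k) = eis_dif y (Lam k)" using y \<gamma> by (intro eis_dif_Gamma0) simp_all
  also have "\<dots> = Q TYPE('a) ^ (k + 1) - (Q TYPE('a) ^ 2 - 1) * int k
      - (Q TYPE('a) ^ (k + degree y + 1) - (Q TYPE('a) ^ 2 - 1) * int (k + degree y))"
    unfolding eis_dif_def eis_pot_def n a by (simp add: ht_Lam amax_Lam)
  finally show ?thesis by (simp add: algebra_simps)
qed

text \<open>After \<open>diag(y, 1)\<close> the maximum is still \<open>k\<close>. By
  \<open>nu_adj\<close> a competitor comes from a vector \<open>u\<close> with second coordinate of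
  \<open>\<gamma> *v u\<close> divisible by \<open>y\<close>, at a gain of \<open>degree y\<close>.
  If \<open>u$2 = 0\<close>, then \<open>y\<close> divides \<open>u$1\<close>, which loses as much;
  otherwise the order of \<open>u\<close> is at most 0, and \<open>degree y \<le> k\<close>
  suffices.\<close>

lemma eis_dif_cusp_zero:
  fixes y :: "'a::{field,finite} poly"
  assumes y: "prime_elem y" and \<gamma>: "\<gamma> \<in> GL2A" and ny: "\<not> y dvd \<gamma>$2$1" and k: "degree y \<le> k"
  shows "eis_dif y (em \<gamma> ** Lam k) = Q TYPE('a) ^ (k + 1) - Q TYPE('a) ^ (k - degree y + 1)"
proof -
  have y0: "y \<noteq> 0" using y by auto
  let ?M = "M2 y 0 0 1 :: 'a poly^2^2"
  let ?g = "em \<gamma> ** Lam k"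
  have d: "det ?g \<noteq> 0" using \<gamma> by (simp add: det_mul)
  have dM: "det ?M = y" by simp
  have am: "amax (em ?M ** ?g) = int k"
  proof (rule amax_eqI)
    have nz: "\<gamma> *v V2 1 0 \<noteq> 0" using \<gamma> e12_nz by (metis det_em_GL2A em_mulv ev_eq_0 mulv_eq_0)
    then show "?M *v (\<gamma> *v V2 1 0) \<noteq> 0" using y0 by (metis dM det_em em_mulv ev_eq_0 mulv_eq_0 pf_eq_0)
    show "nu (em ?M ** ?g) (ev (?M *v (\<gamma> *v V2 1 0))) = int k"
      using y0 d \<gamma> by (simp add: nu_em nu_Lam)
  next
    fix w :: "'a poly^2" assume w: "w \<noteq> 0"
    note nw = nu_adj[OF dM y0 d w]
    obtain u where u: "adj2 ?M *v w = \<gamma> *v u" using GL2A_surj[OF \<gamma>] by blast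
    have u0: "u \<noteq> 0" using nw(2) u by auto
    have nw': "nu (em ?M ** ?g) (ev w) = nu (Lam k) (ev u) + int (degree y)"
      using nw(1) \<gamma> unfolding u by (simp add: nu_em)
    show "nu (em ?M ** ?g) (ev w) \<le> int k"
    proof (cases "u $ 2 = 0")
      case True
      then have u1: "u $ 1 \<noteq> 0" using u0 by (auto simp: vec2_eq_iff)
      have "(adj2 ?M *v w) $ 2 = \<gamma>$2$1 * u$1" unfolding u by (simp add: matvec2_nth True)
      moreover have "(adj2 ?M *v w) $ 2 = y * w $ 2" by (simp add: adj2_def matvec2_nth)
      ultimately have "y dvd \<gamma>$2$1 * u$1" by (metis dvd_triv_left)
      then have "y dvd u$1" using y ny by (simp add: prime_elem_dvd_mult_iff)
      then have "degree y \<le> degree (u$1)" using u1 by (intro dvd_imp_degree_le)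
      then show ?thesis unfolding nw' using True u1 by (simp add: nu_Lam)
    next
      case False
      then show ?thesis unfolding nw' using k by (simp add: nu_Lam min_def)
    qed
  qed
  have ag: "amax ?g = int k" "ht ?g = int k" using \<gamma> by (simp_all add: amax_em amax_Lam ht_em ht_Lam)
  have h: "ht (em ?M ** ?g) = ht ?g - int (degree y)"
    unfolding ht_def am ag using y0 d by (simp add: det_mul pf_subdegree)
  have n: "nat (ht (em ?M ** ?g)) = k - degree y" unfolding h ag using k by simp
  show ?thesis unfolding eis_dif_def eis_pot_def n am ag by simp
qed

text \<open>Up the cusp from height \<open>k\<close>, \<open>eis_dif\<close> changes by
  \<open>(Q - 1) * (Q ^ degree y - 1)\<close> times \<open>- (Q ^ Suc k)\<close> at
  \<open>\<infinity>\<close> and times \<open>Q ^ (Suc k - degree y)\<close> at \<open>0\<close>.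
  The flow times \<open>|P|\<close> is \<open>(Q - 1) ^ 2\<close> times the same powers with
  opposite signs. So these two coefficients cancel the values at both cusps at once.\<close>

definition eis_flow :: "'a::{field,finite} poly \<Rightarrow> 'a poly \<Rightarrow> 'a edge \<Rightarrow> int" where
  "eis_flow P y e = (if e \<in> edges then (Q TYPE('a) - 1) * (vfun (eis_dif y) (snd e) - vfun (eis_dif y) (fst e))
    + (Q TYPE('a) ^ degree y - 1) * (int (card (Res P)) * gflow (Gamma0 y) (flow_wt P y) (fst e) (snd e)) else 0)"

definition eis_cochain :: "'a::{field,finite} poly \<Rightarrow> 'a poly \<Rightarrow> 'a edge \<Rightarrow> int" where
  "eis_cochain P y e = eis_flow P y (edge_act (M2 P 0 0 1) e)"

text \<open>What is left of \<open>eis_dif\<close> modulo \<open>Q\<close>, by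
  \<open>eis_dif_mod\<close>.\<close>

definition amax_drop :: "'a::{field,finite} poly \<Rightarrow> 'a fls^2^2 \<Rightarrow> int" where
  "amax_drop y g = amax g - amax (em (M2 y 0 0 1) ** g)"

lemma vtx_nb_edge: "det g \<noteq> 0 \<Longrightarrow> (vtx g, vtx (g ** nb i)) \<in> edges"
  by (auto simp: edges_iff)

lemma Gamma0_sub_GL2A: "Gamma0 y \<subseteq> GL2A"
  using Gamma0_GL2A by blast

lemma prime_coprime_iff: "prime_elem (q :: 'a::field poly) \<Longrightarrow> \<not> q dvd n \<Longrightarrow> coprime q n"
  using prime_cop by (simp add: cop_iff)

text \<open>Moving \<open>diag(N, 1)\<close> past the representatives replaces \<open>b\<close> by
  \<open>N * b\<close>, a permutation of the residues modulo \<open>q\<close>.\<close>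

lemma hecke_amax_diag:
  fixes q :: "'a::{field,finite} poly"
  assumes q: "prime_elem q" and g: "det g \<noteq> 0" and N: "\<not> q dvd N"
  shows "Q TYPE('a) dvd amax (em (M2 N 0 0 1) ** (em (M2 q 0 0 1) ** g))
    + (\<Sum>b\<in>Res q. amax (em (M2 N 0 0 1) ** (em (M2 1 b 0 q) ** g))) - amax (em (M2 N 0 0 1) ** g) - int (degree q)"
proof -
  have q0: "q \<noteq> 0" and N0: "N \<noteq> 0" using q N by auto
  define g' where "g' = em (M2 N 0 0 1) ** g"
  have g': "det g' \<noteq> 0" using N0 g by (simp add: g'_def det_mul)
  define h where "h z = amax (em (M2 1 z 0 q) ** g')" for z
  have 1: "em (M2 N 0 0 1) ** (em (M2 q 0 0 1) ** g) = em (M2 q 0 0 1) ** g'"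
    unfolding g'_def matrix_mul_assoc em_mult[symmetric] by (simp add: M2_mult mult.commute)
  have 2: "amax (em (M2 N 0 0 1) ** (em (M2 1 b 0 q) ** g)) = h (N * b)" for b
    unfolding h_def g'_def matrix_mul_assoc em_mult[symmetric] by (simp add: M2_mult)
  have per: "h (b + x * q) = h b" for b x
  proof -
    have "M2 1 (b + x * q) 0 q = M2 1 x 0 1 ** M2 1 b 0 q" by (simp add: M2_mult)
    then have "h (b + x * q) = amax (em (M2 1 x 0 1) ** (em (M2 1 b 0 q) ** g'))"
      unfolding h_def by (simp add: em_mult matrix_mul_assoc)
    also have "\<dots> = h b" unfolding h_def using q0 g' by (intro amax_em) (simp_all add: det_mul GL2A_def)
    finally show ?thesis .
  qed
  have "(\<Sum>b\<in>Res q. h (N * b)) = (\<Sum>b\<in>Res q. h b)"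
  proof (rule sum_Res_perm[OF q0 per])
    fix b c assume "b \<in> Res q" "c \<in> Res q" "q dvd N * b - N * c"
    then show "b = c" using q N by (intro Res_eqI) (auto simp: right_diff_distrib[symmetric] prime_elem_dvd_mult_iff)
  qed
  then show ?thesis using hecke_amax[OF q g'] unfolding 1 2 h_def g'_def[symmetric] by simp
qed

context
  fixes P y :: "'a::{field,finite} poly"
  assumes P: "monic P" "prime_elem P" and y: "monic y" "prime_elem y"
begin

lemma y_nz: "y \<noteq> 0" and P_nz: "P \<noteq> 0"
  using P y by simp_all

lemma eis_flow_vtx:
  assumes "det g \<noteq> 0" "det h \<noteq> 0" "(vtx g, vtx h) \<in> edges"
  shows "eis_flow P y (vtx g, vtx h) = (Q TYPE('a) - 1) * (eis_dif y h - eis_dif y g)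
    + (Q TYPE('a) ^ degree y - 1) * (int (card (Res P)) * gflow (Gamma0 y) (flow_wt P y) (vtx g) (vtx h))"
  using assms vfun_vtx[OF eis_dif_vinv[OF y_nz]] by (simp add: eis_flow_def)

lemma eis_flow_nb:
  assumes "det g \<noteq> 0"
  shows "eis_flow P y (vtx g, vtx (g ** nb i)) = (Q TYPE('a) - 1) * (eis_dif y (g ** nb i) - eis_dif y g)
    + (Q TYPE('a) ^ degree y - 1) * (int (card (Res P)) * gflow (Gamma0 y) (flow_wt P y) (vtx g) (vtx (g ** nb i)))"
  using assms by (intro eis_flow_vtx vtx_nb_edge) (simp_all add: det_mul)

lemma eis_flow_harmonic: "harmonic (eis_flow P y)"
  unfolding harmonic_def
proof (intro conjI allI impI ballI)
  fix e :: "'a edge" assume "e \<notin> edges"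
  then show "eis_flow P y e = 0" by (simp add: eis_flow_def)
next
  fix v w :: "'a vertex" assume e: "(v, w) \<in> edges"
  then show "eis_flow P y (v, w) + eis_flow P y (w, v) = 0"
    using edges_sym[OF e] gflow_antisym[of "Gamma0 y" "flow_wt P y" w v] by (simp add: eis_flow_def algebra_simps)
next
  fix v :: "'a vertex" assume "v \<in> vertices"
  then obtain g where g: "det g \<noteq> 0" "v = vtx g" by (elim vertices_cases)
  have c: "int (card (UNIV :: 'a option set)) = Q TYPE('a) + 1" by (simp add: Q_def)
  have "(\<Sum>i\<in>(UNIV :: 'a option set). eis_dif y (g ** nb i) - eis_dif y g) = 0"
    unfolding sum_subtractf eis_dif_harmonic[OF y_nz g(1)] sum_constant c by simp
  moreover have "(\<Sum>i\<in>UNIV. gflow (Gamma0 y) (flow_wt P y) (vtx g) (vtx (g ** nb i))) = 0"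
    by (rule gflow_harmonic[OF Gamma0_sub_GL2A g(1)])
  ultimately show "(\<Sum>w | (v, w) \<in> edges. eis_flow P y (v, w)) = 0"
    unfolding g(2) sum_nb[OF g(1)] eis_flow_nb[OF g(1)] sum.distrib sum_distrib_left[symmetric] by simp
qed

lemma eis_flow_cusp:
  assumes \<gamma>: "\<gamma> \<in> GL2A" and k: "degree P + degree y \<le> k"
  shows "eis_flow P y (vtx (em \<gamma> ** Lam k), vtx (em \<gamma> ** Lam (Suc k))) = 0"
proof -
  have d: "det (em \<gamma> ** Lam j) \<noteq> 0" for j using \<gamma> by (simp add: det_mul)
  have e: "(vtx (em \<gamma> ** Lam k), vtx (em \<gamma> ** Lam (Suc k))) \<in> edges"
    using vtx_nb_edge[OF d, of k None] unfolding Lam_nb_None .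
  show ?thesis
  proof (cases "y dvd \<gamma>$2$1")
    case True
    then have g: "\<gamma> \<in> Gamma0 y" using \<gamma> by (simp add: Gamma0_def GL2A_def)
    have k': "degree P \<le> k" using k by simp
    show ?thesis unfolding eis_flow_vtx[OF d d e] eis_dif_cusp_inf[OF y_nz g] gflow_cusp_inf[OF P y g k']
      by (simp add: power_add power2_eq_square algebra_simps)
  next
    case False
    obtain j where j: "k = j + degree y" using k by (metis add.commute add_leD2 le_Suc_ex)
    have k': "degree y \<le> k" "degree y \<le> Suc k" using k by simp_all
    have s: "k - degree y = j" "Suc k - degree y = Suc j" unfolding j by simp_all
    show ?thesis
      unfolding eis_flow_vtx[OF d d e] eis_dif_cusp_zero[OF y(2) \<gamma> False k'(1)] eis_dif_cusp_zero[OF y(2) \<gamma> False k'(2)] gflow_cusp_zero[OF P y \<gamma> False k] s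
      unfolding j by (simp add: power_add power2_eq_square algebra_simps)
  qed
qed

text \<open>Left multiplication by the matrix permutes \<open>Gamma0 y\<close> and preserves the
  weights by \<open>flow_wt_left\<close>; the potential part is invariant under all of
  \<open>Gamma0 y\<close>.\<close>

lemma eis_flow_conj:
  assumes \<gamma>: "M2 a (P * b) (P * y * c) d \<in> GL2A" and e: "e \<in> edges"
  shows "eis_flow P y (edge_act (M2 a (P * b) (P * y * c) d) e) = eis_flow P y e"
proof -
  let ?\<gamma> = "M2 a (P * b) (P * y * c) d"
  obtain g i where g: "det g \<noteq> 0" "e = (vtx g, vtx (g ** nb i))" using e by (elim edges_cases)
  have g': "det (g ** nb i) \<noteq> 0" using g by (simp add: det_mul)
  have \<gamma>0: "?\<gamma> \<in> Gamma0 y" using \<gamma> by (simp add: Gamma0_def GL2A_def)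
  obtain \<delta> where \<delta>: "\<delta> \<in> Gamma0 y" "\<delta> ** ?\<gamma> = mat 1" using Gamma0_inverse[OF \<gamma>0] by blast
  have iff: "?\<gamma> ** \<tau> \<in> Gamma0 y \<longleftrightarrow> \<tau> \<in> Gamma0 y" for \<tau>
    using Gamma0_mult[OF \<gamma>0, of \<tau>] Gamma0_mult[OF \<delta>(1), of "?\<gamma> ** \<tau>"] by (auto simp: matrix_mul_assoc \<delta>(2))
  have "gflow (Gamma0 y) (flow_wt P y) (vtx (em ?\<gamma> ** g)) (vtx (em ?\<gamma> ** (g ** nb i)))
      = (\<Sum>\<tau> | \<tau> \<in> Gamma0 y \<and> geo \<tau> (g ** nb i) \<noteq> geo \<tau> g. flow_wt P y (?\<gamma> ** \<tau>) * (geo \<tau> (g ** nb i) - geo \<tau> g))"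
    using gflow_translate[OF Gamma0_sub_GL2A[of y] \<gamma> g(1) g', where W = "flow_wt P y"] unfolding iff .
  also have "\<dots> = (\<Sum>\<tau> | \<tau> \<in> Gamma0 y \<and> geo \<tau> (g ** nb i) \<noteq> geo \<tau> g. flow_wt P y \<tau> * (geo \<tau> (g ** nb i) - geo \<tau> g))"
    by (rule sum.cong[OF refl]) (simp add: flow_wt_left[OF P y _ \<gamma>])
  also have "\<dots> = gflow (Gamma0 y) (flow_wt P y) (vtx g) (vtx (g ** nb i))"
    by (rule gflow_vtx[OF Gamma0_sub_GL2A g(1) g', symmetric])
  finally have G: "gflow (Gamma0 y) (flow_wt P y) (vtx (em ?\<gamma> ** g)) (vtx (em ?\<gamma> ** (g ** nb i))) = gflow (Gamma0 y) (flow_wt P y) (vtx g) (vtx (g ** nb i))" .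
  have d: "det (em ?\<gamma> ** g) \<noteq> 0" "det (em ?\<gamma> ** (g ** nb i)) \<noteq> 0" using \<gamma> g(1) g' det_em_GL2A[OF \<gamma>] by (simp_all only: det_mul) simp_all
  have "edge_act ?\<gamma> e \<in> edges" using e edge_act_edges[OF GL2A_det[OF \<gamma>]] by blast
  then have e': "(vtx (em ?\<gamma> ** g), vtx (em ?\<gamma> ** (g ** nb i))) \<in> edges" unfolding g(2) edge_act_vtx .
  show ?thesis
    unfolding g(2) edge_act_vtx eis_flow_vtx[OF d e'] eis_flow_nb[OF g(1)] G eis_dif_Gamma0[OF y_nz g(1) \<gamma>0] eis_dif_Gamma0[OF y_nz g' \<gamma>0] ..
qed

lemma det_emP: "det (em (M2 P 0 0 1)) \<noteq> 0"
  using P_nz by simp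

lemma eis_cochain_vtx: "eis_cochain P y (vtx g, vtx (g ** nb i)) = eis_flow P y (vtx (em (M2 P 0 0 1) ** g), vtx (em (M2 P 0 0 1) ** g ** nb i))"
  by (simp add: eis_cochain_def edge_act_vtx matrix_mul_assoc)

lemma eis_cochain_H0:
  assumes m: "m \<noteq> 0" "y dvd m"
  shows "eis_cochain P y \<in> H0 (P ^ 2 * m)"
proof (rule H0_I)
  let ?M = "M2 P 0 0 1 :: 'a poly^2^2"
  show "P ^ 2 * m \<noteq> 0" using m P_nz by simp
  show "harmonic (eis_cochain P y)"
    unfolding harmonic_def
  proof (intro conjI allI impI ballI)
    fix e :: "'a edge" assume "e \<notin> edges"
    then show "eis_cochain P y e = 0" using P_nz by (simp add: eis_cochain_def eis_flow_def)
  next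
    fix v w :: "'a vertex" assume "(v, w) \<in> edges"
    then have "edge_act ?M (v, w) \<in> edges" using P_nz by simp
    then show "eis_cochain P y (v, w) + eis_cochain P y (w, v) = 0"
      using harmonic_flip[OF eis_flow_harmonic] by (simp add: eis_cochain_def edge_act_def)
  next
    fix v :: "'a vertex" assume "v \<in> vertices"
    then obtain g where g: "det g \<noteq> 0" "v = vtx g" by (elim vertices_cases)
    have "det (em ?M ** g) \<noteq> 0" using g(1) det_emP by (simp add: det_mul)
    then show "(\<Sum>w | (v, w) \<in> edges. eis_cochain P y (v, w)) = 0"
      unfolding g(2) sum_nb[OF g(1)] eis_cochain_vtx by (rule harmonic_nb[OF eis_flow_harmonic])
  qed
  show "invariant (Gamma0 (P ^ 2 * m)) (eis_cochain P y)"
    unfolding invariant_def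
  proof (intro ballI)
    fix \<gamma> :: "'a poly^2^2" and e :: "'a edge" assume \<gamma>: "\<gamma> \<in> Gamma0 (P ^ 2 * m)" and e: "e \<in> edges"
    obtain a b c d where g: "\<gamma> = M2 a b c d" by (rule M2_cases)
    have "P ^ 2 * m dvd c" and u: "(a * d - b * c) dvd 1" using \<gamma> by (simp_all add: Gamma0_def g)
    then obtain t where t: "c = P ^ 2 * m * t" by (elim dvdE)
    obtain z where z: "m = y * z" using m(2) by (elim dvdE)
    let ?\<gamma> = "M2 a (P * b) (P * y * (z * t)) d"
    have c: "c = P * (P * y * (z * t))" by (simp add: t z power2_eq_square mult_ac)
    have G: "?\<gamma> \<in> GL2A" using u by (simp add: GL2A_def c mult_ac)
    have "?M ** \<gamma> = ?\<gamma> ** ?M" unfolding g c by (simp add: M2_mult mult_ac)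
    then have "eis_cochain P y (edge_act \<gamma> e) = eis_flow P y (edge_act ?\<gamma> (edge_act ?M e))" by (simp add: eis_cochain_def edge_act_mult)
    also have "\<dots> = eis_cochain P y e" unfolding eis_cochain_def using e P_nz by (intro eis_flow_conj[OF G]) simp
    finally show "eis_cochain P y (edge_act \<gamma> e) = eis_cochain P y e" .
  qed
  \<comment> \<open>\<open>diag(P, 1)\<close> lowers heights by at most \<open>degree P\<close>,
    which adds to the bound \<open>degree P + degree y\<close> from
    \<open>eis_flow_cusp\<close>.\<close>
  show "eis_cochain P y (vtx g, vtx (g ** nb i)) = 0" if g: "det g \<noteq> 0" "int (2 * degree P + degree y) < ht g" for g i
    unfolding eis_cochain_vtx
  proof (rule up_edges_vanish[OF eis_flow_harmonic, of "degree P + degree y"])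
    show "eis_flow P y (vtx (em \<gamma> ** Lam k), vtx (em \<gamma> ** Lam (Suc k))) = 0" if "\<gamma> \<in> GL2A" "degree P + degree y \<le> k" for \<gamma> k
      using eis_flow_cusp that by blast
    show "det (em ?M ** g) \<noteq> 0" using g(1) det_emP by (simp add: det_mul)
    show "int (degree P + degree y) < ht (em ?M ** g)" using ht_mult_lower[of ?M g] P_nz g by simp
  qed
qed

lemma deg_P_pos: "degree P > 0" and deg_y_pos: "degree y > 0"
  using P(2) y(2) by (auto intro: prime_degree_pos)

text \<open>Modulo \<open>Q\<close> the coefficient \<open>Q - 1\<close> is \<open>-1\<close> and
  \<open>card (Res P)\<close> is \<open>0\<close>, so the correcting flow disappears.\<close>

lemma eis_flow_mod:
  assumes g: "det g \<noteq> 0"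
  shows "Q TYPE('a) dvd eis_flow P y (vtx g, vtx (g ** nb i)) + (amax_drop y (g ** nb i) - amax_drop y g)"
proof -
  let ?Q = "Q TYPE('a)"
  define G where "G = gflow (Gamma0 y) (flow_wt P y) (vtx g) (vtx (g ** nb i))"
  have 1: "?Q dvd eis_dif y (g ** nb i) - amax_drop y (g ** nb i)" "?Q dvd eis_dif y g - amax_drop y g" unfolding amax_drop_def by (rule eis_dif_mod)+
  have 2: "?Q dvd (?Q ^ degree y - 1) * (int (card (Res P)) * G)" using card_Res_Q[OF deg_P_pos] by simp
  have "eis_flow P y (vtx g, vtx (g ** nb i)) + (amax_drop y (g ** nb i) - amax_drop y g) =
      ?Q * (eis_dif y (g ** nb i) - eis_dif y g) - (eis_dif y (g ** nb i) - amax_drop y (g ** nb i)) + (eis_dif y g - amax_drop y g)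
      + (?Q ^ degree y - 1) * (int (card (Res P)) * G)"
    unfolding eis_flow_nb[OF g] G_def by (simp add: algebra_simps)
  then show ?thesis using 1 2 by (metis dvd_add dvd_diff dvd_triv_left)
qed

lemma eis_cochain_mod:
  assumes g: "det g \<noteq> 0"
  shows "Q TYPE('a) dvd eis_cochain P y (vtx g, vtx (g ** nb i))
    + (amax_drop y (em (M2 P 0 0 1) ** (g ** nb i)) - amax_drop y (em (M2 P 0 0 1) ** g))"
  using eis_flow_mod[of "em (M2 P 0 0 1) ** g" i] g P_nz unfolding eis_cochain_vtx by (simp add: det_mul matrix_mul_assoc)

text \<open>The inhomogeneous term \<open>degree q\<close> of \<open>hecke_amax_diag\<close> is the
  same for \<open>N = P\<close> and \<open>N = P * y\<close> and cancels.\<close>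

lemma hecke_amax_drop:
  assumes q: "prime_elem q" and g: "det g \<noteq> 0" and N: "\<not> q dvd P * y"
  shows "Q TYPE('a) dvd amax_drop y (em (M2 P 0 0 1) ** (em (M2 q 0 0 1) ** g))
    + (\<Sum>b\<in>Res q. amax_drop y (em (M2 P 0 0 1) ** (em (M2 1 b 0 q) ** g))) - amax_drop y (em (M2 P 0 0 1) ** g)"
proof -
  have e: "em (M2 y 0 0 1) ** (em (M2 P 0 0 1) ** h) = em (M2 (P * y) 0 0 1) ** h" for h
    unfolding matrix_mul_assoc em_mult[symmetric] by (simp add: M2_mult mult.commute)
  have nP: "\<not> q dvd P" using N by auto
  show ?thesis
    using dvd_diff[OF hecke_amax_diag[OF q g nP] hecke_amax_diag[OF q g N]]
    unfolding amax_drop_def e sum_subtractf by (simp add: algebra_simps)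
qed

text \<open>The eigenvalue \<open>|q| + 1\<close> is 1 modulo \<open>Q\<close>, since
  \<open>|q|\<close> is a positive power of \<open>Q\<close>.\<close>

lemma eis_cochain_hecke:
  assumes q: "monic q" "prime_elem q" "\<not> q dvd n" and n: "P * y dvd n" and e: "e \<in> edges"
  shows "Q TYPE('a) dvd hecke_op n q (eis_cochain P y) e - eis_cochain P y e"
proof -
  obtain g i where g: "det g \<noteq> 0" "e = (vtx g, vtx (g ** nb i))" using e by (elim edges_cases)
  have g': "det (g ** nb i) \<noteq> 0" using g by (simp add: det_mul)
  have N: "\<not> q dvd P * y" using q(3) n dvd_trans by blast
  have q0: "q \<noteq> 0" using q by simp
  let ?Q = "Q TYPE('a)"
  define c where "c h = amax_drop y (em (M2 P 0 0 1) ** h)" for h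
  define C where "C M = c (em M ** (g ** nb i)) - c (em M ** g)" for M
  define F where "F M = eis_cochain P y (edge_act M e)" for M
  have FM: "?Q dvd F M + C M" if "det M \<noteq> 0" for M
    using eis_cochain_mod[of "em M ** g" i] g(1) that unfolding C_def c_def F_def g(2) edge_act_vtx by (simp add: det_mul matrix_mul_assoc)
  have 1: "?Q dvd F (M2 q 0 0 1) + C (M2 q 0 0 1)" using q0 by (intro FM) simp
  have 2: "?Q dvd (\<Sum>b\<in>Res q. F (M2 1 b 0 q) + C (M2 1 b 0 q))" using q0 by (intro dvd_sum FM) simp
  have 3: "?Q dvd eis_cochain P y e + (c (g ** nb i) - c g)" using eis_cochain_mod[OF g(1), of i] unfolding c_def g(2) .
  have 4: "?Q dvd c (em (M2 q 0 0 1) ** h) + (\<Sum>b\<in>Res q. c (em (M2 1 b 0 q) ** h)) - c h" if "det h \<noteq> 0" for h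
    using hecke_amax_drop[OF q(2) that N] unfolding c_def .
  have "hecke_op n q (eis_cochain P y) e = F (M2 q 0 0 1) + (\<Sum>b\<in>Res q. F (M2 1 b 0 q))"
    unfolding hecke_op_def F_def by (rule sum_hecke_mats_prime[OF q])
  then have "hecke_op n q (eis_cochain P y) e - eis_cochain P y e = (F (M2 q 0 0 1) + C (M2 q 0 0 1)) + (\<Sum>b\<in>Res q. F (M2 1 b 0 q) + C (M2 1 b 0 q))
      - (eis_cochain P y e + (c (g ** nb i) - c g))
      - (c (em (M2 q 0 0 1) ** (g ** nb i)) + (\<Sum>b\<in>Res q. c (em (M2 1 b 0 q) ** (g ** nb i))) - c (g ** nb i))
      + (c (em (M2 q 0 0 1) ** g) + (\<Sum>b\<in>Res q. c (em (M2 1 b 0 q) ** g)) - c g)"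
    by (simp add: C_def sum.distrib sum_subtractf)
  then show ?thesis using 1 2 3 4[OF g'] 4[OF g(1)] by (simp only: dvd_add dvd_diff)
qed

text \<open>The witness is the edge that \<open>diag(P, 1)\<close> carries to the edge from the
  standard vertex to \<open>vtx (nb (Some 0))\<close>. Along the latter \<open>amax\<close> stays 0,
  while after \<open>diag(y, 1)\<close> it falls from \<open>degree y\<close> to
  \<open>degree y - 1\<close>.\<close>

lemma eis_cochain_unit_value: "\<exists>e. Q TYPE('a) dvd eis_cochain P y e + 1"
proof -
  let ?M = "em (M2 P 0 0 1) :: 'a fls^2^2"
  let ?N = "nb (Some 0) :: 'a fls^2^2"
  have d: "det (inv2 ?M) \<noteq> 0" using det_emP by (rule det_inv2_nz)
  have c: "?M ** inv2 ?M = mat 1" using det_emP by (rule inv2_right)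
  have N: "?N = M2 fls_X 0 0 1" by (simp add: nb_def)
  have y': "poly_to_fls y \<noteq> 0" using y_nz by simp
  have X: "amax ?N = 0"
  proof -
    have "?N = mat fls_X ** (em Sw ** Lam 1) ** Sw"
      using monom_X[of 0, where 'a='a] unfolding N by (simp add: Lam_def em_M2 M2_mult mat_M2)
    moreover have "amax (mat fls_X ** (em Sw ** Lam 1) ** Sw :: 'a fls^2^2) = amax (em Sw ** Lam 1 :: 'a fls^2^2) - fls_subdegree (fls_X :: 'a fls)"
      using det_em_GL2A[OF Sw_GL2A] by (intro amax_scale Sw_GLO) (simp_all add: det_mul)
    ultimately show ?thesis by (simp add: amax_em Sw_GL2A amax_Lam)
  qed
  obtain j where j: "degree y = Suc j" using deg_y_pos by (metis Suc_pred)
  have 1: "amax (mat 1 :: 'a fls^2^2) = 0" using amax_diag[of 1 0] by (simp add: mat_M2)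
  have 2: "amax (em (M2 y 0 0 1) ** mat 1) = int (degree y)"
    using y_nz unfolding em_M2 by (simp add: amax_diag pf_subdegree)
  have 3: "amax (em (M2 y 0 0 1) ** ?N) = int j"
    using y_nz unfolding em_M2 N by (simp add: M2_mult amax_diag pf_subdegree j)
  have "amax_drop y ?N - amax_drop y (mat 1) = 1" unfolding amax_drop_def 1 2 3 X by (simp add: j)
  then show ?thesis using eis_cochain_mod[OF d, of "Some 0"] unfolding matrix_mul_assoc c by (auto simp only: matrix_mul_lid)
qed

end

lemma prime_dvd_card_field:
  assumes "CARD('a::{field,finite}) = p ^ r"
  shows "p dvd CARD('a)"
proof -
  have "r \<noteq> 0"
  proof
    assume "r = 0"
    then obtain x where "(UNIV :: 'a set) = {x}" using assms by (metis card_1_singletonE power_0)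
    then have "(0::'a) = 1" by (metis UNIV_I singletonD)
    then show False by simp
  qed
  then show ?thesis using assms by (simp add: dvd_power)
qed

theorem theorem8p1:
  fixes P m n :: "'a::{field,finite} poly" and p r :: nat
  assumes "prime p" and "CARD('a) = p ^ r"
    and "monic P" and "prime_elem P"
    and "monic m" and "\<not> m dvd 1"
    and "n = P ^ 2 * m"
  shows "finite (carrier (hecke_algebra n Quot eisenstein_ideal n)) \<and>
         p dvd card (carrier (hecke_algebra n Quot eisenstein_ideal n)) \<and>
         finite (carrier (hecke_algebra0 n Quot eisenstein_ideal0 n)) \<and>
         p dvd card (carrier (hecke_algebra0 n Quot eisenstein_ideal0 n))"
proof -
  have m0: "m \<noteq> 0" and P0: "P \<noteq> 0" using assms by simp_all
  have dm: "degree m > 0" using assms(6) m0 deg0_unit by blast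
  have n0: "n \<noteq> 0" using assms(7) m0 P0 by simp
  have dn: "degree n > 0" using assms(7) m0 P0 dm by (simp add: degree_mult_eq)
  obtain y where y: "monic y" "prime_elem y" "y dvd m" using prime_factor_exists[OF dm] by blast
  define f where "f = eis_cochain P y"
  have f: "f \<in> H0 n" unfolding f_def assms(7) by (rule eis_cochain_H0[OF assms(3,4) y(1,2) m0 y(3)])
  have pQ: "int p dvd Q TYPE('a)" using prime_dvd_card_field[OF assms(2)] by (simp add: Q_def)
  obtain e0 where e0: "Q TYPE('a) dvd f e0 + 1" unfolding f_def using eis_cochain_unit_value[OF assms(3,4) y(1,2)] by blast
  have fe0: "\<not> int p dvd f e0"
  proof
    assume "int p dvd f e0"
    moreover have "int p dvd f e0 + 1" using pQ e0 dvd_trans by blast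
    ultimately have "int p dvd 1" by (metis dvd_add_right_iff)
    then show False using assms(1) by simp
  qed
  have Py: "P * y dvd n" unfolding assms(7) power2_eq_square using y(3) by (simp add: mult_dvd_mono mult.assoc)
  have cong: "int p dvd cgen n q f e" if q: "monic q" "prime_elem q" "\<not> q dvd n" for q e
  proof (cases "e \<in> edges")
    case True
    have dq: "degree q > 0" using q(2) by (rule prime_degree_pos)
    have "Q TYPE('a) dvd int (ideal_norm q)" using card_Res_Q[OF dq] q(1) by (simp add: ideal_norm_Res)
    moreover have "Q TYPE('a) dvd hecke_op n q f e - f e"
      unfolding f_def by (rule eis_cochain_hecke[OF assms(3,4) y(1,2) q Py True])
    moreover have "cgen n q f e = (hecke_op n q f e - f e) - int (ideal_norm q) * f e"
      by (simp add: cgen_app[OF n0 q(1) f] algebra_simps)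
    ultimately have "Q TYPE('a) dvd cgen n q f e" by (simp only: dvd_diff dvd_mult2)
    then show ?thesis using pQ dvd_trans by blast
  next
    case False
    then show ?thesis using H0_off[OF f] H0_off[OF hecke_op_H0[OF f q(1) n0]] by (simp add: cgen_app[OF n0 q(1) f])
  qed
  have *: "finite (carrier ((End_H0 n)\<lparr>carrier := generate_ring (End_H0 n) S\<rparr> Quot
        genideal ((End_H0 n)\<lparr>carrier := generate_ring (End_H0 n) S\<rparr>) (eisenstein_gens n))) \<and>
      p dvd card (carrier ((End_H0 n)\<lparr>carrier := generate_ring (End_H0 n) S\<rparr> Quot
        genideal ((End_H0 n)\<lparr>carrier := generate_ring (End_H0 n) S\<rparr>) (eisenstein_gens n)))"
    if S: "S \<subseteq> {hecke n m | m. monic m}" "\<And>q. monic q \<Longrightarrow> prime_elem q \<Longrightarrow> \<not> q dvd n \<Longrightarrow> hecke n q \<in> S" for S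
    using finite_quotient[OF n0 dn S] prime_dvd_quotient[OF n0 dn S assms(1) f fe0 cong] by blast
  have S1: "{hecke n m | m. monic m} \<subseteq> {hecke n m | m. monic m}"
    and S2: "\<And>q. monic q \<Longrightarrow> prime_elem q \<Longrightarrow> \<not> q dvd n \<Longrightarrow> hecke n q \<in> {hecke n m | m. monic m}" by blast+
  have S3: "{hecke n m | m. monic m \<and> coprime m n} \<subseteq> {hecke n m | m. monic m}"
    and S4: "\<And>q. monic q \<Longrightarrow> prime_elem q \<Longrightarrow> \<not> q dvd n \<Longrightarrow> hecke n q \<in> {hecke n m | m. monic m \<and> coprime m n}"
    using prime_coprime_iff by blast+
  show ?thesis
    unfolding hecke_algebra_def eisenstein_ideal_def hecke_algebra0_def eisenstein_ideal0_def
    using *[OF S1 S2] *[OF S3 S4] by blast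
qed

end
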